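(* Consider a two-phase composite with isotropic phases $\mathsf L_j=\sigma_j\otimes I_2+r_j\mathsf T$, $j=1,2$, with $\sigma_1=\theta_1\sigma_0$, $\sigma_2=\theta_2\sigma_0$, where $\theta_1,\theta_2>0$, $\sigma_0$ is symmetric positive definite, and \[ |r_1-r_2|<|\theta_1-\theta_2|\sqrt{\det\sigma_0}. \] Put $\rho=\dfrac{r_2-r_1}{\sqrt{\det\sigma_1}}$ and let $a_0$ be a real root of \[ (a_0^2+1)\rho=a_0\left(\frac{\theta_2^2}{\theta_1^2}-\rho^2-1\right). \] Let \[ \sigma^*=\Sigma\left(\frac{(1-a_0^2)\theta_1\theta_2}{\theta_2^2-\theta_1^2(\rho+a_0)^2}\right)=\Sigma\left(\frac{\theta_1}{\theta_2}(\rho a_0+1)\right). \] Then \[ \mathsf L^*=\frac{1-a_0^2}{\det\sigma^*-a_0^2}\,\sigma_1\otimes\sigma^*+\left(r_1+\frac{a_0(1-\det\sigma^* )\sqrt{\det\sigma_1}}{\det\sigma^*-a_0^2}\right)\mathsf T . \]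
   Context: Let $R_\perp=\begin{pmatrix}0&-1\\1&0\end{pmatrix}$ and let $I_2$ be the $2\times2$ identity. Let $\mathcal T=\mathbb R^2\oplus\mathbb R^2$. Operators on $\mathcal T$ are written as $2\times2$ block matrices with real $2\times 2$ blocks, and $A\otimes B$ is the block matrix with blocks $A_{ij}B$. Put $\mathsf T=R_\perp\otimes R_\perp$. The phases $\mathsf L_j$ are assumed positive definite: $\sigma_j$ is a real symmetric positive definite $2\times2$ matrix and $r_j\in\mathbb R$ with $r_j^2<\det\sigma_j$. A two-phase composite is given by a measurable partition of the period cell $[0,1]^2=A_1\cup A_2$ (the microstructure) and the periodic tensor field $\mathsf L(x)=\mathsf L_j$ for $x\in A_j$. Its effective tensor $\mathsf L^*$ is defined by $\mathsf L^*E_0=\int_{[0,1]^2}\mathsf L(x)E(x)\,dx$ for $E_0\in\mathcal T$, where $E=E_0+(\nabla\varphi_1,\nabla\varphi_2)$ with $\varphi_1,\varphi_2\in H^1_{\rm per}$ is the unique such field for which both $\mathbb R^2$-components of $\mathsf L E$ are divergence-free. For $h>0$, $\Sigma(h)$ is the effective ($2\times2$ symmetric) conductivity of the two-dimensional conducting composite with the same microstructure and conductivities $I_2$ on $A_1$ and $hI_2$ on $A_2$: $\Sigma(h)e_0=\int\sigma(e_0+\nabla\varphi)\,dx$ with $\nabla\cdot\sigma(e_0+\nabla\varphi)=0$, $\varphi\in H^1_{\rm per}$. *)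

theory Defs
  imports "HOL-Analysis.Analysis"
begin

section \<open>Block operators on pairs of planar vectors\<close>

text \<open>An element of \<open>\<real>\<^sup>2 \<oplus> \<real>\<^sup>2\<close> is \<open>E :: real^2^2\<close> whose two summands are \<open>E $ 1\<close> and \<open>E $ 2\<close>;
  an operator on this space is a \<open>2 \<times> 2\<close> array \<open>L\<close> whose blocks \<open>L $ i $ j\<close> are real matrices.\<close>

type_synonym block_op = "real^2^2^2^2"

definition block_apply :: "block_op \<Rightarrow> real^2^2 \<Rightarrow> real^2^2" where
  "block_apply L E = (\<chi> i. \<Sum>j\<in>UNIV. (L $ i $ j) *v (E $ j))"

definition kron :: "real^2^2 \<Rightarrow> real^2^2 \<Rightarrow> block_op" where
  "kron A B = (\<chi> i j. (A $ i $ j) *\<^sub>R B)"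

definition R_perp :: "real^2^2" where
  "R_perp = vector [vector [0, -1], vector [1, 0]]"

definition T_op :: block_op where
  "T_op = kron R_perp R_perp"

definition sym_pos_def :: "real^2^2 \<Rightarrow> bool" where
  "sym_pos_def A \<longleftrightarrow> transpose A = A \<and> (\<forall>x. x \<noteq> 0 \<longrightarrow> 0 < x \<bullet> (A *v x))"

definition isotropic_phase :: "real^2^2 \<Rightarrow> real \<Rightarrow> block_op" where
  "isotropic_phase \<sigma> r = kron \<sigma> (mat 1) + r *\<^sub>R T_op"

definition pos_def_phase :: "real^2^2 \<Rightarrow> real \<Rightarrow> bool" where
  "pos_def_phase \<sigma> r \<longleftrightarrow> sym_pos_def \<sigma> \<and> r\<^sup>2 < det \<sigma>"


section \<open>Periodic functions\<close>

definition unit_cell :: "(real^2) set" where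
  "unit_cell = {x. \<forall>i. 0 \<le> x $ i \<and> x $ i \<le> 1}"

abbreviation cell_measure :: "(real^2) measure" where
  "cell_measure \<equiv> lebesgue_on unit_cell"

primrec continuously_diff :: "nat \<Rightarrow> (real^2 \<Rightarrow> real) \<Rightarrow> bool" where
  "continuously_diff 0 f \<longleftrightarrow> continuous_on UNIV f"
| "continuously_diff (Suc k) f \<longleftrightarrow>
     (\<exists>g. (\<forall>x. GDERIV f x :> g x) \<and> (\<forall>i. continuously_diff k (\<lambda>x. g x $ i)))"

definition smooth_periodic :: "(real^2 \<Rightarrow> real) \<Rightarrow> bool" where
  "smooth_periodic f \<longleftrightarrow>
     (\<forall>k. continuously_diff k f) \<and> (\<forall>x i. f (x + axis i 1) = f x)"

definition square_integrable :: "(real^2 \<Rightarrow> 'a::euclidean_space) \<Rightarrow> bool" where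
  "square_integrable f \<longleftrightarrow>
     f \<in> borel_measurable cell_measure \<and> integrable cell_measure (\<lambda>x. (norm (f x))\<^sup>2)"

text \<open>\<open>H\<^sup>1\<^sub>p\<^sub>e\<^sub>r\<close> is the closure of the smooth periodic functions in the \<open>H\<^sup>1\<close> norm of the cell;
  \<open>H1_per \<phi> g\<close> says that \<open>\<phi>\<close> belongs to it and has weak gradient \<open>g\<close>.
  A periodic function is represented by its values on the cell, so values of \<open>\<phi>\<close> and \<open>g\<close>
  off the cell are irrelevant.\<close>

definition H1_per :: "(real^2 \<Rightarrow> real) \<Rightarrow> (real^2 \<Rightarrow> real^2) \<Rightarrow> bool" where
  "H1_per \<phi> g \<longleftrightarrow> square_integrable \<phi> \<and> square_integrable g \<and>
     (\<exists>\<psi> G. (\<forall>n. smooth_periodic (\<psi> n) \<and> (\<forall>x. GDERIV (\<psi> n) x :> G n x)) \<and>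
        (\<lambda>n::nat. \<integral>x. (\<psi> n x - \<phi> x)\<^sup>2 \<partial>cell_measure) \<longlonglongrightarrow> 0 \<and>
        (\<lambda>n. \<integral>x. (norm (G n x - g x))\<^sup>2 \<partial>cell_measure) \<longlonglongrightarrow> 0)"

text \<open>Distributional divergence of the periodic extension: tested with periodic functions, so that
  jumps of the normal component across the boundary of the cell count as divergence.\<close>

definition div_free :: "(real^2 \<Rightarrow> real^2) \<Rightarrow> bool" where
  "div_free J \<longleftrightarrow> square_integrable J \<and>
     (\<forall>\<psi> G. smooth_periodic \<psi> \<and> (\<forall>x. GDERIV \<psi> x :> G x) \<longrightarrow>
        (\<integral>x. J x \<bullet> G x \<partial>cell_measure) = 0)"


section \<open>Composites and effective tensors\<close>

definition microstructure :: "(real^2) set \<Rightarrow> (real^2) set \<Rightarrow> bool" where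
  "microstructure A1 A2 \<longleftrightarrow> A1 \<in> sets lebesgue \<and> A2 \<in> sets lebesgue \<and>
     A1 \<union> A2 = unit_cell \<and> A1 \<inter> A2 = {}"

definition two_phase :: "(real^2) set \<Rightarrow> (real^2) set \<Rightarrow> 'a::zero \<Rightarrow> 'a \<Rightarrow> real^2 \<Rightarrow> 'a" where
  "two_phase A1 A2 c1 c2 x = (if x \<in> A1 then c1 else if x \<in> A2 then c2 else 0)"

definition cell_field :: "(real^2 \<Rightarrow> block_op) \<Rightarrow> real^2^2 \<Rightarrow> (real^2 \<Rightarrow> real^2^2) \<Rightarrow> bool" where
  "cell_field L E0 E \<longleftrightarrow>
     (\<exists>\<phi>1 \<phi>2 g1 g2. H1_per \<phi>1 g1 \<and> H1_per \<phi>2 g2 \<and>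
        E = (\<lambda>x. E0 + vector [g1 x, g2 x])) \<and>
     (\<forall>i. div_free (\<lambda>x. block_apply (L x) (E x) $ i))"

text \<open>Ellipticity determines \<open>E\<close> only up to null sets, which do not affect the average of \<open>L E\<close>;
  the description therefore selects the operator rather than the field. The same applies to
  \<open>effective_conductivity\<close>.\<close>

definition effective_tensor :: "(real^2 \<Rightarrow> block_op) \<Rightarrow> block_op" where
  "effective_tensor L =
     (THE M. \<forall>E0. \<exists>E. cell_field L E0 E \<and>
        block_apply M E0 = (\<integral>x. block_apply (L x) (E x) \<partial>cell_measure))"

definition conductivity_field :: "(real^2 \<Rightarrow> real^2^2) \<Rightarrow> real^2 \<Rightarrow> (real^2 \<Rightarrow> real^2) \<Rightarrow> bool" where
  "conductivity_field \<sigma> e0 e \<longleftrightarrow>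
     (\<exists>\<phi> g. H1_per \<phi> g \<and> e = (\<lambda>x. e0 + g x)) \<and> div_free (\<lambda>x. \<sigma> x *v e x)"

definition effective_conductivity :: "(real^2 \<Rightarrow> real^2^2) \<Rightarrow> real^2^2" where
  "effective_conductivity \<sigma> =
     (THE S. \<forall>e0. \<exists>e. conductivity_field \<sigma> e0 e \<and>
        S *v e0 = (\<integral>x. \<sigma> x *v e x \<partial>cell_measure))"

definition Sigma_eff :: "(real^2) set \<Rightarrow> (real^2) set \<Rightarrow> real \<Rightarrow> real^2^2" where
  "Sigma_eff A1 A2 h = effective_conductivity (two_phase A1 A2 (mat 1) (h *\<^sub>R mat 1))"

end

theory Submission
  imports Defs
begin

text \<open>Rotating a plane divergence-free field by \<open>R\<close> makes it curl-free. For \<open>\<sigma>0 = I\<close>, \<open>r1 = 0\<close> the two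
  components of the field and their two rotated fluxes are therefore four curl-free fields, and any
  constant linear combination of them is again curl-free. The quadratic equation for \<open>a0\<close> says
  exactly that two such combinations solve, independently of each other, the scalar problem with
  conductivities \<open>1\<close> and \<open>h\<close>; inverting the change of unknowns and averaging gives \<open>L\<^sup>*\<close>. The inversion
  needs \<open>det \<sigma>\<^sup>* \<noteq> a0\<^sup>2\<close>, which holds because \<open>det \<sigma>\<^sup>*\<close> lies between \<open>1\<close> and \<open>h\<^sup>2\<close>, and \<open>a0\<^sup>2\<close> does not.
  That the rotated flux of a scalar solution is a constant plus a periodic gradient follows from
  projecting it onto gradients: the remainder is orthogonal to all Fourier modes.\<close>

section \<open>Square-integrable fields on the cell\<close>

text \<open>Origin of the quadratic: normalise to \<open>\<sigma>1 = I\<close>,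
  \<open>r1 = 0\<close>, \<open>\<sigma>2 = t I\<close>, \<open>r2 = \<rho>\<close>, with field
  components \<open>F1\<close>, \<open>F2\<close> and fluxes \<open>K1\<close>, \<open>K2\<close>.
  For every \<open>a\<close> the field \<open>p' = R K2 - a F1\<close> is curl-free and
  \<open>Q' = R F2 - a K1\<close> is divergence-free. In phase 1 they coincide, since
  \<open>K = F\<close>. In phase 2, \<open>p' = t R F2 - (a + \<rho>) F1\<close> and
  \<open>Q' = (1 + \<rho> a) R F2 - t a F1\<close>, so \<open>Q' = h p'\<close> for all fields means
  \<open>t h = 1 + \<rho> a\<close> and \<open>t a = h (a + \<rho>)\<close>. Eliminating
  \<open>h\<close> leaves \<open>(a + \<rho>) (1 + \<rho> a) = a t^2\<close>, the equation for
  \<open>a0\<close>. The bound on \<open>|r1 - r2|\<close> becomes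
  \<open>|\<rho>| < |t - 1|\<close>; it excludes \<open>a^2 = 1\<close>, where the change of
  unknowns degenerates, and forces \<open>h > 0\<close>. Both effective tensors are definite
  descriptions, so existence and uniqueness have to be supplied. The coupled field is not found
  variationally but assembled from two scalar solutions, which come from minimising an energy;
  uniqueness of mean fluxes comes from positivity.\<close>

lemma unit_cell_eq_cbox: "unit_cell = cbox 0 1"
  by (auto simp: unit_cell_def mem_box_cart)

lemma unit_cell_measurable [measurable, simp]: "unit_cell \<in> sets lebesgue"
  by (simp add: unit_cell_eq_cbox)

lemma space_cell [simp]: "space cell_measure = unit_cell"
  by (simp add: space_restrict_space)

lemma one_inner_Basis: "b \<in> Basis \<Longrightarrow> (1 :: real^'n) \<bullet> b = 1"
  by (auto simp: Basis_vec_def inner_axis)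

text \<open>With total mass 1, integrals over the cell are averages.\<close>

lemma emeasure_cell: "emeasure cell_measure (space cell_measure) = 1"
proof -
  have "emeasure lborel (cbox 0 (1 :: real^2)) = (\<Prod>b\<in>(Basis :: (real^2) set). (1 - 0) \<bullet> b)"
    by (subst emeasure_lborel_cbox) (auto simp: one_inner_Basis)
  also have "\<dots> = 1" by (simp add: one_inner_Basis)
  finally show ?thesis by (simp add: emeasure_restrict_space unit_cell_eq_cbox)
qed

lemma finite_measure_cell: "finite_measure cell_measure"
  by (rule finite_measureI) (simp only: emeasure_cell, simp)

lemma measure_cell [simp]: "measure cell_measure unit_cell = 1"
  using emeasure_cell by (simp add: measure_def)

lemma integrable_cell_const [simp, intro]:
  "integrable cell_measure (\<lambda>x. c :: 'a::{banach,second_countable_topology})"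
  by (rule finite_measure.integrable_const[OF finite_measure_cell])

lemma integral_cell_const [simp]:
  "(\<integral>x. c \<partial>cell_measure) = (c :: 'a::{banach,second_countable_topology})"
  by simp

text \<open>Domination is asked on the cell only, because values of a field off the cell are
  arbitrary.\<close>

lemma square_integrable_bound:
  fixes f :: "real^2 \<Rightarrow> 'a::euclidean_space" and g :: "real^2 \<Rightarrow> 'b::euclidean_space"
  assumes g: "square_integrable g" and f: "f \<in> borel_measurable cell_measure"
    and le: "\<And>x. x \<in> unit_cell \<Longrightarrow> norm (f x) \<le> c * norm (g x)"
  shows "square_integrable f"
  unfolding square_integrable_def
proof
  show "integrable cell_measure (\<lambda>x. (norm (f x))\<^sup>2)"
  proof (rule Bochner_Integration.integrable_bound)
    show "integrable cell_measure (\<lambda>x. c\<^sup>2 * (norm (g x))\<^sup>2)"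
      using g by (auto simp: square_integrable_def)
    show "(\<lambda>x. (norm (f x))\<^sup>2) \<in> borel_measurable cell_measure"
      using f by measurable
    show "AE x in cell_measure. norm ((norm (f x))\<^sup>2) \<le> norm (c\<^sup>2 * (norm (g x))\<^sup>2)"
    proof (rule AE_I2)
      fix x assume "x \<in> space cell_measure"
      then have "(norm (f x))\<^sup>2 \<le> (c * norm (g x))\<^sup>2"
        using le by (intro power_mono) auto
      then show "norm ((norm (f x))\<^sup>2) \<le> norm (c\<^sup>2 * (norm (g x))\<^sup>2)"
        by (simp add: power_mult_distrib)
    qed
  qed
qed (fact f)

lemma square_integrable_measurable [dest]:
  "square_integrable f \<Longrightarrow> f \<in> borel_measurable cell_measure"
  by (simp add: square_integrable_def)

lemma square_integrable_sq [dest]: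
  "square_integrable f \<Longrightarrow> integrable cell_measure (\<lambda>x. (norm (f x))\<^sup>2)"
  by (simp add: square_integrable_def)

lemma square_integrable_cong:
  assumes "\<And>x. x \<in> unit_cell \<Longrightarrow> f x = g x"
  shows "square_integrable f = square_integrable g"
proof -
  have "f \<in> borel_measurable cell_measure \<longleftrightarrow> g \<in> borel_measurable cell_measure"
    by (intro measurable_cong) (simp add: assms)
  moreover have "integrable cell_measure (\<lambda>x. (norm (f x))\<^sup>2) \<longleftrightarrow> integrable cell_measure (\<lambda>x. (norm (g x))\<^sup>2)"
    by (intro Bochner_Integration.integrable_cong) (auto simp: assms)
  ultimately show ?thesis by (simp add: square_integrable_def)
qed

lemma integrable_inner_square_integrable:
  fixes f g :: "real^2 \<Rightarrow> 'a::euclidean_space"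
  assumes f: "square_integrable f" and g: "square_integrable g"
  shows "integrable cell_measure (\<lambda>x. f x \<bullet> g x)"
proof (rule Bochner_Integration.integrable_bound)
  show "integrable cell_measure (\<lambda>x. (norm (f x))\<^sup>2 + (norm (g x))\<^sup>2)"
    using f g by auto
  show "(\<lambda>x. f x \<bullet> g x) \<in> borel_measurable cell_measure"
    using f g by (auto intro!: borel_measurable_inner)
  show "AE x in cell_measure. norm (f x \<bullet> g x) \<le> norm ((norm (f x))\<^sup>2 + (norm (g x))\<^sup>2)"
  proof (rule AE_I2)
    fix x
    have "\<bar>f x \<bullet> g x\<bar> \<le> norm (f x) * norm (g x)" by (rule Cauchy_Schwarz_ineq2)
    also have "\<dots> \<le> (norm (f x))\<^sup>2 + (norm (g x))\<^sup>2"
      using sum_squares_bound[of "norm (f x)" "norm (g x)"]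
        mult_nonneg_nonneg[OF norm_ge_zero[of "f x"] norm_ge_zero[of "g x"]] by linarith
    finally show "norm (f x \<bullet> g x) \<le> norm ((norm (f x))\<^sup>2 + (norm (g x))\<^sup>2)" by simp
  qed
qed

lemma square_integrable_const [simp, intro]: "square_integrable (\<lambda>x. c)"
  by (simp add: square_integrable_def)

lemma square_integrable_add [intro]:
  fixes f g :: "real^2 \<Rightarrow> 'a::euclidean_space"
  assumes f: "square_integrable f" and g: "square_integrable g"
  shows "square_integrable (\<lambda>x. f x + g x)"
  unfolding square_integrable_def
proof
  show "(\<lambda>x. f x + g x) \<in> borel_measurable cell_measure"
    using f g by (auto intro!: borel_measurable_add)
  have "(norm (f x + g x))\<^sup>2 = (norm (f x))\<^sup>2 + 2 * (f x \<bullet> g x) + (norm (g x))\<^sup>2" for x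
    by (simp add: power2_norm_eq_inner algebra_simps inner_commute)
  then show "integrable cell_measure (\<lambda>x. (norm (f x + g x))\<^sup>2)"
    using integrable_inner_square_integrable[OF f g] square_integrable_sq[OF f] square_integrable_sq[OF g]
    by simp
qed

lemma square_integrable_bounded_linear:
  assumes f: "square_integrable f" and A: "bounded_linear A"
  shows "square_integrable (\<lambda>x. A (f x))"
proof -
  obtain K where K: "\<And>y. norm (A y) \<le> norm y * K"
    using bounded_linear.bounded[OF A] by auto
  have "A \<in> borel_measurable borel"
    by (intro borel_measurable_continuous_onI linear_continuous_on A)
  then have "(\<lambda>x. A (f x)) \<in> borel_measurable cell_measure"
    by (rule measurable_compose[OF square_integrable_measurable[OF f]])
  then show ?thesis
    by (rule square_integrable_bound[OF f]) (use K in \<open>simp add: mult.commute\<close>)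
qed

lemma square_integrable_scaleR [intro]:
  "square_integrable f \<Longrightarrow> square_integrable (\<lambda>x. c *\<^sub>R f x)"
  by (erule square_integrable_bounded_linear) (rule bounded_linear_scaleR_right)

lemma square_integrable_minus [intro]:
  "square_integrable f \<Longrightarrow> square_integrable (\<lambda>x. - f x)"
  using square_integrable_scaleR[of f "-1"] by simp

lemma square_integrable_diff [intro]:
  "square_integrable f \<Longrightarrow> square_integrable g \<Longrightarrow> square_integrable (\<lambda>x. f x - g x)"
  using square_integrable_add[of f "\<lambda>x. - g x"] by auto

lemma square_integrable_nth [intro]:
  "square_integrable (f :: real^2 \<Rightarrow> 'a::euclidean_space^'n) \<Longrightarrow> square_integrable (\<lambda>x. f x $ i)"
  by (erule square_integrable_bounded_linear) (rule bounded_linear_vec_nth)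

lemma square_integrable_matrix [intro]:
  "square_integrable f \<Longrightarrow> square_integrable (\<lambda>x. (A :: real^2^2) *v f x)"
  by (erule square_integrable_bounded_linear) (rule matrix_vector_mul_bounded_linear)

lemma square_integrable_bounded_scale:
  assumes "square_integrable f" "\<eta> \<in> borel_measurable cell_measure"
    "\<And>x. x \<in> unit_cell \<Longrightarrow> \<bar>\<eta> x\<bar> \<le> K"
  shows "square_integrable (\<lambda>x. \<eta> x *\<^sub>R f x)"
  using assms by (intro square_integrable_bound[OF assms(1), of _ K])
    (auto intro!: borel_measurable_scaleR mult_right_mono)

lemma integrable_square_integrable:
  assumes f: "square_integrable f" shows "integrable cell_measure f"
proof (rule Bochner_Integration.integrable_bound)
  show "integrable cell_measure (\<lambda>x. 1 + (norm (f x))\<^sup>2)"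
    using f by auto
  show "AE x in cell_measure. norm (f x) \<le> norm (1 + (norm (f x))\<^sup>2)"
  proof (rule AE_I2)
    fix x
    have "2 * norm (f x) \<le> 1 + (norm (f x))\<^sup>2"
      using sum_squares_bound[of 1 "norm (f x)"] by simp
    then show "norm (f x) \<le> norm (1 + (norm (f x))\<^sup>2)"
      using norm_ge_zero[of "f x"] unfolding real_norm_def by linarith
  qed
qed (use f in auto)

lemma square_integrable_continuous:
  assumes "continuous_on UNIV f" shows "square_integrable f"
proof -
  have c: "continuous_on unit_cell f" using assms continuous_on_subset by blast
  have "compact unit_cell" by (simp add: unit_cell_eq_cbox)
  then obtain K where K: "\<And>x. x \<in> unit_cell \<Longrightarrow> norm (f x) \<le> K"
    using compact_continuous_image[OF c] compact_imp_bounded bounded_iff by (metis imageI)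
  show ?thesis
    using K c by (intro square_integrable_bound[OF square_integrable_const[of "1::real"], of _ K])
     (auto intro!: continuous_imp_measurable_on_sets_lebesgue)
qed

section \<open>Hilbert space structure of the square-integrable fields\<close>

lemma Cauchy_Schwarz_cell:
  fixes f g :: "real^2 \<Rightarrow> 'a::euclidean_space"
  assumes f: "square_integrable f" and g: "square_integrable g"
  shows "(\<integral>x. f x \<bullet> g x \<partial>cell_measure)\<^sup>2
    \<le> (\<integral>x. (norm (f x))\<^sup>2 \<partial>cell_measure) * (\<integral>x. (norm (g x))\<^sup>2 \<partial>cell_measure)"
proof -
  let ?A = "\<integral>x. (norm (f x))\<^sup>2 \<partial>cell_measure" and ?B = "\<integral>x. f x \<bullet> g x \<partial>cell_measure"
  let ?C = "\<integral>x. (norm (g x))\<^sup>2 \<partial>cell_measure"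
  \<comment> \<open>The squared norm of \<open>f - t g\<close> is nonnegative for every
    \<open>t\<close>; Cauchy-Schwarz is the discriminant condition of this quadratic.\<close>
  have *: "0 \<le> ?A - 2 * t * ?B + t\<^sup>2 * ?C" for t
  proof -
    have "(norm (f x - t *\<^sub>R g x))\<^sup>2 = (norm (f x))\<^sup>2 - 2 * t * (f x \<bullet> g x) + t\<^sup>2 * (norm (g x))\<^sup>2" for x
      unfolding power2_norm_eq_inner by (simp add: algebra_simps inner_commute power2_eq_square)
    then have "(\<integral>x. (norm (f x - t *\<^sub>R g x))\<^sup>2 \<partial>cell_measure) = ?A - 2 * t * ?B + t\<^sup>2 * ?C"
      using f g integrable_inner_square_integrable[OF f g] by (simp add: square_integrable_sq)
    moreover have "0 \<le> (\<integral>x. (norm (f x - t *\<^sub>R g x))\<^sup>2 \<partial>cell_measure)"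
      by (rule Bochner_Integration.integral_nonneg) simp
    ultimately show ?thesis by simp
  qed
  have A: "0 \<le> ?A" and C: "0 \<le> ?C" by (auto intro!: Bochner_Integration.integral_nonneg)
  show ?thesis
  proof (cases "?C = 0")
    case True
    have "?B = 0"
    proof (rule ccontr)
      assume "?B \<noteq> 0"
      \<comment> \<open>With \<open>?C = 0\<close> the quadratic is affine in \<open>t\<close>, and
        this \<open>t\<close> gives it the value -1.\<close>
      then show False using *[of "(?A + 1) / (2 * ?B)"] True by simp
    qed
    then show ?thesis using True by simp
  next
    case False
    then have "0 < ?C" using C by linarith
    then show ?thesis using *[of "?B / ?C"] by (simp add: field_simps power2_eq_square)
  qed
qed

text \<open>Cauchy-Schwarz bounds the difference of the two pairings by the \<open>L2\<close> error
  times the norm of \<open>g\<close>.\<close>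

lemma L2_limit_inner:
  fixes f :: "nat \<Rightarrow> real^2 \<Rightarrow> 'a::euclidean_space"
  assumes fn: "\<And>n. square_integrable (f n)" and f: "square_integrable f0" and g: "square_integrable g"
    and lim: "(\<lambda>n. \<integral>x. (norm (f n x - f0 x))\<^sup>2 \<partial>cell_measure) \<longlonglongrightarrow> 0"
  shows "(\<lambda>n. \<integral>x. f n x \<bullet> g x \<partial>cell_measure) \<longlonglongrightarrow> (\<integral>x. f0 x \<bullet> g x \<partial>cell_measure)"
proof -
  let ?G = "\<integral>x. (norm (g x))\<^sup>2 \<partial>cell_measure"
  have bd: "norm ((\<integral>x. f n x \<bullet> g x \<partial>cell_measure) - (\<integral>x. f0 x \<bullet> g x \<partial>cell_measure))
      \<le> sqrt ((\<integral>x. (norm (f n x - f0 x))\<^sup>2 \<partial>cell_measure) * ?G)" for n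
  proof -
    have "(\<integral>x. f n x \<bullet> g x \<partial>cell_measure) - (\<integral>x. f0 x \<bullet> g x \<partial>cell_measure)
      = (\<integral>x. (f n x - f0 x) \<bullet> g x \<partial>cell_measure)"
      unfolding inner_diff_left
      by (rule Bochner_Integration.integral_diff[symmetric];
          intro integrable_inner_square_integrable fn f g)
    then show ?thesis
      using Cauchy_Schwarz_cell[of "\<lambda>x. f n x - f0 x" g] fn f g
      by (simp add: real_le_rsqrt square_integrable_diff)
  qed
  have "(\<lambda>n. sqrt ((\<integral>x. (norm (f n x - f0 x))\<^sup>2 \<partial>cell_measure) * ?G)) \<longlonglongrightarrow> sqrt (0 * ?G)"
    by (intro tendsto_intros lim)
  then have lim0: "(\<lambda>n. sqrt ((\<integral>x. (norm (f n x - f0 x))\<^sup>2 \<partial>cell_measure) * ?G)) \<longlonglongrightarrow> 0"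
    by simp
  have "(\<lambda>n. (\<integral>x. f n x \<bullet> g x \<partial>cell_measure) - (\<integral>x. f0 x \<bullet> g x \<partial>cell_measure)) \<longlonglongrightarrow> 0"
    by (rule Lim_null_comparison[OF _ lim0], rule always_eventually, rule allI, rule bd)
  then show ?thesis by (rule LIM_zero_cancel)
qed

text \<open>Riesz-Fischer. On a cell of measure 1 the \<open>L1\<close> norm is at most the
  \<open>L2\<close> norm, so a subsequence converges almost everywhere; Fatou along it turns the
  Cauchy bound into a bound on the distance to the limit.\<close>

lemma L2_complete:
  fixes f :: "nat \<Rightarrow> real^2 \<Rightarrow> 'a::euclidean_space"
  assumes f: "\<And>n. square_integrable (f n)"
    and cauchy: "\<And>e. e > 0 \<Longrightarrow> \<exists>N. \<forall>m\<ge>N. \<forall>n\<ge>N. (\<integral>x. (norm (f m x - f n x))\<^sup>2 \<partial>cell_measure) < e"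
  obtains g where "square_integrable g"
    "(\<lambda>n. \<integral>x. (norm (f n x - g x))\<^sup>2 \<partial>cell_measure) \<longlonglongrightarrow> 0"
proof -
  note fm [measurable] = square_integrable_measurable[OF f]
  have L1: "(\<integral>x. norm (f m x - f n x) \<partial>cell_measure) < e"
    if "(\<integral>x. (norm (f m x - f n x))\<^sup>2 \<partial>cell_measure) < e\<^sup>2" "e > 0" for e m n
  proof -
    have "(\<integral>x. norm (f m x - f n x) \<partial>cell_measure)\<^sup>2 \<le> (\<integral>x. (norm (f m x - f n x))\<^sup>2 \<partial>cell_measure)"
      using Cauchy_Schwarz_cell[of "\<lambda>x. norm (f m x - f n x)" "\<lambda>x. 1"] f
        square_integrable_diff[OF f[of m] f[of n]]
      by (simp add: square_integrable_def)
    then have "(\<integral>x. norm (f m x - f n x) \<partial>cell_measure)\<^sup>2 < e\<^sup>2" using that by simp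
    then show ?thesis by (rule power2_less_imp_less) (rule less_imp_le[OF \<open>e > 0\<close>])
  qed
  obtain r where r: "strict_mono r" and ae: "AE x in cell_measure. Cauchy (\<lambda>i. f (r i) x)"
  proof (rule cauchy_L1_AE_cauchy_subseq[of cell_measure f])
    show "integrable cell_measure (f n)" for n by (rule integrable_square_integrable[OF f])
    show "\<exists>N. \<forall>i\<ge>N. \<forall>j\<ge>N. (\<integral>x. norm (f i x - f j x) \<partial>cell_measure) < e" if "e > 0" for e
    proof -
      obtain N where "\<forall>m\<ge>N. \<forall>n\<ge>N. (\<integral>x. (norm (f m x - f n x))\<^sup>2 \<partial>cell_measure) < e\<^sup>2"
        using cauchy[of "e\<^sup>2"] \<open>e > 0\<close> by auto
      then show ?thesis using L1 \<open>e > 0\<close> by blast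
    qed
  qed blast
  \<comment> \<open>Where the subsequence diverges, \<open>lim\<close> is an arbitrary value; such
    points form a null set.\<close>
  define g where "g = (\<lambda>x. lim (\<lambda>i. f (r i) x))"
  have gm [measurable]: "g \<in> borel_measurable cell_measure"
    unfolding g_def by (rule borel_measurable_lim_metric) simp
  have gl: "AE x in cell_measure. (\<lambda>i. f (r i) x) \<longlonglongrightarrow> g x"
    using ae by eventually_elim (auto simp: g_def Cauchy_convergent_iff convergent_LIMSEQ_iff)
  have fatou: "(\<integral>\<^sup>+x. ennreal ((norm (f n x - g x))\<^sup>2) \<partial>cell_measure) \<le> ennreal e"
    if N: "\<forall>m\<ge>N. \<forall>n\<ge>N. (\<integral>x. (norm (f m x - f n x))\<^sup>2 \<partial>cell_measure) < e" and n: "n \<ge> N" for N n e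
  proof -
    have "(\<integral>\<^sup>+x. ennreal ((norm (f n x - g x))\<^sup>2) \<partial>cell_measure)
        = (\<integral>\<^sup>+x. liminf (\<lambda>i. ennreal ((norm (f n x - f (r i) x))\<^sup>2)) \<partial>cell_measure)"
    proof (rule nn_integral_cong_AE)
      show "AE x in cell_measure. ennreal ((norm (f n x - g x))\<^sup>2)
         = liminf (\<lambda>i. ennreal ((norm (f n x - f (r i) x))\<^sup>2))"
        using gl
      proof eventually_elim
        case (elim x)
        then have "(\<lambda>i. ennreal ((norm (f n x - f (r i) x))\<^sup>2)) \<longlonglongrightarrow> ennreal ((norm (f n x - g x))\<^sup>2)"
          by (intro tendsto_ennrealI tendsto_intros)
        then show ?case by (rule lim_imp_Liminf[OF sequentially_bot, symmetric])
      qed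
    qed
    also have "\<dots> \<le> liminf (\<lambda>i. \<integral>\<^sup>+x. ennreal ((norm (f n x - f (r i) x))\<^sup>2) \<partial>cell_measure)"
      by (rule nn_integral_liminf) measurable
    also have "\<dots> \<le> liminf (\<lambda>i. ennreal e)"
    proof (rule Liminf_mono, rule eventually_sequentiallyI[of N])
      fix i assume "N \<le> i"
      then have "N \<le> r i" using seq_suble[OF r, of i] by simp
      have "(\<integral>\<^sup>+x. ennreal ((norm (f n x - f (r i) x))\<^sup>2) \<partial>cell_measure)
          = ennreal (\<integral>x. (norm (f n x - f (r i) x))\<^sup>2 \<partial>cell_measure)"
        using f by (intro nn_integral_eq_integral) (auto simp: square_integrable_sq square_integrable_diff)
      also have "\<dots> \<le> ennreal e" using N n \<open>N \<le> r i\<close> by (intro ennreal_leI less_imp_le) auto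
      finally show "(\<integral>\<^sup>+x. ennreal ((norm (f n x - f (r i) x))\<^sup>2) \<partial>cell_measure) \<le> ennreal e" .
    qed
    also have "\<dots> = ennreal e" by (simp add: Liminf_const)
    finally show ?thesis .
  qed
  have si: "square_integrable g"
  proof -
    obtain N where N: "\<forall>m\<ge>N. \<forall>n\<ge>N. (\<integral>x. (norm (f m x - f n x))\<^sup>2 \<partial>cell_measure) < 1"
      using cauchy[of 1] by auto
    have "integrable cell_measure (\<lambda>x. (norm (f N x - g x))\<^sup>2)"
      using fatou[OF N order_refl] by (intro integrableI_bounded) (auto simp: order_le_less_trans)
    then have "square_integrable (\<lambda>x. f N x - g x)" by (simp add: square_integrable_def)
    from square_integrable_diff[OF f[of N] this] show ?thesis by simp
  qed
  have "(\<lambda>n. \<integral>x. (norm (f n x - g x))\<^sup>2 \<partial>cell_measure) \<longlonglongrightarrow> 0"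
  proof (rule LIMSEQ_I)
    fix e :: real assume "e > 0"
    \<comment> \<open>\<open>fatou\<close> yields a weak inequality only; halving \<open>e\<close>
      makes the final one strict.\<close>
    then obtain N where N: "\<forall>m\<ge>N. \<forall>n\<ge>N. (\<integral>x. (norm (f m x - f n x))\<^sup>2 \<partial>cell_measure) < e/2"
      using cauchy[of "e/2"] by auto
    have "norm ((\<integral>x. (norm (f n x - g x))\<^sup>2 \<partial>cell_measure) - 0) < e" if "n \<ge> N" for n
    proof -
      have "ennreal (\<integral>x. (norm (f n x - g x))\<^sup>2 \<partial>cell_measure) \<le> ennreal (e/2)"
        using fatou[OF N that] si f
        by (subst nn_integral_eq_integral[symmetric]) (auto simp: square_integrable_sq square_integrable_diff)
      then have "(\<integral>x. (norm (f n x - g x))\<^sup>2 \<partial>cell_measure) \<le> e/2"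
        using \<open>e > 0\<close> by (simp add: ennreal_le_iff)
      then show ?thesis using \<open>e > 0\<close> by (simp add: Bochner_Integration.integral_nonneg)
    qed
    then show "\<exists>N. \<forall>n\<ge>N. norm ((\<integral>x. (norm (f n x - g x))\<^sup>2 \<partial>cell_measure) - 0) < e" by blast
  qed
  with si that show thesis by blast
qed


section \<open>Fubini and the Poincare inequality on the cell\<close>

definition plane_point :: "real \<Rightarrow> real \<Rightarrow> real^2" where
  "plane_point s t = s *\<^sub>R axis 1 1 + t *\<^sub>R axis 2 1"

lemma plane_point_nth [simp]: "plane_point s t $ 1 = s" "plane_point s t $ 2 = t"
  by (simp_all add: plane_point_def axis_def)

lemma plane_point_eta [simp]: "plane_point (x $ 1) (x $ 2) = x"
  by (simp add: vec_eq_iff forall_2)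

lemma continuous_on_plane_point [continuous_intros]:
  "continuous_on S f \<Longrightarrow> continuous_on S g \<Longrightarrow> continuous_on S (\<lambda>x. plane_point (f x) (g x))"
  unfolding plane_point_def by (intro continuous_intros)

lemma Basis_real2: "(Basis :: (real^2) set) = {axis 1 1, axis 2 1}"
  by (auto simp: Basis_vec_def UNIV_2)

text \<open>The two measures agree on boxes. This carries Fubini for pairs of reals over to the
  cell.\<close>

lemma lborel_plane:
  "(lborel :: (real^2) measure) = distr lborel borel (\<lambda>p. plane_point (fst p) (snd p))"
proof (rule lborel_eqI)
  have cont: "continuous_on UNIV (\<lambda>p :: real \<times> real. plane_point (fst p) (snd p))"
    by (intro continuous_intros)
  then have m [measurable]: "(\<lambda>p :: real \<times> real. plane_point (fst p) (snd p)) \<in> borel_measurable lborel"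
    by (simp add: borel_measurable_continuous_onI)
  fix l u :: "real^2"
  assume le: "\<And>b. b \<in> Basis \<Longrightarrow> l \<bullet> b \<le> u \<bullet> b"
  have le': "l $ 1 \<le> u $ 1" "l $ 2 \<le> u $ 2"
    using le[of "axis 1 1"] le[of "axis 2 1"] by (auto simp: Basis_real2 inner_axis)
  have "(\<lambda>p. plane_point (fst p) (snd p)) -` box l u = box (l $ 1, l $ 2) (u $ 1, u $ 2)"
    by (auto simp: mem_box_cart mem_box forall_2 Basis_prod_def)
  then have "emeasure (distr lborel borel (\<lambda>p. plane_point (fst p) (snd p))) (box l u)
      = emeasure lborel (box (l $ 1, l $ 2) (u $ 1, u $ 2))"
    by (subst emeasure_distr) auto
  also have "box (l $ 1, l $ 2) (u $ 1, u $ 2) = box (l $ 1) (u $ 1) \<times> box (l $ 2) (u $ 2)"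
    by (simp add: box_prod)
  also have "emeasure lborel \<dots> = emeasure (lborel \<Otimes>\<^sub>M lborel) \<dots>"
    by (simp add: lborel_prod)
  also have "\<dots> = ennreal (u $ 1 - l $ 1) * ennreal (u $ 2 - l $ 2)"
    using le' by (subst lborel.emeasure_pair_measure_Times) auto
  also have "\<dots> = ennreal ((u $ 1 - l $ 1) * (u $ 2 - l $ 2))"
    using le' by (simp add: ennreal_mult)
  also have "(u $ 1 - l $ 1) * (u $ 2 - l $ 2) = (\<Prod>b\<in>Basis. (u - l) \<bullet> b)"
    by (simp add: Basis_real2 axis_eq_axis inner_axis)
  finally show "emeasure (distr lborel borel (\<lambda>p. plane_point (fst p) (snd p))) (box l u)
      = ennreal (\<Prod>b\<in>Basis. (u - l) \<bullet> b)" .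
qed simp

text \<open>Both orders are needed, since each partial derivative is integrated first in its own
  variable.\<close>

lemma cell_integral_iterated:
  fixes f :: "real^2 \<Rightarrow> real"
  assumes f: "continuous_on UNIV f"
  shows "(\<integral>x. f x \<partial>cell_measure) = integral {0..1} (\<lambda>s. integral {0..1} (\<lambda>t. f (plane_point s t)))"
    and "(\<integral>x. f x \<partial>cell_measure) = integral {0..1} (\<lambda>t. integral {0..1} (\<lambda>s. f (plane_point s t)))"
proof -
  have cont: "continuous_on UNIV (\<lambda>p :: real \<times> real. plane_point (fst p) (snd p))"
    by (intro continuous_intros)
  then have m [measurable]: "(\<lambda>p :: real \<times> real. plane_point (fst p) (snd p)) \<in> borel_measurable lborel"
    by (simp add: borel_measurable_continuous_onI)
  have fm [measurable]: "f \<in> borel_measurable borel"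
    by (rule borel_measurable_continuous_onI[OF f])
  have ucb [measurable]: "unit_cell \<in> sets borel" by (simp add: unit_cell_eq_cbox)
  have contf: "continuous_on A (\<lambda>p :: real \<times> real. f (plane_point (fst p) (snd p)))" for A
    using continuous_on_compose2[OF f cont] continuous_on_subset by blast
  have "(\<integral>x. f x \<partial>cell_measure) = (\<integral>x. indicator unit_cell x *\<^sub>R f x \<partial>lebesgue)"
    by (rule integral_restrict_space) simp
  also have "\<dots> = (\<integral>x. indicator unit_cell x *\<^sub>R f x \<partial>lborel)"
    by (rule integral_completion) measurable
  also have "\<dots> = (\<integral>p. indicator unit_cell (plane_point (fst p) (snd p)) *\<^sub>R f (plane_point (fst p) (snd p)) \<partial>lborel)"
    by (subst lborel_plane, subst integral_distr) auto
  also have "\<dots> = (\<integral>p. indicator (cbox (0,0) (1,1)) p *\<^sub>R f (plane_point (fst p) (snd p)) \<partial>lborel)"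
    by (intro Bochner_Integration.integral_cong)
      (auto simp: indicator_def unit_cell_def forall_2 mem_box Basis_prod_def)
  also have "\<dots> = integral (cbox (0,0) (1,1)) (\<lambda>p. f (plane_point (fst p) (snd p)))"
    using set_borel_integral_eq_integral(2)[of "cbox (0,0) (1,1)" "\<lambda>p. f (plane_point (fst p) (snd p))"]
      borel_integrable_compact[OF compact_cbox contf[of "cbox (0,0) (1,1)"]]
    by (simp add: set_lebesgue_integral_def set_integrable_def indicator_def if_distrib cong: if_cong)
  also have "\<dots> = integral (cbox 0 1) (\<lambda>s. integral (cbox 0 1) (\<lambda>t. f (plane_point s t)))"
    using integral_prod_continuous[OF contf[of "cbox (0,0) (1,1)"]] by simp
  finally show 1: "(\<integral>x. f x \<partial>cell_measure) = integral {0..1} (\<lambda>s. integral {0..1} (\<lambda>t. f (plane_point s t)))"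
    by simp
  show "(\<integral>x. f x \<partial>cell_measure) = integral {0..1} (\<lambda>t. integral {0..1} (\<lambda>s. f (plane_point s t)))"
    unfolding 1
    using integral_swap_continuous[of 0 0 1 1 "\<lambda>s t. f (plane_point s t)"] contf[of "cbox (0,0) (1,1)"]
    by (simp add: case_prod_unfold)
qed

section \<open>Gradients of periodic functions and symmetry of second derivatives\<close>

lemma GDERIV_unique:
  assumes "GDERIV f x :> a" "GDERIV f x :> b" shows "a = b"
proof -
  have "(\<lambda>h. h \<bullet> a) = (\<lambda>h. h \<bullet> b)"
    using assms unfolding gderiv_def by (rule has_derivative_unique)
  then have "(a - b) \<bullet> a = (a - b) \<bullet> b" by metis
  then have "(a - b) \<bullet> (a - b) = 0" by (simp add: inner_diff_right)
  then show ?thesis by simp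
qed

lemma GDERIV_partial:
  assumes "GDERIV f (plane_point s t) :> g"
  shows "((\<lambda>s. f (plane_point s t)) has_real_derivative g $ 1) (at s)"
    and "((\<lambda>t. f (plane_point s t)) has_real_derivative g $ 2) (at t)"
proof -
  have D: "(f has_derivative (\<lambda>h. h \<bullet> g)) (at (plane_point s t))"
    using assms by (simp add: gderiv_def)
  have 1: "((\<lambda>s. plane_point s t) has_derivative (\<lambda>h. h *\<^sub>R axis 1 1)) (at s)"
    unfolding plane_point_def by (auto intro!: derivative_eq_intros)
  have 2: "((\<lambda>t. plane_point s t) has_derivative (\<lambda>h. h *\<^sub>R axis 2 1)) (at t)"
    unfolding plane_point_def by (auto intro!: derivative_eq_intros)
  have "((\<lambda>s. f (plane_point s t)) has_derivative (\<lambda>h. (h *\<^sub>R axis 1 1) \<bullet> g)) (at s)"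
    by (rule has_derivative_compose[OF 1 D])
  then show "((\<lambda>s. f (plane_point s t)) has_real_derivative g $ 1) (at s)"
    by (simp add: has_field_derivative_def inner_axis' mult.commute[of "g $ 1"] mult_commute_abs)
  have "((\<lambda>t. f (plane_point s t)) has_derivative (\<lambda>h. (h *\<^sub>R axis 2 1) \<bullet> g)) (at t)"
    by (rule has_derivative_compose[OF 2 D])
  then show "((\<lambda>t. f (plane_point s t)) has_real_derivative g $ 2) (at t)"
    by (simp add: has_field_derivative_def inner_axis' mult.commute[of "g $ 2"] mult_commute_abs)
qed

lemma GDERIV_continuous:
  assumes "\<And>x. GDERIV f x :> g x" shows "continuous_on UNIV f"
  using assms unfolding gderiv_def
  by (meson UNIV_I continuous_on_eq_continuous_at has_derivative_continuous open_UNIV)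

text \<open>The fundamental theorem of calculus along coordinate \<open>i\<close> leaves a
  difference of values on opposite edges, which periodicity cancels.\<close>

lemma integral_periodic_gradient:
  fixes f :: "real^2 \<Rightarrow> real"
  assumes D: "\<And>x. GDERIV f x :> g x" and g: "continuous_on UNIV g"
    and per: "\<And>x i. f (x + axis i 1) = f x"
  shows "(\<integral>x. g x $ i \<partial>cell_measure) = 0"
proof -
  have gi: "continuous_on UNIV (\<lambda>x. g x $ j)" for j
    by (intro continuous_intros g)
  have p1: "f (plane_point 1 t) = f (plane_point 0 t)" for t
    using per[of "plane_point 0 t" 1] by (simp add: plane_point_def add.commute)
  have p2: "f (plane_point s 1) = f (plane_point s 0)" for s
    using per[of "plane_point s 0" 2] by (simp add: plane_point_def)
  have "((\<lambda>t. g (plane_point s t) $ 2) has_integral f (plane_point s 1) - f (plane_point s 0)) {0..1}" for s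
    by (rule fundamental_theorem_of_calculus)
      (auto simp: has_real_derivative_iff_has_vector_derivative[symmetric]
        intro!: has_field_derivative_at_within GDERIV_partial(2) D)
  then have 2: "integral {0..1} (\<lambda>t. g (plane_point s t) $ 2) = 0" for s
    using p2 by (simp add: integral_unique)
  have "((\<lambda>s. g (plane_point s t) $ 1) has_integral f (plane_point 1 t) - f (plane_point 0 t)) {0..1}" for t
    by (rule fundamental_theorem_of_calculus)
      (auto simp: has_real_derivative_iff_has_vector_derivative[symmetric]
        intro!: has_field_derivative_at_within GDERIV_partial(1) D)
  then have 1: "integral {0..1} (\<lambda>s. g (plane_point s t) $ 1) = 0" for t
    using p1 by (simp add: integral_unique)
  consider "i = 1" | "i = 2" using exhaust_2 by blast
  then show ?thesis
    by cases (simp_all add: cell_integral_iterated(1)[OF gi[of 2]] cell_integral_iterated(2)[OF gi[of 1]] 1 2)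
qed

text \<open>The mean value theorem is applied twice to the second difference of \<open>f\<close>
  over a square: first in \<open>s\<close> and then in \<open>t\<close>, or the other way round.
  Each order produces one mixed partial.\<close>

lemma mixed_difference:
  fixes f :: "real^2 \<Rightarrow> real" and s t h :: real
  assumes D: "\<And>x. GDERIV f x :> g x" and D2: "\<And>i x. GDERIV (\<lambda>x. g x $ i) x :> H i x" and h: "h > 0"
  defines "d \<equiv> f (plane_point (s + h) (t + h)) - f (plane_point (s + h) t)
      - f (plane_point s (t + h)) + f (plane_point s t)"
  shows "\<exists>\<sigma> \<tau>. s < \<sigma> \<and> \<sigma> < s + h \<and> t < \<tau> \<and> \<tau> < t + h \<and> d = h * h * H 1 (plane_point \<sigma> \<tau>) $ 2"
    and "\<exists>\<sigma> \<tau>. s < \<sigma> \<and> \<sigma> < s + h \<and> t < \<tau> \<and> \<tau> < t + h \<and> d = h * h * H 2 (plane_point \<sigma> \<tau>) $ 1"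
proof -
  obtain \<sigma> where \<sigma>: "s < \<sigma>" "\<sigma> < s + h"
    "(f (plane_point (s + h) (t + h)) - f (plane_point (s + h) t)) - (f (plane_point s (t + h)) - f (plane_point s t))
      = (s + h - s) * (g (plane_point \<sigma> (t + h)) $ 1 - g (plane_point \<sigma> t) $ 1)"
    using MVT2[of s "s + h" "\<lambda>s. f (plane_point s (t + h)) - f (plane_point s t)"
        "\<lambda>s. g (plane_point s (t + h)) $ 1 - g (plane_point s t) $ 1"] h
      DERIV_diff[OF GDERIV_partial(1)[OF D] GDERIV_partial(1)[OF D]] by auto
  obtain \<tau> where \<tau>: "t < \<tau>" "\<tau> < t + h"
    "g (plane_point \<sigma> (t + h)) $ 1 - g (plane_point \<sigma> t) $ 1 = (t + h - t) * H 1 (plane_point \<sigma> \<tau>) $ 2"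
    using MVT2[of t "t + h" "\<lambda>t. g (plane_point \<sigma> t) $ 1" "\<lambda>t. H 1 (plane_point \<sigma> t) $ 2"] h
      GDERIV_partial(2)[OF D2] by auto
  show "\<exists>\<sigma> \<tau>. s < \<sigma> \<and> \<sigma> < s + h \<and> t < \<tau> \<and> \<tau> < t + h \<and> d = h * h * H 1 (plane_point \<sigma> \<tau>) $ 2"
    using \<sigma> \<tau> by (intro exI[of _ \<sigma>] exI[of _ \<tau>]) (simp add: d_def)
  obtain \<tau>' where \<tau>': "t < \<tau>'" "\<tau>' < t + h"
    "(f (plane_point (s + h) (t + h)) - f (plane_point s (t + h))) - (f (plane_point (s + h) t) - f (plane_point s t))
      = (t + h - t) * (g (plane_point (s + h) \<tau>') $ 2 - g (plane_point s \<tau>') $ 2)"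
    using MVT2[of t "t + h" "\<lambda>t. f (plane_point (s + h) t) - f (plane_point s t)"
        "\<lambda>t. g (plane_point (s + h) t) $ 2 - g (plane_point s t) $ 2"] h
      DERIV_diff[OF GDERIV_partial(2)[OF D] GDERIV_partial(2)[OF D]] by auto
  obtain \<sigma>' where \<sigma>': "s < \<sigma>'" "\<sigma>' < s + h"
    "g (plane_point (s + h) \<tau>') $ 2 - g (plane_point s \<tau>') $ 2 = (s + h - s) * H 2 (plane_point \<sigma>' \<tau>') $ 1"
    using MVT2[of s "s + h" "\<lambda>s. g (plane_point s \<tau>') $ 2" "\<lambda>s. H 2 (plane_point s \<tau>') $ 1"] h
      GDERIV_partial(1)[OF D2] by auto
  show "\<exists>\<sigma> \<tau>. s < \<sigma> \<and> \<sigma> < s + h \<and> t < \<tau> \<and> \<tau> < t + h \<and> d = h * h * H 2 (plane_point \<sigma> \<tau>) $ 1"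
    using \<sigma>' \<tau>' by (intro exI[of _ \<sigma>'] exI[of _ \<tau>']) (simp add: d_def)
qed

text \<open>Divide the two expressions for the same second difference by \<open>h^2\<close> and let
  the square shrink to \<open>x\<close>; continuity of the second derivatives handles the
  intermediate points.\<close>

lemma mixed_partials_eq:
  fixes f :: "real^2 \<Rightarrow> real"
  assumes D: "\<And>x. GDERIV f x :> g x" and D2: "\<And>i x. GDERIV (\<lambda>x. g x $ i) x :> H i x"
    and H: "\<And>i. continuous_on UNIV (H i)"
  shows "H 1 x $ 2 = H 2 x $ 1"
proof -
  define s t where "s = x $ 1" and "t = x $ 2"
  define h where "h n = inverse (real (Suc n))" for n
  have h0: "h n > 0" for n by (simp add: h_def)
  have lim_h: "h \<longlonglongrightarrow> 0" unfolding h_def by (rule LIMSEQ_inverse_real_of_nat)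
  have lim: "(\<lambda>n. H i (plane_point (a n) (b n)) $ j) \<longlonglongrightarrow> H i x $ j"
    if ab: "\<And>n. s < a n" "\<And>n. a n < s + h n" "\<And>n. t < b n" "\<And>n. b n < t + h n" for a b i j
  proof -
    have "a \<longlonglongrightarrow> s"
      by (rule tendsto_sandwich[OF _ _ tendsto_const, of _ _ _ "\<lambda>n. s + h n"])
        (use ab tendsto_add[OF tendsto_const lim_h, of s] in \<open>auto intro!: always_eventually less_imp_le\<close>)
    moreover have "b \<longlonglongrightarrow> t"
      by (rule tendsto_sandwich[OF _ _ tendsto_const, of _ _ _ "\<lambda>n. t + h n"])
        (use ab tendsto_add[OF tendsto_const lim_h, of t] in \<open>auto intro!: always_eventually less_imp_le\<close>)
    ultimately have "(\<lambda>n. plane_point (a n) (b n)) \<longlonglongrightarrow> plane_point s t"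
      unfolding plane_point_def by (intro tendsto_intros)
    then have "(\<lambda>n. plane_point (a n) (b n)) \<longlonglongrightarrow> x" by (simp add: s_def t_def)
    then have "(\<lambda>n. H i (plane_point (a n) (b n))) \<longlonglongrightarrow> H i x"
      using H[of i] by (intro isCont_tendsto_compose[of x "H i"])
        (auto simp: continuous_on_eq_continuous_at)
    then show ?thesis by (rule tendsto_vec_nth)
  qed
  define d where "d n = f (plane_point (s + h n) (t + h n)) - f (plane_point (s + h n) t)
      - f (plane_point s (t + h n)) + f (plane_point s t)" for n
  have "\<forall>n. \<exists>\<sigma> \<tau>. s < \<sigma> \<and> \<sigma> < s + h n \<and> t < \<tau> \<and> \<tau> < t + h n \<and> d n = h n * h n * H 1 (plane_point \<sigma> \<tau>) $ 2"
    unfolding d_def using mixed_difference(1)[where f=f and g=g and H=H, OF D D2 h0] by blast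
  then obtain a b where ab: "\<And>n. s < a n" "\<And>n. a n < s + h n" "\<And>n. t < b n" "\<And>n. b n < t + h n"
    "\<And>n. d n = h n * h n * H 1 (plane_point (a n) (b n)) $ 2" by metis
  have "\<forall>n. \<exists>\<sigma> \<tau>. s < \<sigma> \<and> \<sigma> < s + h n \<and> t < \<tau> \<and> \<tau> < t + h n \<and> d n = h n * h n * H 2 (plane_point \<sigma> \<tau>) $ 1"
    unfolding d_def using mixed_difference(2)[where f=f and g=g and H=H, OF D D2 h0] by blast
  then obtain a' b' where ab': "\<And>n. s < a' n" "\<And>n. a' n < s + h n" "\<And>n. t < b' n" "\<And>n. b' n < t + h n"
    "\<And>n. d n = h n * h n * H 2 (plane_point (a' n) (b' n)) $ 1" by metis
  have "H 1 (plane_point (a n) (b n)) $ 2 = H 2 (plane_point (a' n) (b' n)) $ 1" for n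
    using ab(5)[of n] ab'(5)[of n] h0[of n] by simp
  then show ?thesis
    using lim[OF ab(1-4), of 1 2] lim[OF ab'(1-4), of 2 1] LIMSEQ_unique by auto
qed

text \<open>With \<open>c = u b - u a\<close>, integrating \<open>(u' - c)^2 \<ge> 0\<close> from
  \<open>a\<close> to \<open>b\<close> bounds \<open>(2 - (b - a)) c^2\<close> by the integral of
  \<open>u'^2\<close>, and \<open>b - a \<le> 1\<close>.\<close>

lemma oscillation_le_integral_derivative_sq:
  fixes u u' :: "real \<Rightarrow> real"
  assumes D: "\<And>t. (u has_real_derivative u' t) (at t)" and c: "continuous_on UNIV u'"
    and p: "p \<in> {0..1}" and q: "q \<in> {0..1}"
  shows "(u p - u q)\<^sup>2 \<le> integral {0..1} (\<lambda>t. (u' t)\<^sup>2)"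
  using p q
proof (induction p q rule: linorder_wlog)
  case (sym a b)
  then show ?case by (simp add: power2_commute)
next
  case (le a b)
  define c where "c = u b - u a"
  have int: "(\<lambda>t. (u' t)\<^sup>2) integrable_on {l..r}" "u' integrable_on {l..r}" for l r
    by (auto intro!: integrable_continuous_real continuous_intros continuous_on_subset[OF assms(2)])
  have ftc: "(u' has_integral c) {a..b}"
    unfolding c_def using le
    by (intro fundamental_theorem_of_calculus)
      (auto simp: has_real_derivative_iff_has_vector_derivative[symmetric]
        intro!: has_field_derivative_at_within D)
  have "((\<lambda>t. (u' t)\<^sup>2 - 2 * c * u' t + c\<^sup>2) has_integral
      integral {a..b} (\<lambda>t. (u' t)\<^sup>2) - 2 * c * c + (b - a) *\<^sub>R c\<^sup>2) {a..b}"
    using le has_integral_const_real[of "c\<^sup>2" a b]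
    by (intro has_integral_add has_integral_diff has_integral_mult_right ftc integrable_integral int)
       auto
  moreover have "(u' t)\<^sup>2 - 2 * c * u' t + c\<^sup>2 \<ge> 0" for t
    using zero_le_power2[of "u' t - c"] by (simp add: power2_diff algebra_simps)
  ultimately have "0 \<le> integral {a..b} (\<lambda>t. (u' t)\<^sup>2) - 2 * c * c + (b - a) *\<^sub>R c\<^sup>2"
    by (rule has_integral_nonneg)
  moreover have "(b - a) *\<^sub>R c\<^sup>2 \<le> c\<^sup>2"
    using le by (simp add: mult_left_le_one_le)
  ultimately have "c\<^sup>2 \<le> integral {a..b} (\<lambda>t. (u' t)\<^sup>2)"
    by (simp add: power2_eq_square)
  also have "\<dots> \<le> integral {0..1} (\<lambda>t. (u' t)\<^sup>2)"
    using le by (intro integral_subset_le int) auto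
  finally show ?case by (simp add: c_def power2_commute)
qed

lemma continuous_on_section_integral:
  fixes f :: "real^2 \<Rightarrow> real"
  assumes "continuous_on UNIV f"
  shows "continuous_on UNIV (\<lambda>s. integral {0..1} (\<lambda>t. f (plane_point s t)))"
    and "continuous_on UNIV (\<lambda>t. integral {0..1} (\<lambda>s. f (plane_point s t)))"
proof -
  show "continuous_on UNIV (\<lambda>s. integral {0..1} (\<lambda>t. f (plane_point s t)))"
    using integral_continuous_on_param[of UNIV 0 1 "\<lambda>s t. f (plane_point s t)"]
      continuous_on_compose2[OF assms, of "UNIV \<times> {0..1}" "\<lambda>p. plane_point (fst p) (snd p)"]
    by (simp add: case_prod_unfold continuous_intros)
  show "continuous_on UNIV (\<lambda>t. integral {0..1} (\<lambda>s. f (plane_point s t)))"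
    using integral_continuous_on_param[of UNIV 0 1 "\<lambda>t s. f (plane_point s t)"]
      continuous_on_compose2[OF assms, of "UNIV \<times> {0..1}" "\<lambda>p. plane_point (snd p) (fst p)"]
    by (simp add: case_prod_unfold continuous_intros)
qed

text \<open>Join \<open>x\<close> to \<open>y\<close> through the corner \<open>(x1, y2)\<close>:
  the vertical step is controlled by \<open>a x1\<close>, the horizontal one by \<open>b y2\<close>.
  For mean zero, averaging \<open>(f x - f y)^2\<close> over both points gives twice the mean of
  \<open>f^2\<close>, hence the constant 1.\<close>

lemma Poincare_cell:
  fixes f :: "real^2 \<Rightarrow> real"
  assumes D: "\<And>x. GDERIV f x :> g x" and g: "continuous_on UNIV g"
    and mean: "(\<integral>x. f x \<partial>cell_measure) = 0"
  shows "(\<integral>x. (f x)\<^sup>2 \<partial>cell_measure) \<le> (\<integral>x. (norm (g x))\<^sup>2 \<partial>cell_measure)"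
proof -
  have f: "continuous_on UNIV f" by (rule GDERIV_continuous[OF D])
  have gi: "continuous_on UNIV (\<lambda>x. (g x $ i)\<^sup>2)" for i by (intro continuous_intros g)
  define a where "a s = integral {0..1} (\<lambda>t. (g (plane_point s t) $ 2)\<^sup>2)" for s
  define b where "b t = integral {0..1} (\<lambda>s. (g (plane_point s t) $ 1)\<^sup>2)" for t
  have a_cont: "continuous_on UNIV (\<lambda>x :: real^2. a (x $ 1))"
    unfolding a_def
    by (rule continuous_on_compose2[OF continuous_on_section_integral(1)[OF gi[of 2]]])
      (auto intro!: continuous_intros)
  have b_cont: "continuous_on UNIV (\<lambda>x :: real^2. b (x $ 2))"
    unfolding b_def
    by (rule continuous_on_compose2[OF continuous_on_section_integral(2)[OF gi[of 1]]])
      (auto intro!: continuous_intros)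
  have int: "integrable cell_measure k" if "continuous_on UNIV k" for k :: "real^2 \<Rightarrow> real"
    by (intro integrable_square_integrable square_integrable_continuous that)
  have ints: "integrable cell_measure f" "integrable cell_measure (\<lambda>x. (f x)\<^sup>2)"
    "integrable cell_measure (\<lambda>x :: real^2. a (x $ 1))" "integrable cell_measure (\<lambda>x :: real^2. b (x $ 2))"
    by (intro int continuous_intros f a_cont b_cont)+
  let ?F = "\<integral>x. (f x)\<^sup>2 \<partial>cell_measure"
  let ?A = "\<integral>x. a (x $ 1) \<partial>cell_measure" and ?B = "\<integral>x. b (x $ 2) \<partial>cell_measure"
  have osc: "(f x - f y)\<^sup>2 \<le> 2 * a (x $ 1) + 2 * b (y $ 2)" if "x \<in> unit_cell" "y \<in> unit_cell" for x y
  proof -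
    have xy: "x $ i \<in> {0..1}" "y $ i \<in> {0..1}" for i using that by (auto simp: unit_cell_def)
    let ?z = "plane_point (x $ 1) (y $ 2)"
    have "(f (plane_point (x $ 1) (x $ 2)) - f ?z)\<^sup>2 \<le> a (x $ 1)"
      unfolding a_def
      by (rule oscillation_le_integral_derivative_sq[where u="\<lambda>t. f (plane_point (x $ 1) t)"])
       (use xy in \<open>auto intro!: GDERIV_partial(2) D continuous_intros continuous_on_compose2[OF g]\<close>)
    moreover have "(f ?z - f (plane_point (y $ 1) (y $ 2)))\<^sup>2 \<le> b (y $ 2)"
      unfolding b_def
      by (rule oscillation_le_integral_derivative_sq[where u="\<lambda>t. f (plane_point t (y $ 2))"])
       (use xy in \<open>auto intro!: GDERIV_partial(1) D continuous_intros continuous_on_compose2[OF g]\<close>)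
    moreover have "(f x - f y)\<^sup>2 \<le> 2 * (f x - f ?z)\<^sup>2 + 2 * (f ?z - f y)\<^sup>2"
      using zero_le_power2[of "(f x - f ?z) - (f ?z - f y)"] by (simp add: power2_eq_square algebra_simps)
    ultimately show ?thesis by simp
  qed
  \<comment> \<open>Average over \<open>y\<close>; the cross term vanishes because \<open>f\<close>
    has mean zero.\<close>
  have *: "(f x)\<^sup>2 + ?F \<le> 2 * a (x $ 1) + 2 * ?B" if x: "x \<in> unit_cell" for x
  proof -
    have "(f x)\<^sup>2 + ?F = (\<integral>y. (f x)\<^sup>2 - 2 * f x * f y + (f y)\<^sup>2 \<partial>cell_measure)"
      using ints mean by simp
    also have "\<dots> = (\<integral>y. (f x - f y)\<^sup>2 \<partial>cell_measure)"
      by (intro Bochner_Integration.integral_cong) (auto simp: power2_diff)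
    also have "\<dots> \<le> (\<integral>y. 2 * a (x $ 1) + 2 * b (y $ 2) \<partial>cell_measure)"
      using osc[OF x] ints
      by (intro integral_mono int continuous_intros f b_cont) auto
    also have "\<dots> = 2 * a (x $ 1) + 2 * ?B" using ints by simp
    finally show ?thesis .
  qed
  have "?F + ?F = (\<integral>x. (f x)\<^sup>2 + ?F \<partial>cell_measure)" using ints by simp
  also have "\<dots> \<le> (\<integral>x. 2 * a (x $ 1) + 2 * ?B \<partial>cell_measure)"
    using * ints by (intro integral_mono) auto
  also have "\<dots> = 2 * ?A + 2 * ?B" using ints by simp
  finally have "?F \<le> ?A + ?B" by simp
  \<comment> \<open>\<open>a (x $ 1)\<close> is constant in the second variable, so its cell
    integral reduces to the outer one.\<close>
  also have "?A = (\<integral>x. (g x $ 2)\<^sup>2 \<partial>cell_measure)"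
    by (simp add: cell_integral_iterated(1)[OF gi] cell_integral_iterated(1)[OF a_cont]) (simp add: a_def)
  also have "?B = (\<integral>x. (g x $ 1)\<^sup>2 \<partial>cell_measure)"
    by (simp add: cell_integral_iterated(2)[OF gi] cell_integral_iterated(2)[OF b_cont]) (simp add: b_def)
  also have "(\<integral>x. (g x $ 2)\<^sup>2 \<partial>cell_measure) + (\<integral>x. (g x $ 1)\<^sup>2 \<partial>cell_measure)
      = (\<integral>x. (g x $ 2)\<^sup>2 + (g x $ 1)\<^sup>2 \<partial>cell_measure)"
    using int[OF gi] by simp
  also have "\<dots> = (\<integral>x. (norm (g x))\<^sup>2 \<partial>cell_measure)"
    by (simp add: power2_norm_eq_inner) (simp add: inner_vec_def sum_2 power2_eq_square add.commute)
  finally show ?thesis .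
qed


section \<open>Smooth periodic functions\<close>

text \<open>Carrying \<open>G\<close> as a second argument avoids choosing a gradient at every use;
  by \<open>GDERIV_unique\<close> it is determined by \<open>\<psi>\<close>.\<close>

definition smooth_grad :: "(real^2 \<Rightarrow> real) \<Rightarrow> (real^2 \<Rightarrow> real^2) \<Rightarrow> bool" where
  "smooth_grad \<psi> G \<longleftrightarrow> smooth_periodic \<psi> \<and> (\<forall>x. GDERIV \<psi> x :> G x)"

lemma continuously_diff_continuous: "continuously_diff k f \<Longrightarrow> continuous_on UNIV f"
  by (cases k) (auto intro: GDERIV_continuous)

lemma continuous_on_vecI:
  fixes g :: "'a::topological_space \<Rightarrow> 'b::real_normed_vector^'n"
  assumes "\<And>i. continuous_on S (\<lambda>x. g x $ i)" shows "continuous_on S g"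
  using assms continuous_on_vec_lambda[of S "\<lambda>i x. g x $ i"] by simp

text \<open>\<open>continuously_diff\<close> provides some gradient; uniqueness identifies it with
  the given one.\<close>

lemma continuously_diff_SucD:
  assumes "continuously_diff (Suc k) f" "\<And>x. GDERIV f x :> g x"
  shows "continuously_diff k (\<lambda>x. g x $ i)"
proof -
  obtain g' where g': "\<And>x. GDERIV f x :> g' x" "\<And>i. continuously_diff k (\<lambda>x. g' x $ i)"
    using assms(1) by auto
  have "g' = g" using GDERIV_unique[OF g'(1) assms(2)] by auto
  then show ?thesis using g'(2) by simp
qed

lemma GDERIV_periodic:
  assumes "\<And>x. GDERIV \<psi> x :> G x" "\<And>x. \<psi> (x + a) = \<psi> x"
  shows "G (x + a) = G x"
proof -
  have "((\<lambda>y. \<psi> (y + a)) has_derivative (\<lambda>h. h \<bullet> G (x + a))) (at x)"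
    by (rule has_derivative_compose[of "\<lambda>y. y + a" "\<lambda>h. h"])
      (use assms(1) in \<open>auto simp: gderiv_def intro!: derivative_eq_intros\<close>)
  then have "GDERIV \<psi> x :> G (x + a)" using assms(2) by (simp add: gderiv_def)
  from GDERIV_unique[OF this assms(1)] show ?thesis .
qed

lemma smooth_grad_GDERIV: "smooth_grad \<psi> G \<Longrightarrow> GDERIV \<psi> x :> G x"
  by (simp add: smooth_grad_def)

lemma smooth_grad_periodic: "smooth_grad \<psi> G \<Longrightarrow> \<psi> (x + axis i 1) = \<psi> x"
  by (simp add: smooth_grad_def smooth_periodic_def)

lemma smooth_grad_diff: "smooth_grad \<psi> G \<Longrightarrow> continuously_diff k \<psi>"
  by (simp add: smooth_grad_def smooth_periodic_def)

lemma smooth_grad_continuous: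
  assumes "smooth_grad \<psi> G" shows "continuous_on UNIV \<psi>" "continuous_on UNIV G"
proof -
  show "continuous_on UNIV \<psi>"
    using continuously_diff_continuous[OF smooth_grad_diff[OF assms]] .
  have "continuously_diff 0 (\<lambda>x. G x $ i)" for i
    by (rule continuously_diff_SucD[OF smooth_grad_diff[OF assms] smooth_grad_GDERIV[OF assms]])
  then show "continuous_on UNIV G" by (intro continuous_on_vecI) simp
qed

text \<open>Components of a smooth periodic gradient are smooth and periodic again, so integration
  by parts stays inside the class; the symmetry is what makes rotated gradients
  divergence-free.\<close>

lemma smooth_grad_second:
  assumes "smooth_grad \<psi> G"
  obtains H where "\<And>i. smooth_grad (\<lambda>x. G x $ i) (H i)" "\<And>x. H 1 x $ 2 = H 2 x $ 1"
proof -
  have G: "continuously_diff k (\<lambda>x. G x $ i)" for k i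
    by (rule continuously_diff_SucD[OF smooth_grad_diff[OF assms] smooth_grad_GDERIV[OF assms]])
  have "\<exists>h. \<forall>x. GDERIV (\<lambda>x. G x $ i) x :> h x" for i
    using G[of 1 i] by auto
  then obtain H where H: "\<And>i x. GDERIV (\<lambda>x. G x $ i) x :> H i x" by metis
  have per: "G (x + axis i 1) = G x" for x i
    by (rule GDERIV_periodic[OF smooth_grad_GDERIV[OF assms] smooth_grad_periodic[OF assms]])
  have 1: "smooth_grad (\<lambda>x. G x $ i) (H i)" for i
    unfolding smooth_grad_def smooth_periodic_def using G H per by simp
  have 2: "H 1 x $ 2 = H 2 x $ 1" for x
    by (rule mixed_partials_eq[OF smooth_grad_GDERIV[OF assms] H smooth_grad_continuous(2)[OF 1]])
  from 1 2 that show thesis by blast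
qed

lemma continuously_diff_add:
  "continuously_diff k f \<Longrightarrow> continuously_diff k g \<Longrightarrow> continuously_diff k (\<lambda>x. f x + g x)"
proof (induction k arbitrary: f g)
  case (Suc k)
  then obtain f' g' where *: "\<And>x. GDERIV f x :> f' x" "\<And>i. continuously_diff k (\<lambda>x. f' x $ i)"
    "\<And>x. GDERIV g x :> g' x" "\<And>i. continuously_diff k (\<lambda>x. g' x $ i)" by auto
  then show ?case using Suc.IH[OF *(2) *(4)]
    by (auto intro!: exI[of _ "\<lambda>x. f' x + g' x"] GDERIV_add)
qed (auto intro: continuous_intros)

lemma GDERIV_cmult: "GDERIV f x :> d \<Longrightarrow> GDERIV (\<lambda>x. c * f x) x :> c *\<^sub>R d"
  using GDERIV_mult[OF GDERIV_const[of c x], of f d] by simp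

lemma continuously_diff_cmult: "continuously_diff k f \<Longrightarrow> continuously_diff k (\<lambda>x. c * f x)"
proof (induction k arbitrary: f)
  case (Suc k)
  then obtain f' where *: "\<And>x. GDERIV f x :> f' x" "\<And>i. continuously_diff k (\<lambda>x. f' x $ i)"
    by auto
  then show ?case using Suc.IH[OF *(2)]
    by (auto intro!: exI[of _ "\<lambda>x. c *\<^sub>R f' x"] GDERIV_cmult)
qed (auto intro: continuous_intros)

lemma continuously_diff_const: "continuously_diff k (\<lambda>x. c)"
proof (induction k arbitrary: c)
  case (Suc k)
  then show ?case by (auto intro!: exI[of _ "\<lambda>x. 0"] GDERIV_const)
qed auto

lemma smooth_grad_const: "smooth_grad (\<lambda>x. c) (\<lambda>x. 0)"
  by (simp add: smooth_grad_def smooth_periodic_def continuously_diff_const GDERIV_const)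

lemma smooth_grad_add:
  "smooth_grad f F \<Longrightarrow> smooth_grad g G \<Longrightarrow> smooth_grad (\<lambda>x. f x + g x) (\<lambda>x. F x + G x)"
  by (simp add: smooth_grad_def smooth_periodic_def continuously_diff_add GDERIV_add)

lemma smooth_grad_cmult: "smooth_grad f F \<Longrightarrow> smooth_grad (\<lambda>x. c * f x) (\<lambda>x. c *\<^sub>R F x)"
  by (simp add: smooth_grad_def smooth_periodic_def continuously_diff_cmult GDERIV_cmult)

lemma smooth_grad_square_integrable:
  assumes "smooth_grad \<psi> G" shows "square_integrable \<psi>" "square_integrable G"
  using smooth_grad_continuous[OF assms] by (auto intro: square_integrable_continuous)

lemma smooth_grad_mean_zero:
  assumes "smooth_grad \<psi> G" shows "(\<integral>x. G x \<bullet> c \<partial>cell_measure) = 0"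
proof -
  have "(\<integral>x. G x $ i \<partial>cell_measure) = 0" for i
    by (rule integral_periodic_gradient[OF smooth_grad_GDERIV[OF assms] smooth_grad_continuous(2)[OF assms]
      smooth_grad_periodic[OF assms]])
  moreover have "integrable cell_measure (\<lambda>x. G x $ i)" for i
    by (intro integrable_square_integrable square_integrable_nth smooth_grad_square_integrable(2)[OF assms])
  ultimately show ?thesis by (simp add: inner_vec_def sum_2)
qed

section \<open>Rotated gradients and cosine modes\<close>

lemma R_perp_mult: "R_perp *v v = vector [- (v $ 2), v $ 1]"
  by (simp add: R_perp_def matrix_vector_mult_def vec_eq_iff forall_2 sum_2)

text \<open>The Jacobian is a null Lagrangian: \<open>(R F) \<bullet> G\<close> is the first partial
  of \<open>f G2\<close> minus the second partial of \<open>f G1\<close>, and partials of periodic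
  functions have mean zero.\<close>

lemma smooth_grad_rotated_orthogonal:
  assumes f: "smooth_grad f F" and g: "smooth_grad g G"
  shows "(\<integral>x. (R_perp *v F x) \<bullet> G x \<partial>cell_measure) = 0"
proof -
  obtain H where H: "\<And>i. smooth_grad (\<lambda>x. G x $ i) (H i)" and sym: "\<And>x. H 1 x $ 2 = H 2 x $ 1"
    using smooth_grad_second[OF g] by blast
  note cont = smooth_grad_continuous[OF f] smooth_grad_continuous[OF g] smooth_grad_continuous[OF H]
  have z: "(\<integral>x. (f x *\<^sub>R H i x + (G x $ i) *\<^sub>R F x) $ j \<partial>cell_measure) = 0" for i j
  proof (rule integral_periodic_gradient)
    show "GDERIV (\<lambda>x. f x * G x $ i) x :> (f x *\<^sub>R H i x + (G x $ i) *\<^sub>R F x)" for x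
      by (rule GDERIV_mult[OF smooth_grad_GDERIV[OF f] smooth_grad_GDERIV[OF H]])
    show "continuous_on UNIV (\<lambda>x. f x *\<^sub>R H i x + (G x $ i) *\<^sub>R F x)"
      by (intro continuous_intros cont)
    show "f (x + axis k 1) * G (x + axis k 1) $ i = f x * G x $ i" for x k
      using smooth_grad_periodic[OF f] smooth_grad_periodic[OF H] by simp
  qed
  have int: "integrable cell_measure (\<lambda>x. (f x *\<^sub>R H i x + (G x $ i) *\<^sub>R F x) $ j)" for i j
    by (intro integrable_square_integrable square_integrable_continuous continuous_intros cont)
  have "(R_perp *v F x) \<bullet> G x
      = (f x *\<^sub>R H 2 x + (G x $ 2) *\<^sub>R F x) $ 1 - (f x *\<^sub>R H 1 x + (G x $ 1) *\<^sub>R F x) $ 2" for x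
    using sym[of x] by (simp add: R_perp_mult inner_vec_def sum_2 algebra_simps)
  then show ?thesis using z[of 2 1] z[of 1 2] int[of 2 1] int[of 1 2] by simp
qed

text \<open>The phase \<open>c\<close> covers cosine and sine at once, and differentiation only
  shifts it by \<open>pi/2\<close>, up to a frequency factor.\<close>

definition wave :: "int \<Rightarrow> int \<Rightarrow> real \<Rightarrow> real^2 \<Rightarrow> real" where
  "wave k l c x = cos (2 * pi * (of_int k * x $ 1 + of_int l * x $ 2) + c)"

definition frequency :: "int \<Rightarrow> int \<Rightarrow> real^2" where
  "frequency k l = (2 * pi) *\<^sub>R vector [of_int k, of_int l]"

lemma wave_alt: "wave k l c x = cos (x \<bullet> frequency k l + c)"
  by (simp add: wave_def frequency_def inner_vec_def sum_2 algebra_simps)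

lemma GDERIV_wave: "GDERIV (wave k l c) x :> wave k l (c + pi/2) x *\<^sub>R frequency k l"
proof -
  have "((\<lambda>x. cos (x \<bullet> frequency k l + c)) has_derivative
      (\<lambda>h. - sin (x \<bullet> frequency k l + c) * (h \<bullet> frequency k l))) (at x)"
    by (auto intro!: derivative_eq_intros simp: mult.commute)
  moreover have "- sin (x \<bullet> frequency k l + c) = wave k l (c + pi/2) x"
    by (simp add: wave_alt add.assoc[symmetric] cos_add)
  ultimately show ?thesis by (simp add: gderiv_def wave_alt[abs_def] mult.commute)
qed

lemma smooth_grad_wave: "smooth_grad (wave k l c) (\<lambda>x. wave k l (c + pi/2) x *\<^sub>R frequency k l)"
proof -
  \<comment> \<open>Amplitude and phase must vary in the induction: a derivative multiplies the one
    by a frequency component and shifts the other.\<close>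
  have "continuously_diff n (\<lambda>x. a * wave k l c x)" for n a c
  proof (induction n arbitrary: a c)
    case 0
    show ?case by (auto simp: wave_alt[abs_def] intro!: continuous_intros)
  next
    case (Suc n)
    have "continuously_diff n (\<lambda>x. (a *\<^sub>R wave k l (c + pi/2) x *\<^sub>R frequency k l) $ i)" for i
      using Suc[of "a * frequency k l $ i" "c + pi/2"] by (simp add: mult_ac)
    then show ?case
      by (auto intro!: exI[of _ "\<lambda>x. a *\<^sub>R wave k l (c + pi/2) x *\<^sub>R frequency k l"] GDERIV_cmult GDERIV_wave)
  qed
  from this[of _ 1 c] have cd: "continuously_diff n (wave k l c)" for n by simp
  have per: "wave k l c (x + axis i 1) = wave k l c x" for x i
  proof -
    have s: "cos (y + 2 * pi * of_int m) = cos y" for y m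
      by (metis cos_add cos_int_2pin sin_int_2pin mult.commute mult_zero_right mult_1_right diff_zero)
    consider "i = 1" | "i = 2" using exhaust_2 by blast
    then show ?thesis
    proof cases
      case 1
      have "wave k l c (x + axis i 1)
        = cos ((2 * pi * (of_int k * x $ 1 + of_int l * x $ 2) + c) + 2 * pi * of_int k)"
        unfolding wave_def by (rule arg_cong[of _ _ cos]) (simp add: 1 axis_def algebra_simps)
      then show ?thesis by (simp only: s wave_def)
    next
      case 2
      have "wave k l c (x + axis i 1)
        = cos ((2 * pi * (of_int k * x $ 1 + of_int l * x $ 2) + c) + 2 * pi * of_int l)"
        unfolding wave_def by (rule arg_cong[of _ _ cos]) (simp add: 2 axis_def algebra_simps)
      then show ?thesis by (simp only: s wave_def)
    qed
  qed
  show ?thesis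
    using cd per GDERIV_wave by (simp add: smooth_grad_def smooth_periodic_def)
qed


section \<open>Completeness of the Fourier modes\<close>

lemma wave_mult:
  "wave k l c x * wave k' l' c' x
    = 1/2 * wave (k - k') (l - l') (c - c') x + 1/2 * wave (k + k') (l + l') (c + c') x"
  unfolding wave_def cos_times_cos by (simp add: algebra_simps)

text \<open>Combinations of cosines. The product-to-sum formula makes them closed under products, so
  polynomials in the coordinates of \<open>torus\<close> belong to them.\<close>

inductive trig_poly :: "(real^2 \<Rightarrow> real) \<Rightarrow> bool" where
  wave: "trig_poly (\<lambda>x. a * wave k l c x)"
| add: "trig_poly f \<Longrightarrow> trig_poly g \<Longrightarrow> trig_poly (\<lambda>x. f x + g x)"

lemma trig_poly_const: "trig_poly (\<lambda>x. a)"
  using trig_poly.wave[of a 0 0 0] by (simp add: wave_def)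

lemma trig_poly_wave_mult: "trig_poly g \<Longrightarrow> trig_poly (\<lambda>x. (a * wave k l c x) * g x)"
proof (induction rule: trig_poly.induct)
  case (wave b k' l' c')
  have "(a * wave k l c x) * (b * wave k' l' c' x)
     = (a * b / 2) * wave (k - k') (l - l') (c - c') x + (a * b / 2) * wave (k + k') (l + l') (c + c') x" for x
    using wave_mult[of k l c x k' l' c'] by (simp add: algebra_simps)
  then show ?case by (simp only: trig_poly.intros)
next
  case (add f g)
  then show ?case by (simp add: distrib_left trig_poly.add)
qed

lemma trig_poly_mult: "trig_poly f \<Longrightarrow> trig_poly g \<Longrightarrow> trig_poly (\<lambda>x. f x * g x)"
  by (induction rule: trig_poly.induct) (simp_all add: trig_poly_wave_mult distrib_right trig_poly.add)

text \<open>Glues opposite edges of the cell. Its values lie in a Euclidean space, so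
  Stone-Weierstrass for polynomials applies on its image.\<close>

definition torus :: "real^2 \<Rightarrow> complex \<times> complex" where
  "torus x = (cis (2 * pi * x $ 1), cis (2 * pi * x $ 2))"

lemma continuous_on_torus: "continuous_on S torus"
  unfolding torus_def by (intro continuous_intros)

text \<open>One of the two points has to be interior, since opposite edges have the same
  image.\<close>

lemma torus_inj:
  assumes "torus x = torus y" "x \<in> box 0 1" "y \<in> unit_cell" shows "x = y"
proof -
  have *: "s = t" if "cis (2 * pi * s) = cis (2 * pi * t)" "0 < s" "s < 1" "0 \<le> t" "t \<le> 1" for s t
  proof -
    have "sin (2 * pi * s) = sin (2 * pi * t) \<and> cos (2 * pi * s) = cos (2 * pi * t)"
      using that(1) by (simp add: complex_eq_iff)
    then obtain n :: int where "2 * pi * s = 2 * pi * t + 2 * pi * of_int n"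
      using sin_cos_eq_iff[of "2 * pi * s" "2 * pi * t"] by auto
    then have "2 * pi * s = 2 * pi * (t + of_int n)" by (simp add: algebra_simps)
    then have n: "s = t + of_int n" by simp
    with that have "of_int n < (1 :: real)" "(-1 :: real) < of_int n" by linarith+
    then have "n = 0" by linarith
    with n show ?thesis by simp
  qed
  show ?thesis
    using assms *[of "x $ 1" "y $ 1"] *[of "x $ 2" "y $ 2"]
    by (simp add: torus_def mem_box_cart unit_cell_def vec_eq_iff forall_2)
qed

lemma trig_poly_torus:
  assumes "real_polynomial_function p" shows "trig_poly (\<lambda>x. p (torus x))"
  using assms
proof (induction rule: real_polynomial_function.induct)
  case (linear f)
  interpret bounded_linear f by fact
  \<comment> \<open>A real-linear functional is a combination of real and imaginary parts, and those
    of \<open>cis\<close> are cosines with phase 0 and \<open>- pi/2\<close>.\<close>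
  have dec: "f (z, w) = Re z * f (1, 0) + Im z * f (\<i>, 0) + Re w * f (0, 1) + Im w * f (0, \<i>)" for z w
  proof -
    have zw: "(z, w) = Re z *\<^sub>R (1, 0) + Im z *\<^sub>R (\<i>, 0) + Re w *\<^sub>R (0, 1) + Im w *\<^sub>R (0, \<i>)"
      by (simp add: complex_eq_iff)
    show ?thesis by (subst zw) (simp only: add scaleR real_scaleR_def)
  qed
  have "(\<lambda>x. f (torus x)) = (\<lambda>x. f (1, 0) * wave 1 0 0 x + f (\<i>, 0) * wave 1 0 (- pi/2) x
     + f (0, 1) * wave 0 1 0 x + f (0, \<i>) * wave 0 1 (- pi/2) x)"
    by (rule ext, unfold torus_def, rule trans[OF dec]) (simp add: wave_def cos_diff mult.commute)
  then show ?case by (simp only: trig_poly.intros)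
qed (auto intro: trig_poly_const trig_poly.add trig_poly_mult)

lemma integrable_mult_bounded:
  fixes v w :: "real^2 \<Rightarrow> real"
  assumes v: "integrable cell_measure v" and w: "w \<in> borel_measurable cell_measure"
    and b: "\<And>x. x \<in> unit_cell \<Longrightarrow> \<bar>w x\<bar> \<le> K"
  shows "integrable cell_measure (\<lambda>x. v x * w x)"
proof (rule Bochner_Integration.integrable_bound)
  show "integrable cell_measure (\<lambda>x. K * v x)" using v by simp
  show "(\<lambda>x. v x * w x) \<in> borel_measurable cell_measure" using v w by auto
  show "AE x in cell_measure. norm (v x * w x) \<le> norm (K * v x)"
    using b by (intro AE_I2) (auto simp: abs_mult mult.commute[of K] intro!: mult_left_mono order_trans[OF b])
qed

lemma integrable_mult_continuous:
  fixes v w :: "real^2 \<Rightarrow> real"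
  assumes v: "integrable cell_measure v" and w: "continuous_on UNIV w"
  shows "integrable cell_measure (\<lambda>x. v x * w x)"
proof -
  have "compact (w ` unit_cell)"
    using w continuous_on_subset by (intro compact_continuous_image) (auto simp: unit_cell_eq_cbox)
  then obtain K where "\<And>x. x \<in> unit_cell \<Longrightarrow> \<bar>w x\<bar> \<le> K"
    by (metis bounded_iff compact_imp_bounded imageI real_norm_def)
  then show ?thesis
    by (rule integrable_mult_bounded[OF v square_integrable_measurable[OF square_integrable_continuous[OF w]]])
qed

lemma trig_poly_continuous: "trig_poly f \<Longrightarrow> continuous_on UNIV f"
  by (induction rule: trig_poly.induct) (auto simp: wave_alt intro!: continuous_intros)

lemma orthogonal_trig_poly:
  fixes v :: "real^2 \<Rightarrow> real"
  assumes v: "integrable cell_measure v" and orth: "\<And>k l c. (\<integral>x. v x * wave k l c x \<partial>cell_measure) = 0"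
    and p: "trig_poly p"
  shows "(\<integral>x. v x * p x \<partial>cell_measure) = 0"
  using p
proof (induction rule: trig_poly.induct)
  case (wave a k l c)
  have "(\<integral>x. v x * (a * wave k l c x) \<partial>cell_measure) = (\<integral>x. a * (v x * wave k l c x) \<partial>cell_measure)"
    by (simp add: mult_ac)
  then show ?case using orth[of k l c] by simp
next
  case (add f g)
  then show ?case
    using integrable_mult_continuous[OF v trig_poly_continuous] by (simp add: distrib_left)
qed

text \<open>Stone-Weierstrass approximates \<open>F\<close> uniformly on the compact image of the
  cell by polynomials, whose pullbacks are trigonometric polynomials.\<close>

lemma orthogonal_continuous_torus:
  fixes v :: "real^2 \<Rightarrow> real"
  assumes v: "integrable cell_measure v" and orth: "\<And>k l c. (\<integral>x. v x * wave k l c x \<partial>cell_measure) = 0"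
    and F: "continuous_on UNIV F"
  shows "(\<integral>x. v x * F (torus x) \<partial>cell_measure) = 0"
proof -
  have Ft: "continuous_on UNIV (\<lambda>x. F (torus x))"
    by (rule continuous_on_compose2[OF F continuous_on_torus]) simp
  have "\<bar>\<integral>x. v x * F (torus x) \<partial>cell_measure\<bar> \<le> e" if "e > 0" for e
  proof -
    let ?I = "\<integral>x. \<bar>v x\<bar> \<partial>cell_measure"
    have I: "?I \<ge> 0" by (rule Bochner_Integration.integral_nonneg) simp
    \<comment> \<open>The summand 1 covers the case in which \<open>v\<close> vanishes almost
      everywhere.\<close>
    define d where "d = e / (?I + 1)"
    have d: "d > 0" "d * ?I \<le> e"
    proof -
      have "e / (t + 1) > 0 \<and> e / (t + 1) * t \<le> e" if "t \<ge> 0" for t :: real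
        using that \<open>e > 0\<close> by (auto simp: field_simps)
      from this[OF I] show "d > 0" "d * ?I \<le> e" unfolding d_def by blast+
    qed
    have "compact (torus ` unit_cell)"
      by (intro compact_continuous_image continuous_on_torus) (simp add: unit_cell_eq_cbox)
    then obtain p where p: "real_polynomial_function p"
      "\<And>y. y \<in> torus ` unit_cell \<Longrightarrow> \<bar>F y - p y\<bar> < d"
      using Stone_Weierstrass_real_polynomial_function[of "torus ` unit_cell" F d] d(1)
        continuous_on_subset[OF F] by auto
    note tp = trig_poly_torus[OF p(1)]
    note pc = trig_poly_continuous[OF tp]
    have "(\<integral>x. v x * F (torus x) \<partial>cell_measure)
      = (\<integral>x. v x * (F (torus x) - p (torus x)) \<partial>cell_measure)"
      using orthogonal_trig_poly[OF v orth tp] integrable_mult_continuous[OF v Ft]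
        integrable_mult_continuous[OF v pc] by (simp add: right_diff_distrib)
    also have "\<bar>\<dots>\<bar> \<le> (\<integral>x. \<bar>v x\<bar> * d \<partial>cell_measure)"
    proof (rule order_trans[OF integral_abs_bound], rule integral_mono)
      show "integrable cell_measure (\<lambda>x. \<bar>v x * (F (torus x) - p (torus x))\<bar>)"
        by (intro integrable_abs integrable_mult_continuous[OF v] continuous_intros Ft pc)
      show "integrable cell_measure (\<lambda>x. \<bar>v x\<bar> * d)" using v by simp
      show "\<bar>v x * (F (torus x) - p (torus x))\<bar> \<le> \<bar>v x\<bar> * d" if "x \<in> space cell_measure" for x
        using p(2)[of "torus x"] that by (auto simp: abs_mult intro!: mult_left_mono)
    qed
    also have "\<dots> \<le> e" using d v by (simp add: mult.commute)
    finally show ?thesis .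
  qed
  then have "\<bar>\<integral>x. v x * F (torus x) \<partial>cell_measure\<bar> \<le> 0 + e" if "e > 0" for e
    unfolding add_0_left using that by blast
  then have "\<bar>\<integral>x. v x * F (torus x) \<partial>cell_measure\<bar> \<le> 0"
    by (rule field_le_epsilon)
  then show ?thesis by (simp only: abs_le_zero_iff)
qed

text \<open>Tent functions of the distance to the image of \<open>K\<close> are continuous in
  \<open>torus x\<close> and decrease to the indicator of \<open>K\<close>; dominated convergence
  with bound \<open>|v|\<close> transfers orthogonality. As \<open>K\<close> avoids the boundary, no
  other point of the cell is mapped into its image.\<close>

lemma orthogonal_compact:
  fixes v :: "real^2 \<Rightarrow> real"
  assumes v: "integrable cell_measure v" and orth: "\<And>k l c. (\<integral>x. v x * wave k l c x \<partial>cell_measure) = 0"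
    and K: "compact K" "K \<subseteq> box 0 1"
  shows "(\<integral>x. v x * indicator K x \<partial>cell_measure) = 0"
proof (cases "K = {}")
  case False
  let ?T = "torus ` K"
  have T: "closed ?T" "?T \<noteq> {}"
    using K False by (auto intro!: compact_imp_closed compact_continuous_image continuous_on_torus)
  define F where "F n y = max 0 (1 - real n * infdist y ?T)" for n y
  have Fc: "continuous_on UNIV (F n)" for n
    unfolding F_def by (intro continuous_intros)
  have Ft: "continuous_on UNIV (\<lambda>x. F n (torus x))" for n
    by (rule continuous_on_compose2[OF Fc continuous_on_torus]) simp
  have lim: "(\<lambda>n. F n (torus x)) \<longlonglongrightarrow> indicator K x" if x: "x \<in> unit_cell" for x
  proof (cases "x \<in> K")
    case True
    then have "infdist (torus x) ?T = 0" by simp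
    then show ?thesis using True by (simp add: F_def)
  next
    case False
    have "torus x \<notin> ?T" using torus_inj[of _ x] K(2) x False by auto
    then have pos: "infdist (torus x) ?T > 0"
      using infdist_pos_not_in_closed[OF T] by simp
    obtain N where N: "real N * infdist (torus x) ?T > 1"
      using reals_Archimedean3[OF pos] by metis
    have "F n (torus x) = 0" if "n \<ge> N" for n
    proof -
      have "real N * infdist (torus x) ?T \<le> real n * infdist (torus x) ?T"
        using that pos by (intro mult_right_mono) auto
      then show ?thesis using N by (simp add: F_def)
    qed
    then have "eventually (\<lambda>n. F n (torus x) = 0) sequentially"
      by (rule eventually_sequentiallyI)
    then show ?thesis using False by (simp add: tendsto_eventually)
  qed
  have F01: "\<bar>F n y\<bar> \<le> 1" for n y by (simp add: F_def infdist_nonneg)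
  have Km: "indicat_real K \<in> borel_measurable cell_measure"
  proof (rule borel_measurable_indicator)
    have "K \<subseteq> unit_cell"
      using K(2) box_subset_cbox unfolding unit_cell_eq_cbox by blast
    then show "K \<in> sets cell_measure"
      using fmeasurableD[OF lmeasurable_compact[OF K(1)]] by (simp add: sets_restrict_space_iff)
  qed
  have "(\<lambda>n. \<integral>x. v x * F n (torus x) \<partial>cell_measure) \<longlonglongrightarrow> (\<integral>x. v x * indicator K x \<partial>cell_measure)"
  proof (rule integral_dominated_convergence[where w="\<lambda>x. \<bar>v x\<bar>"])
    show "(\<lambda>x. v x * indicator K x) \<in> borel_measurable cell_measure"
      by (rule borel_measurable_times[OF borel_measurable_integrable[OF v] Km])
    show "(\<lambda>x. v x * F n (torus x)) \<in> borel_measurable cell_measure" for n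
      using integrable_mult_continuous[OF v Ft] by (rule borel_measurable_integrable)
    show "integrable cell_measure (\<lambda>x. \<bar>v x\<bar>)" using v by simp
    show "AE x in cell_measure. (\<lambda>n. v x * F n (torus x)) \<longlonglongrightarrow> v x * indicator K x"
      by (intro AE_I2 tendsto_intros lim) simp
    show "AE x in cell_measure. norm (v x * F n (torus x)) \<le> \<bar>v x\<bar>" for n
      using F01 by (intro AE_I2) (simp add: abs_mult mult_left_le)
  qed
  then show ?thesis
    using orthogonal_continuous_torus[OF v orth Fc] LIMSEQ_unique by (simp add: LIMSEQ_const_iff)
qed simp

text \<open>If \<open>v > 0\<close> on a set of positive measure, inner regularity gives a compact
  subset of positive measure, over which \<open>v\<close> would have to integrate to zero.\<close>

lemma orthogonal_waves_nonpos:
  fixes v :: "real^2 \<Rightarrow> real"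
  assumes v: "integrable cell_measure v" and orth: "\<And>k l c. (\<integral>x. v x * wave k l c x \<partial>cell_measure) = 0"
  shows "AE x in cell_measure. v x \<le> 0"
proof -
  \<comment> \<open>The boundary is cut off because \<open>orthogonal_compact\<close> works in the
    open cell; it is a null set and returns at the end.\<close>
  define S where "S = {x \<in> box 0 1. v x > 0}"
  have "{x \<in> space cell_measure. v x > 0} \<in> sets cell_measure"
    using v by measurable
  then have "{x \<in> unit_cell. v x > 0} \<in> sets lebesgue"
    by (auto simp: sets_restrict_space)
  moreover have "S = {x \<in> unit_cell. v x > 0} \<inter> box 0 1"
    by (auto simp: S_def unit_cell_eq_cbox dest: box_subset_cbox[THEN subsetD])
  ultimately have Sm: "S \<in> sets lebesgue" by auto
  have "S \<in> null_sets lebesgue"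
  proof (rule ccontr)
    assume notnull: "S \<notin> null_sets lebesgue"
    have "S \<in> lmeasurable"
      by (rule bounded_set_imp_lmeasurable[OF _ Sm]) (auto simp: S_def intro: bounded_subset[OF bounded_box])
    then have Se: "emeasure lebesgue S = ennreal (measure lebesgue S)"
      by (rule emeasure_eq_measure2)
    then have "measure lebesgue S > 0"
      using notnull Sm by (metis ennreal_0 measure_nonneg null_setsI order_less_le)
    \<comment> \<open>The tolerance is the whole measure of \<open>S\<close>, so a null set
      \<open>T\<close> would violate it.\<close>
    then obtain T where T: "closed T" "T \<subseteq> S" "S - T \<in> lmeasurable"
      "emeasure lebesgue (S - T) < ennreal (measure lebesgue S)"
      using sets_lebesgue_inner_closed[OF Sm] by metis
    have Tb: "T \<subseteq> box 0 1" using T(2) by (auto simp: S_def)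
    have Tc: "compact T"
      using T(1) bounded_subset[OF bounded_box Tb] by (simp add: compact_eq_bounded_closed)
    have Tl: "T \<in> sets lebesgue" using T(1) by simp
    have Tcell: "T \<subseteq> unit_cell"
      using Tb box_subset_cbox unfolding unit_cell_eq_cbox by blast
    have int0: "(\<integral>x. v x * indicator T x \<partial>cell_measure) = 0"
      by (rule orthogonal_compact[OF v orth Tc Tb])
    have Tm: "indicat_real T \<in> borel_measurable cell_measure"
      by (intro borel_measurable_indicator) (use Tl Tcell in \<open>auto simp: sets_restrict_space_iff\<close>)
    have "AE x in cell_measure. v x * indicator T x = 0"
    proof (subst integral_nonneg_eq_0_iff_AE[symmetric])
      show "integrable cell_measure (\<lambda>x. v x * indicator T x)"
        by (rule integrable_mult_bounded[OF v Tm, of 1]) (simp add: indicator_def)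
      show "AE x in cell_measure. 0 \<le> v x * indicator T x"
        using T(2) by (intro AE_I2) (auto simp: S_def indicator_def)
    qed (rule int0)
    then have "AE x in cell_measure. x \<notin> T"
      by eventually_elim (use T(2) in \<open>auto simp: S_def indicator_def split: if_splits\<close>)
    then have "AE x in lebesgue. x \<in> unit_cell \<longrightarrow> x \<notin> T"
      by (subst (asm) AE_restrict_space_iff) auto
    then have "AE x in lebesgue. x \<notin> T"
      by eventually_elim (use Tcell in auto)
    then have "T \<in> null_sets lebesgue"
      using Tl by (simp add: AE_iff_null_sets)
    then have "emeasure lebesgue (S - T) = emeasure lebesgue S"
      by (intro emeasure_Diff_null_set Sm)
    with T(4) Se show False by simp
  qed
  then have 1: "AE x in lebesgue. x \<notin> S" by (rule AE_not_in)
  have "unit_cell - box 0 1 \<in> null_sets lebesgue"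
    using negligible_frontier_interval[of "0 :: real^2" 1]
    by (simp add: negligible_iff_null_sets unit_cell_eq_cbox)
  then have 2: "AE x in lebesgue. x \<notin> unit_cell - box 0 1" by (rule AE_not_in)
  have "AE x in lebesgue. x \<in> unit_cell \<longrightarrow> v x \<le> 0"
    using 1 2 by eventually_elim (auto simp: S_def)
  then show ?thesis by (subst AE_restrict_space_iff) auto
qed

lemma orthogonal_waves_zero:
  fixes v :: "real^2 \<Rightarrow> real"
  assumes v: "integrable cell_measure v" and orth: "\<And>k l c. (\<integral>x. v x * wave k l c x \<partial>cell_measure) = 0"
  shows "AE x in cell_measure. v x = 0"
proof -
  have "AE x in cell_measure. v x \<le> 0" by (rule orthogonal_waves_nonpos[OF v orth])
  moreover have "AE x in cell_measure. - v x \<le> 0"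
    using v orth by (intro orthogonal_waves_nonpos) auto
  ultimately show ?thesis by eventually_elim simp
qed


section \<open>Periodic potentials and divergence-free fields\<close>

text \<open>With the scalar error written through \<open>norm\<close>, the same \<open>L2\<close>
  lemmas serve potentials and gradients.\<close>

lemma H1_per_iff:
  "H1_per \<phi> g \<longleftrightarrow> square_integrable \<phi> \<and> square_integrable g \<and>
     (\<exists>\<psi> G. (\<forall>n. smooth_grad (\<psi> n) (G n)) \<and>
        (\<lambda>n::nat. \<integral>x. (norm (\<psi> n x - \<phi> x))\<^sup>2 \<partial>cell_measure) \<longlonglongrightarrow> 0 \<and>
        (\<lambda>n. \<integral>x. (norm (G n x - g x))\<^sup>2 \<partial>cell_measure) \<longlonglongrightarrow> 0)"
  by (simp add: H1_per_def smooth_grad_def)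

lemma H1_per_square_integrable: "H1_per \<phi> g \<Longrightarrow> square_integrable g"
  by (simp add: H1_per_def)

lemma div_free_iff:
  "div_free J \<longleftrightarrow> square_integrable J \<and>
     (\<forall>\<psi> G. smooth_grad \<psi> G \<longrightarrow> (\<integral>x. J x \<bullet> G x \<partial>cell_measure) = 0)"
  by (simp add: div_free_def smooth_grad_def)

lemma div_free_square_integrable: "div_free J \<Longrightarrow> square_integrable J"
  by (simp add: div_free_def)

lemma L2_limit_add:
  fixes f :: "nat \<Rightarrow> real^2 \<Rightarrow> 'a::euclidean_space"
  assumes "\<And>n. square_integrable (f n)" "square_integrable f0"
    "\<And>n. square_integrable (g n)" "square_integrable g0"
    and f: "(\<lambda>n. \<integral>x. (norm (f n x - f0 x))\<^sup>2 \<partial>cell_measure) \<longlonglongrightarrow> 0"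
    and g: "(\<lambda>n. \<integral>x. (norm (g n x - g0 x))\<^sup>2 \<partial>cell_measure) \<longlonglongrightarrow> 0"
  shows "(\<lambda>n. \<integral>x. (norm ((f n x + g n x) - (f0 x + g0 x)))\<^sup>2 \<partial>cell_measure) \<longlonglongrightarrow> 0"
proof -
  have le: "(norm ((f n x + g n x) - (f0 x + g0 x)))\<^sup>2 \<le> 2 * (norm (f n x - f0 x))\<^sup>2 + 2 * (norm (g n x - g0 x))\<^sup>2"
    for n x
  proof -
    have "norm ((f n x + g n x) - (f0 x + g0 x)) \<le> norm (f n x - f0 x) + norm (g n x - g0 x)"
      using norm_triangle_ineq[of "f n x - f0 x" "g n x - g0 x"] by (simp add: algebra_simps)
    then have "(norm ((f n x + g n x) - (f0 x + g0 x)))\<^sup>2 \<le> (norm (f n x - f0 x) + norm (g n x - g0 x))\<^sup>2"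
      by (rule power_mono) simp
    also have "\<dots> \<le> 2 * (norm (f n x - f0 x))\<^sup>2 + 2 * (norm (g n x - g0 x))\<^sup>2"
      using sum_squares_bound[of "norm (f n x - f0 x)" "norm (g n x - g0 x)"] by (simp add: power2_sum)
    finally show ?thesis .
  qed
  have i: "integrable cell_measure (\<lambda>x. (norm (f n x - f0 x))\<^sup>2)"
     "integrable cell_measure (\<lambda>x. (norm (g n x - g0 x))\<^sup>2)"
     "integrable cell_measure (\<lambda>x. (norm ((f n x + g n x) - (f0 x + g0 x)))\<^sup>2)" for n
    by (intro square_integrable_sq square_integrable_diff square_integrable_add assms)+
  have "(\<integral>x. (norm ((f n x + g n x) - (f0 x + g0 x)))\<^sup>2 \<partial>cell_measure)
      \<le> 2 * (\<integral>x. (norm (f n x - f0 x))\<^sup>2 \<partial>cell_measure) + 2 * (\<integral>x. (norm (g n x - g0 x))\<^sup>2 \<partial>cell_measure)" for n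
  proof -
    have "(\<integral>x. (norm ((f n x + g n x) - (f0 x + g0 x)))\<^sup>2 \<partial>cell_measure)
      \<le> (\<integral>x. 2 * (norm (f n x - f0 x))\<^sup>2 + 2 * (norm (g n x - g0 x))\<^sup>2 \<partial>cell_measure)"
      using i by (intro integral_mono le Bochner_Integration.integrable_add integrable_mult_right)
    then show ?thesis using i by simp
  qed
  then have ub: "\<forall>\<^sub>F n in sequentially. (\<integral>x. (norm ((f n x + g n x) - (f0 x + g0 x)))\<^sup>2 \<partial>cell_measure)
      \<le> 2 * (\<integral>x. (norm (f n x - f0 x))\<^sup>2 \<partial>cell_measure) + 2 * (\<integral>x. (norm (g n x - g0 x))\<^sup>2 \<partial>cell_measure)"
    by (intro always_eventually allI)
  have lb: "\<forall>\<^sub>F n in sequentially. 0 \<le> (\<integral>x. (norm ((f n x + g n x) - (f0 x + g0 x)))\<^sup>2 \<partial>cell_measure)"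
    by (intro always_eventually allI Bochner_Integration.integral_nonneg) simp
  have "(\<lambda>n. 2 * (\<integral>x. (norm (f n x - f0 x))\<^sup>2 \<partial>cell_measure) + 2 * (\<integral>x. (norm (g n x - g0 x))\<^sup>2 \<partial>cell_measure))
      \<longlonglongrightarrow> 2 * 0 + 2 * 0"
    by (intro tendsto_intros f g)
  then show ?thesis
    by (intro tendsto_sandwich[OF lb ub tendsto_const]) simp
qed

lemma H1_per_add:
  assumes "H1_per \<phi> g" "H1_per \<phi>' g'"
  shows "H1_per (\<lambda>x. \<phi> x + \<phi>' x) (\<lambda>x. g x + g' x)"
proof -
  obtain \<psi> G where 1: "\<And>n. smooth_grad (\<psi> n) (G n)"
    "(\<lambda>n::nat. \<integral>x. (norm (\<psi> n x - \<phi> x))\<^sup>2 \<partial>cell_measure) \<longlonglongrightarrow> 0"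
    "(\<lambda>n. \<integral>x. (norm (G n x - g x))\<^sup>2 \<partial>cell_measure) \<longlonglongrightarrow> 0"
    using assms(1) unfolding H1_per_iff by blast
  obtain \<psi>' G' where 2: "\<And>n. smooth_grad (\<psi>' n) (G' n)"
    "(\<lambda>n::nat. \<integral>x. (norm (\<psi>' n x - \<phi>' x))\<^sup>2 \<partial>cell_measure) \<longlonglongrightarrow> 0"
    "(\<lambda>n. \<integral>x. (norm (G' n x - g' x))\<^sup>2 \<partial>cell_measure) \<longlonglongrightarrow> 0"
    using assms(2) unfolding H1_per_iff by blast
  have si: "square_integrable \<phi>" "square_integrable g" "square_integrable \<phi>'" "square_integrable g'"
    using assms by (simp_all add: H1_per_def)
  show ?thesis
    unfolding H1_per_iff
    by (intro conjI exI[of _ "\<lambda>n x. \<psi> n x + \<psi>' n x"] exI[of _ "\<lambda>n x. G n x + G' n x"] allI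
        square_integrable_add si smooth_grad_add L2_limit_add 1 2
        smooth_grad_square_integrable(1)[OF 1(1)] smooth_grad_square_integrable(2)[OF 1(1)]
        smooth_grad_square_integrable(1)[OF 2(1)] smooth_grad_square_integrable(2)[OF 2(1)])
qed

lemma H1_per_scaleR:
  assumes "H1_per \<phi> g" shows "H1_per (\<lambda>x. c * \<phi> x) (\<lambda>x. c *\<^sub>R g x)"
proof -
  obtain \<psi> G where 1: "\<And>n. smooth_grad (\<psi> n) (G n)"
    "(\<lambda>n::nat. \<integral>x. (norm (\<psi> n x - \<phi> x))\<^sup>2 \<partial>cell_measure) \<longlonglongrightarrow> 0"
    "(\<lambda>n. \<integral>x. (norm (G n x - g x))\<^sup>2 \<partial>cell_measure) \<longlonglongrightarrow> 0"
    using assms(1) unfolding H1_per_iff by blast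
  have si: "square_integrable \<phi>" "square_integrable g"
    using assms by (simp_all add: H1_per_def)
  have lim: "(\<lambda>n. \<integral>x. (norm (c *\<^sub>R f n x - c *\<^sub>R f0 x))\<^sup>2 \<partial>cell_measure) \<longlonglongrightarrow> 0"
    if "(\<lambda>n. \<integral>x. (norm (f n x - f0 x))\<^sup>2 \<partial>cell_measure) \<longlonglongrightarrow> 0"
    for f :: "nat \<Rightarrow> real^2 \<Rightarrow> 'a::euclidean_space" and f0
  proof -
    have "(\<lambda>n. c\<^sup>2 * (\<integral>x. (norm (f n x - f0 x))\<^sup>2 \<partial>cell_measure)) \<longlonglongrightarrow> c\<^sup>2 * 0"
      by (intro tendsto_intros that)
    moreover have "(norm (c *\<^sub>R f n x - c *\<^sub>R f0 x))\<^sup>2 = c\<^sup>2 * (norm (f n x - f0 x))\<^sup>2" for n x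
      by (simp add: scaleR_diff_right[symmetric] power_mult_distrib)
    ultimately show ?thesis by simp
  qed
  show ?thesis
    unfolding H1_per_iff
    using lim[OF 1(2)] lim[OF 1(3)] square_integrable_scaleR[OF si(1)] square_integrable_scaleR[OF si(2)]
      smooth_grad_cmult[OF 1(1)]
    by (intro conjI exI[of _ "\<lambda>n x. c * \<psi> n x"] exI[of _ "\<lambda>n x. c *\<^sub>R G n x"] allI) auto
qed

text \<open>The Fourier argument identifies a rotated flux with a gradient only almost everywhere;
  this puts the rotated flux itself into \<open>H1_per\<close>.\<close>

lemma H1_per_gradient_cong_AE:
  assumes "H1_per \<phi> g" "square_integrable g'" "AE x in cell_measure. g x = g' x"
  shows "H1_per \<phi> g'"
proof -
  obtain \<psi> G where 1: "\<And>n. smooth_grad (\<psi> n) (G n)"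
    "(\<lambda>n::nat. \<integral>x. (norm (\<psi> n x - \<phi> x))\<^sup>2 \<partial>cell_measure) \<longlonglongrightarrow> 0"
    "(\<lambda>n. \<integral>x. (norm (G n x - g x))\<^sup>2 \<partial>cell_measure) \<longlonglongrightarrow> 0"
    using assms(1) unfolding H1_per_iff by blast
  have "(\<integral>x. (norm (G n x - g x))\<^sup>2 \<partial>cell_measure) = (\<integral>x. (norm (G n x - g' x))\<^sup>2 \<partial>cell_measure)" for n
  proof (rule integral_cong_AE)
    show "(\<lambda>x. (norm (G n x - g x))\<^sup>2) \<in> borel_measurable cell_measure"
      by (intro borel_measurable_integrable square_integrable_sq square_integrable_diff
          smooth_grad_square_integrable(2)[OF 1(1)] H1_per_square_integrable[OF assms(1)])
    show "(\<lambda>x. (norm (G n x - g' x))\<^sup>2) \<in> borel_measurable cell_measure"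
      by (intro borel_measurable_integrable square_integrable_sq square_integrable_diff
          smooth_grad_square_integrable(2)[OF 1(1)] assms(2))
    show "AE x in cell_measure. (norm (G n x - g x))\<^sup>2 = (norm (G n x - g' x))\<^sup>2"
      using assms(3) by eventually_elim simp
  qed
  with 1 assms show ?thesis unfolding H1_per_iff by auto
qed

text \<open>Density: pairing with \<open>v\<close> is \<open>L2\<close>-continuous, and every
  \<open>H1_per\<close> gradient is a limit of smooth ones.\<close>

lemma H1_per_inner_limit:
  assumes "H1_per \<phi> g" and v: "square_integrable v"
    and z: "\<And>\<psi> G. smooth_grad \<psi> G \<Longrightarrow> (\<integral>x. G x \<bullet> v x \<partial>cell_measure) = 0"
  shows "(\<integral>x. g x \<bullet> v x \<partial>cell_measure) = 0"
proof -
  obtain \<psi> G where 1: "\<And>n. smooth_grad (\<psi> n) (G n)"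
    "(\<lambda>n. \<integral>x. (norm (G n x - g x))\<^sup>2 \<partial>cell_measure) \<longlonglongrightarrow> 0"
    using assms(1) unfolding H1_per_iff by blast
  have "(\<lambda>n. \<integral>x. G n x \<bullet> v x \<partial>cell_measure) \<longlonglongrightarrow> (\<integral>x. g x \<bullet> v x \<partial>cell_measure)"
    by (rule L2_limit_inner[OF smooth_grad_square_integrable(2)[OF 1(1)] H1_per_square_integrable[OF assms(1)] v 1(2)])
  then show ?thesis using z[OF 1(1)] by (simp add: LIMSEQ_const_iff)
qed

section \<open>Pairing of divergence-free fields with gradients\<close>

lemma div_free_H1_orthogonal:
  assumes "div_free J" "H1_per \<phi> g" shows "(\<integral>x. J x \<bullet> g x \<partial>cell_measure) = 0"
  using H1_per_inner_limit[OF assms(2) div_free_square_integrable[OF assms(1)]] assms(1)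
  by (simp add: div_free_iff inner_commute)

lemma div_free_const: "div_free (\<lambda>x. c)"
  unfolding div_free_iff using smooth_grad_mean_zero by (simp add: inner_commute)

text \<open>Constants are divergence-free, hence orthogonal to gradients.\<close>

lemma H1_per_mean_zero:
  assumes "H1_per \<phi> g" shows "(\<integral>x. g x \<partial>cell_measure) = 0"
proof -
  have "(\<integral>x. c \<bullet> g x \<partial>cell_measure) = 0" for c
    by (rule div_free_H1_orthogonal[OF div_free_const assms])
  then have "c \<bullet> (\<integral>x. g x \<partial>cell_measure) = 0" for c
    using integrable_square_integrable[OF H1_per_square_integrable[OF assms]] by simp
  then show ?thesis by (metis inner_eq_zero_iff)
qed

lemma R_perp_inner_swap: "(R_perp *v v) \<bullet> w = - (v \<bullet> (R_perp *v w))"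
  by (simp add: R_perp_mult inner_vec_def sum_2)

lemma R_perp_R_perp [simp]: "R_perp *v (R_perp *v v) = - v"
  by (simp add: R_perp_mult vec_eq_iff forall_2)

text \<open>The null-Lagrangian identity for two smooth gradients, extended in one argument by
  density.\<close>

lemma div_free_rotated_gradient:
  assumes "H1_per \<phi> g" shows "div_free (\<lambda>x. R_perp *v g x)"
  unfolding div_free_iff
proof (intro conjI allI impI)
  show "square_integrable (\<lambda>x. R_perp *v g x)"
    by (intro square_integrable_matrix H1_per_square_integrable[OF assms])
  fix \<psi> G assume G: "smooth_grad \<psi> G"
  have "(\<integral>x. g x \<bullet> (R_perp *v G x) \<partial>cell_measure) = 0"
  proof (rule H1_per_inner_limit[OF assms])
    show "square_integrable (\<lambda>x. R_perp *v G x)"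
      by (intro square_integrable_matrix smooth_grad_square_integrable(2)[OF G])
    fix \<psi>' G' assume "smooth_grad \<psi>' G'"
    from smooth_grad_rotated_orthogonal[OF G this]
    show "(\<integral>x. G' x \<bullet> (R_perp *v G x) \<partial>cell_measure) = 0" by (simp add: inner_commute)
  qed
  then show "(\<integral>x. (R_perp *v g x) \<bullet> G x \<partial>cell_measure) = 0" by (simp add: R_perp_inner_swap)
qed

lemma div_free_add: 
  assumes "div_free J" "div_free K" shows "div_free (\<lambda>x. J x + K x)"
proof -
  have "(\<integral>x. (J x + K x) \<bullet> G x \<partial>cell_measure) = 0" if "smooth_grad \<psi> G" for \<psi> G
  proof -
    have "integrable cell_measure (\<lambda>x. J x \<bullet> G x)" "integrable cell_measure (\<lambda>x. K x \<bullet> G x)"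
      by (intro integrable_inner_square_integrable div_free_square_integrable assms
        smooth_grad_square_integrable(2)[OF that])+
    then show ?thesis using assms that by (simp add: div_free_iff inner_add_left)
  qed
  then show ?thesis
    using assms by (auto simp: div_free_iff)
qed

lemma div_free_scaleR: "div_free J \<Longrightarrow> div_free (\<lambda>x. c *\<^sub>R J x)"
  by (auto simp: div_free_iff)

lemma div_free_cong:
  assumes "\<And>x. x \<in> unit_cell \<Longrightarrow> J x = K x" shows "div_free J = div_free K"
proof -
  have "(\<integral>x. J x \<bullet> G x \<partial>cell_measure) = (\<integral>x. K x \<bullet> G x \<partial>cell_measure)" for G
    using assms by (intro Bochner_Integration.integral_cong) auto
  then show ?thesis using square_integrable_cong[OF assms] by (simp add: div_free_iff)
qed

text \<open>Uniform ellipticity. The weight 1 gives the orthogonal projection onto gradients, the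
  two-phase weight gives the conductivity problem.\<close>

locale bounded_weight =
  fixes \<eta> :: "real^2 \<Rightarrow> real" and lo hi :: real
  assumes measurable: "\<eta> \<in> borel_measurable cell_measure"
    and lo: "0 < lo" "\<And>x. x \<in> unit_cell \<Longrightarrow> lo \<le> \<eta> x"
    and hi: "\<And>x. x \<in> unit_cell \<Longrightarrow> \<eta> x \<le> hi"
begin

definition energy :: "(real^2 \<Rightarrow> real^2) \<Rightarrow> (real^2 \<Rightarrow> real^2) \<Rightarrow> real" where
  "energy u v = (\<integral>x. (\<eta> x *\<^sub>R u x) \<bullet> v x \<partial>cell_measure)"

lemma square_integrable_weight: "square_integrable u \<Longrightarrow> square_integrable (\<lambda>x. \<eta> x *\<^sub>R u x)"
  using measurable lo hi by (intro square_integrable_bounded_scale[of u \<eta> hi]) force+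

lemma integrable_energy:
  "square_integrable u \<Longrightarrow> square_integrable v \<Longrightarrow> integrable cell_measure (\<lambda>x. (\<eta> x *\<^sub>R u x) \<bullet> v x)"
  by (intro integrable_inner_square_integrable square_integrable_weight)

lemma energy_expand:
  assumes u: "square_integrable u" and v: "square_integrable v"
  shows "energy (\<lambda>x. u x + t *\<^sub>R v x) (\<lambda>x. u x + t *\<^sub>R v x) = energy u u + 2 * t * energy u v + t\<^sup>2 * energy v v"
proof -
  have "(\<eta> x *\<^sub>R (u x + t *\<^sub>R v x)) \<bullet> (u x + t *\<^sub>R v x)
      = (\<eta> x *\<^sub>R u x) \<bullet> u x + 2 * t * ((\<eta> x *\<^sub>R u x) \<bullet> v x) + t\<^sup>2 * ((\<eta> x *\<^sub>R v x) \<bullet> v x)" for x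
    by (simp add: inner_add_left inner_add_right inner_commute[of "v x" "u x"] algebra_simps power2_eq_square)
  then show ?thesis
    unfolding energy_def
    using integrable_energy[OF u u] integrable_energy[OF u v] integrable_energy[OF v v] by simp
qed

lemma energy_lower:
  assumes u: "square_integrable u"
  shows "lo * (\<integral>x. (norm (u x))\<^sup>2 \<partial>cell_measure) \<le> energy u u"
proof -
  have "lo * (\<integral>x. (norm (u x))\<^sup>2 \<partial>cell_measure) = (\<integral>x. lo * (norm (u x))\<^sup>2 \<partial>cell_measure)" by simp
  also have "\<dots> \<le> energy u u"
    unfolding energy_def
  proof (rule integral_mono)
    show "integrable cell_measure (\<lambda>x. lo * (norm (u x))\<^sup>2)" using u by auto
    show "integrable cell_measure (\<lambda>x. (\<eta> x *\<^sub>R u x) \<bullet> u x)" by (rule integrable_energy[OF u u])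
    show "lo * (norm (u x))\<^sup>2 \<le> (\<eta> x *\<^sub>R u x) \<bullet> u x" if "x \<in> space cell_measure" for x
      using lo(2)[of x] that by (simp add: power2_norm_eq_inner mult_right_mono)
  qed
  finally show ?thesis .
qed

lemma energy_nonneg: "square_integrable u \<Longrightarrow> 0 \<le> energy u u"
proof (erule order_trans[rotated, OF energy_lower])
  show "0 \<le> lo * (\<integral>x. (norm (u x))\<^sup>2 \<partial>cell_measure)"
    using lo(1) by (intro mult_nonneg_nonneg Bochner_Integration.integral_nonneg) auto
qed

text \<open>The last term is the energy of the midpoint. As midpoints of admissible fields are
  admissible, near-minimisers must be close to each other.\<close>

lemma parallelogram:
  assumes a: "square_integrable a" and b: "square_integrable b"
  shows "energy (\<lambda>x. b x - a x) (\<lambda>x. b x - a x)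
    = 2 * energy a a + 2 * energy b b
      - 4 * energy (\<lambda>x. a x + (1/2) *\<^sub>R (b x - a x)) (\<lambda>x. a x + (1/2) *\<^sub>R (b x - a x))"
proof -
  have c: "square_integrable (\<lambda>x. b x - a x)" using a b by auto
  show ?thesis using energy_expand[OF a c, of 1] energy_expand[OF a c, of "1/2"]
    by (simp add: power2_eq_square)
qed

end


section \<open>Weighted projection and duality in the plane\<close>

text \<open>By Poincare, mean-zero potentials are Cauchy along with their gradients, so both
  converge and the limits form a pair in \<open>H1_per\<close>.\<close>

lemma L2_cauchy_smooth_limit:
  assumes sm: "\<And>n. smooth_grad (\<psi> n) (G n)" and mean: "\<And>n. (\<integral>x. \<psi> n x \<partial>cell_measure) = 0"
    and cauchy: "\<And>e. e > 0 \<Longrightarrow> \<exists>N. \<forall>m\<ge>N. \<forall>n\<ge>N. (\<integral>x. (norm (G m x - G n x))\<^sup>2 \<partial>cell_measure) < e"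
  obtains \<phi> g where "H1_per \<phi> g" "(\<lambda>n. \<integral>x. (norm (G n x - g x))\<^sup>2 \<partial>cell_measure) \<longlonglongrightarrow> 0"
proof -
  have P: "(\<integral>x. (norm (\<psi> m x - \<psi> n x))\<^sup>2 \<partial>cell_measure) \<le> (\<integral>x. (norm (G m x - G n x))\<^sup>2 \<partial>cell_measure)"
    for m n
  proof -
    have "(\<integral>x. (\<psi> m x - \<psi> n x)\<^sup>2 \<partial>cell_measure) \<le> (\<integral>x. (norm (G m x - G n x))\<^sup>2 \<partial>cell_measure)"
    proof (rule Poincare_cell)
      show "GDERIV (\<lambda>x. \<psi> m x - \<psi> n x) x :> (G m x - G n x)" for x
        by (intro GDERIV_diff smooth_grad_GDERIV[OF sm])
      show "continuous_on UNIV (\<lambda>x. G m x - G n x)"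
        by (intro continuous_intros smooth_grad_continuous(2)[OF sm])
      show "(\<integral>x. \<psi> m x - \<psi> n x \<partial>cell_measure) = 0"
        using mean integrable_square_integrable[OF smooth_grad_square_integrable(1)[OF sm]] by simp
    qed
    then show ?thesis by simp
  qed
  obtain g where g: "square_integrable g" "(\<lambda>n. \<integral>x. (norm (G n x - g x))\<^sup>2 \<partial>cell_measure) \<longlonglongrightarrow> 0"
    by (rule L2_complete[of G, OF smooth_grad_square_integrable(2)[OF sm] cauchy])
  obtain \<phi> where \<phi>: "square_integrable \<phi>" "(\<lambda>n. \<integral>x. (norm (\<psi> n x - \<phi> x))\<^sup>2 \<partial>cell_measure) \<longlonglongrightarrow> 0"
  proof (rule L2_complete[of \<psi>, OF smooth_grad_square_integrable(1)[OF sm]])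
    fix e :: real assume "e > 0"
    then obtain N where "\<forall>m\<ge>N. \<forall>n\<ge>N. (\<integral>x. (norm (G m x - G n x))\<^sup>2 \<partial>cell_measure) < e"
      using cauchy by blast
    then show "\<exists>N. \<forall>m\<ge>N. \<forall>n\<ge>N. (\<integral>x. (norm (\<psi> m x - \<psi> n x))\<^sup>2 \<partial>cell_measure) < e"
      using P by (meson le_less_trans)
  qed blast
  have "H1_per \<phi> g" unfolding H1_per_iff using sm g \<phi> by blast
  with g(2) that show thesis by blast
qed

text \<open>Subtracting the mean keeps the gradient and makes Poincare applicable.\<close>

lemma smooth_grad_centered:
  assumes "smooth_grad \<psi> G"
  shows "smooth_grad (\<lambda>x. \<psi> x + - (\<integral>x. \<psi> x \<partial>cell_measure)) G"
    "(\<integral>x. \<psi> x + - (\<integral>x. \<psi> x \<partial>cell_measure) \<partial>cell_measure) = 0"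
proof -
  show "smooth_grad (\<lambda>x. \<psi> x + - (\<integral>x. \<psi> x \<partial>cell_measure)) G"
    using smooth_grad_add[OF assms smooth_grad_const] by (simp only: add_0_right)
  show "(\<integral>x. \<psi> x + - (\<integral>x. \<psi> x \<partial>cell_measure) \<partial>cell_measure) = 0"
    using integrable_square_integrable[OF smooth_grad_square_integrable(1)[OF assms]]
    by (subst Bochner_Integration.integral_add) auto
qed

context bounded_weight
begin

lemma minimizing_sequence_Cauchy:
  assumes sm: "\<And>n. smooth_grad (\<psi> n) (G n)" and F: "square_integrable F"
    and d: "\<And>\<psi> G. smooth_grad \<psi> G \<Longrightarrow> d \<le> energy (\<lambda>x. F x + G x) (\<lambda>x. F x + G x)"
    and near: "\<And>n. energy (\<lambda>x. F x + G n x) (\<lambda>x. F x + G n x) < d + inverse (real (Suc n))"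
    and e: "e > 0"
  shows "\<exists>N. \<forall>m\<ge>N. \<forall>n\<ge>N. (\<integral>x. (norm (G m x - G n x))\<^sup>2 \<partial>cell_measure) < e"
proof -
  have siG: "square_integrable (G n)" for n by (rule smooth_grad_square_integrable(2)[OF sm])
  have siFG: "square_integrable (\<lambda>x. F x + G n x)" for n
    by (intro square_integrable_add F siG)
  have bd: "lo * (\<integral>x. (norm (G m x - G n x))\<^sup>2 \<partial>cell_measure)
      < 2 * inverse (real (Suc m)) + 2 * inverse (real (Suc n))" for m n
  proof -
    have "smooth_grad (\<lambda>x. \<psi> n x + (1/2) * (\<psi> m x + (-1) * \<psi> n x))
        (\<lambda>x. G n x + (1/2) *\<^sub>R (G m x + (-1) *\<^sub>R G n x))"
      by (intro smooth_grad_add smooth_grad_cmult sm)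
    from d[OF this]
    have mid: "d \<le> energy (\<lambda>x. (F x + G n x) + (1/2) *\<^sub>R ((F x + G m x) - (F x + G n x)))
        (\<lambda>x. (F x + G n x) + (1/2) *\<^sub>R ((F x + G m x) - (F x + G n x)))"
      by (simp add: add.assoc)
    have "lo * (\<integral>x. (norm (G m x - G n x))\<^sup>2 \<partial>cell_measure)
        \<le> energy (\<lambda>x. (F x + G m x) - (F x + G n x)) (\<lambda>x. (F x + G m x) - (F x + G n x))"
      using energy_lower[OF square_integrable_diff[OF siG[of m] siG[of n]]] by simp
    also have "\<dots> < 2 * inverse (real (Suc m)) + 2 * inverse (real (Suc n))"
      using parallelogram[OF siFG[of n] siFG[of m]] mid near[of n] near[of m] by linarith
    finally show ?thesis .
  qed
  \<comment> \<open>Two terms, each below \<open>2 k\<close>, add up to less than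
    \<open>lo * e\<close>.\<close>
  define k where "k = lo * e / 4"
  have k: "k > 0" using lo(1) e by (simp add: k_def)
  then obtain N where N: "inverse (real (Suc N)) < k" using reals_Archimedean by blast
  have small: "inverse (real (Suc n)) < k" if "n \<ge> N" for n
  proof -
    have "inverse (real (Suc n)) \<le> inverse (real (Suc N))"
      using that by (intro le_imp_inverse_le) auto
    then show ?thesis using N by (rule order_le_less_trans)
  qed
  have "(\<integral>x. (norm (G m x - G n x))\<^sup>2 \<partial>cell_measure) < e" if "m \<ge> N" "n \<ge> N" for m n
  proof -
    have "lo * (\<integral>x. (norm (G m x - G n x))\<^sup>2 \<partial>cell_measure) < lo * e"
      using bd[of m n] small[OF that(1)] small[OF that(2)] unfolding k_def by linarith
    then show ?thesis by (rule mult_left_less_imp_less) (rule less_imp_le[OF lo(1)])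
  qed
  then show ?thesis by blast
qed

text \<open>The direct method: minimise the energy of \<open>F + G\<close> over smooth periodic
  gradients \<open>G\<close>. Near-minimisers are Cauchy, and the vanishing first variation of the
  limit is the divergence condition.\<close>

lemma weighted_projection:
  assumes F: "square_integrable F"
  obtains \<phi> g where "H1_per \<phi> g" "div_free (\<lambda>x. \<eta> x *\<^sub>R (F x + g x))"
proof -
  define E where "E G = energy (\<lambda>x. F x + G x) (\<lambda>x. F x + G x)" for G
  define V where "V = {E G |\<psi> G. smooth_grad \<psi> G}"
  define d where "d = Inf V"
  have V: "V \<noteq> {}" unfolding V_def using smooth_grad_const by blast
  have V0: "0 \<le> y" if "y \<in> V" for y
  proof -
    from that obtain G \<psi> where "y = E G" "smooth_grad \<psi> G" by (auto simp: V_def)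
    then show ?thesis unfolding E_def
      by (simp add: energy_nonneg F smooth_grad_square_integrable(2) square_integrable_add)
  qed
  then have bdd: "bdd_below V" by (rule bdd_belowI)
  have dle: "d \<le> E G" if "smooth_grad \<psi> G" for \<psi> G
    unfolding d_def using that bdd by (intro cInf_lower) (auto simp: V_def)
  have "\<exists>\<psi> G. smooth_grad \<psi> G \<and> (\<integral>x. \<psi> x \<partial>cell_measure) = 0 \<and> E G < d + inverse (real (Suc n))" for n
  proof -
    have "Inf V < d + inverse (real (Suc n))" unfolding d_def by simp
    then obtain y where "y \<in> V" "y < d + inverse (real (Suc n))"
      using cInf_lessD[OF V] by blast
    then obtain \<psi> G where "smooth_grad \<psi> G" "E G < d + inverse (real (Suc n))"
      unfolding V_def by blast
    with smooth_grad_centered[of \<psi> G] show ?thesis by blast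
  qed
  then obtain \<psi> G where sm: "\<And>n. smooth_grad (\<psi> n) (G n)"
    and mean: "\<And>n. (\<integral>x. \<psi> n x \<partial>cell_measure) = 0"
    and near: "\<And>n. E (G n) < d + inverse (real (Suc n))" by metis
  have siG: "square_integrable (G n)" for n by (rule smooth_grad_square_integrable(2)[OF sm])
  have siFG: "square_integrable (\<lambda>x. F x + G n x)" for n
    by (intro square_integrable_add F siG)
  obtain \<phi> g where g: "H1_per \<phi> g" "(\<lambda>n. \<integral>x. (norm (G n x - g x))\<^sup>2 \<partial>cell_measure) \<longlonglongrightarrow> 0"
  proof (rule L2_cauchy_smooth_limit[OF sm mean])
    show "\<exists>N. \<forall>m\<ge>N. \<forall>n\<ge>N. (\<integral>x. (norm (G m x - G n x))\<^sup>2 \<partial>cell_measure) < e" if "e > 0" for e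
      by (rule minimizing_sequence_Cauchy[OF sm F dle[unfolded E_def] near[unfolded E_def] that])
  qed blast
  have sig: "square_integrable g" by (rule H1_per_square_integrable[OF g(1)])
  have siFg: "square_integrable (\<lambda>x. F x + g x)" by (intro square_integrable_add F sig)
  have "(\<integral>x. (\<eta> x *\<^sub>R (F x + g x)) \<bullet> X x \<partial>cell_measure) = 0" if X: "smooth_grad \<xi> X" for \<xi> X
  proof -
    have siX: "square_integrable X" by (rule smooth_grad_square_integrable(2)[OF X])
    define B where "B = energy (\<lambda>x. F x + g x) X"
    define C where "C = energy X X"
    have lim: "(\<lambda>n. energy (\<lambda>x. F x + G n x) X) \<longlonglongrightarrow> B"
    proof -
      have "(\<lambda>n. \<integral>x. (F x + G n x) \<bullet> (\<eta> x *\<^sub>R X x) \<partial>cell_measure)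
          \<longlonglongrightarrow> (\<integral>x. (F x + g x) \<bullet> (\<eta> x *\<^sub>R X x) \<partial>cell_measure)"
        by (rule L2_limit_inner[OF siFG siFg square_integrable_weight[OF siX]]) (simp add: g(2))
      then show ?thesis by (simp add: B_def energy_def)
    qed
    \<comment> \<open>The limit \<open>g\<close> need not be a smooth gradient, so minimality is
      used along the sequence, where the competitors are smooth, and then passed to the
      limit.\<close>
    have ineq: "0 \<le> 2 * t * B + t\<^sup>2 * C" for t
    proof -
      have "0 \<le> inverse (real (Suc n)) + 2 * t * energy (\<lambda>x. F x + G n x) X + t\<^sup>2 * C" for n
      proof -
        have "smooth_grad (\<lambda>x. \<psi> n x + t * \<xi> x) (\<lambda>x. G n x + t *\<^sub>R X x)"
          by (intro smooth_grad_add smooth_grad_cmult sm X)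
        from dle[OF this] have "d \<le> E (G n) + 2 * t * energy (\<lambda>x. F x + G n x) X + t\<^sup>2 * C"
          using energy_expand[OF siFG[of n] siX, of t] by (simp add: E_def C_def add.assoc)
        with near[of n] show ?thesis by linarith
      qed
      moreover have "(\<lambda>n. inverse (real (Suc n)) + 2 * t * energy (\<lambda>x. F x + G n x) X + t\<^sup>2 * C)
          \<longlonglongrightarrow> 0 + 2 * t * B + t\<^sup>2 * C"
        by (intro tendsto_intros lim LIMSEQ_inverse_real_of_nat)
      ultimately have "0 \<le> 0 + 2 * t * B + t\<^sup>2 * C"
        by (intro LIMSEQ_le_const) auto
      then show ?thesis by simp
    qed
    have C0: "0 \<le> C" unfolding C_def by (rule energy_nonneg[OF siX])
    have "B = 0"
    proof -
      \<comment> \<open>The denominator \<open>C + 1\<close> in place of \<open>C\<close> also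
        covers \<open>C = 0\<close>.\<close>
      define t where "t = - B / (C + 1)"
      have tC: "t * (C + 1) = - B" using C0 by (simp add: t_def)
      have "0 \<le> (C + 1)\<^sup>2 * (2 * t * B + t\<^sup>2 * C)" using ineq[of t] by simp
      also have "\<dots> = 2 * (t * (C + 1)) * B * (C + 1) + (t * (C + 1))\<^sup>2 * C"
        by (simp add: algebra_simps power2_eq_square)
      also have "\<dots> = - (B\<^sup>2 * (C + 2))" unfolding tC by (simp add: algebra_simps power2_eq_square)
      finally have "B\<^sup>2 * (C + 2) \<le> 0" by simp
      then show ?thesis using C0 by (simp add: mult_le_0_iff)
    qed
    then show ?thesis by (simp add: B_def energy_def)
  qed
  then have "div_free (\<lambda>x. \<eta> x *\<^sub>R (F x + g x))"
    unfolding div_free_iff using square_integrable_weight[OF siFg] by blast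
  with g(1) that show thesis by blast
qed

end

section \<open>Rotated divergence-free fields are gradients\<close>

lemma bounded_weight_const: "0 < c \<Longrightarrow> bounded_weight (\<lambda>x. c) c c"
  by unfold_locales auto

text \<open>A field orthogonal to all gradients, all rotated gradients and all constants is orthogonal to
  every Fourier mode, because a nonzero frequency and its rotation span the plane.\<close>

lemma orthogonal_gradients_rotated_zero:
  assumes w: "square_integrable w" and mean: "(\<integral>x. w x \<partial>cell_measure) = 0"
    and o1: "\<And>\<psi> G. smooth_grad \<psi> G \<Longrightarrow> (\<integral>x. w x \<bullet> G x \<partial>cell_measure) = 0"
    and o2: "\<And>\<psi> G. smooth_grad \<psi> G \<Longrightarrow> (\<integral>x. w x \<bullet> (R_perp *v G x) \<partial>cell_measure) = 0"
  shows "AE x in cell_measure. w x = 0"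
proof -
  have wint: "integrable cell_measure (\<lambda>x. w x \<bullet> a)" for a
    using integrable_square_integrable[OF w] by simp
  have wi: "integrable cell_measure (\<lambda>x. w x $ i)" for i
    by (intro integrable_square_integrable square_integrable_nth w)
  have waveint: "integrable cell_measure (\<lambda>x. (w x \<bullet> a) * wave k l c x)" for a k l c
    by (rule integrable_mult_continuous[OF wint smooth_grad_continuous(1)[OF smooth_grad_wave]])
  have orth: "(\<integral>x. w x $ i * wave k l c x \<partial>cell_measure) = 0" for i k l c
  proof (cases "k = 0 \<and> l = 0")
    \<comment> \<open>The zero frequency is the constant mode, which only the mean controls.\<close>
    case True
    have "(\<integral>x. w x $ i \<partial>cell_measure) = (\<integral>x. w x \<bullet> axis i 1 \<partial>cell_measure)"
      by (simp add: inner_axis)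
    also have "\<dots> = 0" using integrable_square_integrable[OF w] mean by simp
    finally show ?thesis using True wi[of i] by (simp add: wave_def)
  next
    case False
    define \<nu> where "\<nu> = frequency k l"
    have \<nu>0: "\<nu> \<noteq> 0" using False by (auto simp: \<nu>_def frequency_def vec_eq_iff forall_2)
    \<comment> \<open>The shifted phase makes the gradient equal to the wave of phase
      \<open>c\<close> times the frequency.\<close>
    have g: "smooth_grad (wave k l (c - pi/2)) (\<lambda>x. wave k l c x *\<^sub>R \<nu>)"
      using smooth_grad_wave[of k l "c - pi/2"] by (simp add: \<nu>_def)
    have a: "(\<integral>x. (w x \<bullet> \<nu>) * wave k l c x \<partial>cell_measure) = 0"
      using o1[OF g] by (simp add: mult.commute)
    have b: "(\<integral>x. (w x \<bullet> (R_perp *v \<nu>)) * wave k l c x \<partial>cell_measure) = 0"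
      using o2[OF g] by (simp add: mult.commute matrix_vector_mult_scaleR)
    have "(\<nu> \<bullet> \<nu>) * v $ i = \<nu> $ i * (v \<bullet> \<nu>) + (R_perp *v \<nu>) $ i * (v \<bullet> (R_perp *v \<nu>))" for v
      using exhaust_2[of i] by (auto simp: R_perp_mult inner_vec_def sum_2 algebra_simps)
    then have "(\<nu> \<bullet> \<nu>) * (w x $ i * wave k l c x) = \<nu> $ i * ((w x \<bullet> \<nu>) * wave k l c x)
       + (R_perp *v \<nu>) $ i * ((w x \<bullet> (R_perp *v \<nu>)) * wave k l c x)" for x
      by (metis (no_types, opaque_lifting) distrib_right mult.assoc)
    then have "(\<integral>x. (\<nu> \<bullet> \<nu>) * (w x $ i * wave k l c x) \<partial>cell_measure)
      = \<nu> $ i * (\<integral>x. (w x \<bullet> \<nu>) * wave k l c x \<partial>cell_measure)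
       + (R_perp *v \<nu>) $ i * (\<integral>x. (w x \<bullet> (R_perp *v \<nu>)) * wave k l c x \<partial>cell_measure)"
      using waveint[of \<nu>] waveint[of "R_perp *v \<nu>"] by simp
    then show ?thesis using a b \<nu>0 by simp
  qed
  have "AE x in cell_measure. w x $ i = 0" for i
    by (rule orthogonal_waves_zero[OF wi orth])
  from this[of 1] this[of 2] show ?thesis
    by eventually_elim (simp add: vec_eq_iff forall_2)
qed

text \<open>Projecting \<open>- F\<close> leaves \<open>w = g - F\<close> divergence-free. It is
  orthogonal to rotated gradients as well: \<open>g\<close> because it is a gradient,
  \<open>R J\<close> because rotation preserves inner products and \<open>J\<close> is
  divergence-free, the constant because rotated gradients have mean zero.\<close>

lemma div_free_rotated_is_gradient:
  assumes J: "div_free J"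
  obtains \<phi> where "H1_per \<phi> (\<lambda>x. R_perp *v J x - R_perp *v (\<integral>x. J x \<partial>cell_measure))"
proof -
  interpret bounded_weight "\<lambda>x. 1" 1 1 by (rule bounded_weight_const) simp
  define c where "c = R_perp *v (\<integral>x. J x \<partial>cell_measure)"
  define F where "F x = R_perp *v J x - c" for x
  have siJ: "square_integrable J" by (rule div_free_square_integrable[OF J])
  have siRJ: "square_integrable (\<lambda>x. R_perp *v J x)" using siJ by (rule square_integrable_matrix)
  have siF: "square_integrable F" unfolding F_def
    by (intro square_integrable_diff siRJ square_integrable_const)
  obtain \<phi> g where g: "H1_per \<phi> g" "div_free (\<lambda>x. 1 *\<^sub>R (- F x + g x))"
    using weighted_projection[OF square_integrable_minus[OF siF]] by blast
  define w where "w x = g x - F x" for x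
  have dw: "div_free w" using g(2) by (simp add: w_def[abs_def] add.commute)
  have sig: "square_integrable g" by (rule H1_per_square_integrable[OF g(1)])
  have "(\<integral>x. R_perp *v J x \<partial>cell_measure) = c"
    unfolding c_def
    by (rule integral_bounded_linear[OF matrix_vector_mul_bounded_linear integrable_square_integrable[OF siJ]])
  then have "(\<integral>x. F x \<partial>cell_measure) = 0"
    unfolding F_def using integrable_square_integrable[OF siRJ] by simp
  then have mean: "(\<integral>x. w x \<partial>cell_measure) = 0"
    unfolding w_def using H1_per_mean_zero[OF g(1)] integrable_square_integrable[OF siF]
      integrable_square_integrable[OF sig] by simp
  have "AE x in cell_measure. w x = 0"
  proof (rule orthogonal_gradients_rotated_zero[OF div_free_square_integrable[OF dw] mean])
    fix \<psi> G assume G: "smooth_grad \<psi> G"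
    show "(\<integral>x. w x \<bullet> G x \<partial>cell_measure) = 0" using dw G by (simp add: div_free_iff)
    have siG: "square_integrable G" by (rule smooth_grad_square_integrable(2)[OF G])
    have siRG: "square_integrable (\<lambda>x. R_perp *v G x)" using siG by (rule square_integrable_matrix)
    have 1: "(\<integral>x. g x \<bullet> (R_perp *v G x) \<partial>cell_measure) = 0"
      using div_free_rotated_gradient[OF g(1)] G by (simp add: div_free_iff R_perp_inner_swap)
    have 2: "(\<integral>x. (R_perp *v J x) \<bullet> (R_perp *v G x) \<partial>cell_measure) = 0"
      using J G by (simp add: div_free_iff R_perp_inner_swap)
    have 3: "(\<integral>x. c \<bullet> (R_perp *v G x) \<partial>cell_measure) = 0"
      using smooth_grad_mean_zero[OF G, of "R_perp *v c"]
      by (simp add: inner_commute[of c] R_perp_inner_swap)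
    note ii = integrable_inner_square_integrable
    have "(\<integral>x. w x \<bullet> (R_perp *v G x) \<partial>cell_measure)
      = (\<integral>x. g x \<bullet> (R_perp *v G x) - ((R_perp *v J x) \<bullet> (R_perp *v G x) - c \<bullet> (R_perp *v G x)) \<partial>cell_measure)"
      by (simp add: w_def F_def inner_diff_left)
    also have "\<dots> = 0"
      using 1 2 3 ii[OF sig siRG] ii[OF siRJ siRG] ii[OF square_integrable_const siRG, of c] by simp
    finally show "(\<integral>x. w x \<bullet> (R_perp *v G x) \<partial>cell_measure) = 0" .
  qed
  then have "AE x in cell_measure. g x = F x" by (simp add: w_def)
  from H1_per_gradient_cong_AE[OF g(1) siF this] that show thesis
    by (simp add: F_def[abs_def] c_def)
qed


section \<open>The effective conductivity\<close>

text \<open>Subtracting \<open>m\<close> from the diagonal leaves a positive semidefinite form; its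
  determinant and trace are nonnegative, and expanding \<open>a d\<close> gives the bound.\<close>

lemma det_ge_of_quadratic_form_ge:
  fixes a b d m :: real
  assumes q: "\<And>x y. m * (x\<^sup>2 + y\<^sup>2) \<le> a * x\<^sup>2 + 2 * b * x * y + d * y\<^sup>2" and m: "0 \<le> m"
  shows "m\<^sup>2 \<le> a * d - b\<^sup>2"
proof -
  define a' d' where "a' = a - m" and "d' = d - m"
  have q': "0 \<le> a' * x\<^sup>2 + 2 * b * x * y + d' * y\<^sup>2" for x y
    using q[of x y] by (simp add: a'_def d'_def algebra_simps)
  have a': "0 \<le> a'" and d': "0 \<le> d'" using q'[of 1 0] q'[of 0 1] by simp_all
  \<comment> \<open>The vectors \<open>(- b, a')\<close> and \<open>(d', - b)\<close> each produce a
    diagonal entry times the determinant.\<close>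
  have "0 \<le> a' * (a' * d' - b\<^sup>2)"
    using q'[of "- b" a'] by (simp add: algebra_simps power2_eq_square)
  moreover have "0 \<le> d' * (a' * d' - b\<^sup>2)"
    using q'[of d' "- b"] by (simp add: algebra_simps power2_eq_square)
  ultimately have s: "0 \<le> (a' + d') * (a' * d' - b\<^sup>2)" by (simp add: distrib_right)
  have "b\<^sup>2 \<le> a' * d'"
  proof (cases "a' + d' = 0")
    \<comment> \<open>With a zero diagonal, the vectors \<open>(1, 1)\<close> and
      \<open>(1, -1)\<close> force \<open>b = 0\<close>.\<close>
    case True
    then have "a' = 0" "d' = 0" using a' d' by linarith+
    then show ?thesis using q'[of 1 1] q'[of 1 "-1"] by simp
  next
    case False
    then show ?thesis using s a' d' by (simp add: zero_le_mult_iff)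
  qed
  moreover have "a * d = m\<^sup>2 + m * (a' + d') + a' * d'"
    by (simp add: a'_def d'_def algebra_simps power2_eq_square)
  moreover have "0 \<le> m * (a' + d')" using m a' d' by simp
  ultimately show ?thesis by linarith
qed

context bounded_weight
begin

definition weight_field :: "real^2 \<Rightarrow> (real^2 \<Rightarrow> real^2) \<Rightarrow> bool" where
  "weight_field e0 e \<longleftrightarrow> (\<exists>\<phi> g. H1_per \<phi> g \<and> e = (\<lambda>x. e0 + g x)) \<and> div_free (\<lambda>x. \<eta> x *\<^sub>R e x)"

definition mean_flux :: "(real^2 \<Rightarrow> real^2) \<Rightarrow> real^2" where
  "mean_flux e = (\<integral>x. \<eta> x *\<^sub>R e x \<partial>cell_measure)"

lemma weight_field_exists: "\<exists>e. weight_field e0 e"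
proof -
  obtain \<phi> g where "H1_per \<phi> g" "div_free (\<lambda>x. \<eta> x *\<^sub>R (e0 + g x))"
    by (rule weighted_projection[OF square_integrable_const])
  then show ?thesis unfolding weight_field_def by blast
qed

lemma weight_field_square_integrable:
  assumes "weight_field a e" shows "square_integrable e"
proof -
  obtain \<phi> g where "H1_per \<phi> g" "e = (\<lambda>x. a + g x)" using assms unfolding weight_field_def by blast
  then show ?thesis using square_integrable_add[OF square_integrable_const H1_per_square_integrable] by simp
qed

lemma weight_field_add:
  assumes "weight_field a e" "weight_field b f"
  shows "weight_field (a + b) (\<lambda>x. e x + f x)"
proof -
  obtain \<phi> g \<phi>' g' where 1: "H1_per \<phi> g" "e = (\<lambda>x. a + g x)" "div_free (\<lambda>x. \<eta> x *\<^sub>R e x)"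
    and 2: "H1_per \<phi>' g'" "f = (\<lambda>x. b + g' x)" "div_free (\<lambda>x. \<eta> x *\<^sub>R f x)"
    using assms unfolding weight_field_def by blast
  have "div_free (\<lambda>x. \<eta> x *\<^sub>R (e x + f x))"
    using div_free_add[OF 1(3) 2(3)] by (simp add: scaleR_add_right)
  moreover have "(\<lambda>x. e x + f x) = (\<lambda>x. (a + b) + (g x + g' x))"
    by (simp add: 1 2 algebra_simps)
  ultimately show ?thesis using H1_per_add[OF 1(1) 2(1)] unfolding weight_field_def by blast
qed

lemma weight_field_scaleR:
  assumes "weight_field a e" shows "weight_field (c *\<^sub>R a) (\<lambda>x. c *\<^sub>R e x)"
proof -
  obtain \<phi> g where 1: "H1_per \<phi> g" "e = (\<lambda>x. a + g x)" "div_free (\<lambda>x. \<eta> x *\<^sub>R e x)"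
    using assms unfolding weight_field_def by blast
  have "div_free (\<lambda>x. \<eta> x *\<^sub>R (c *\<^sub>R e x))"
    using div_free_scaleR[OF 1(3), of c] by (simp add: mult.commute)
  moreover have "(\<lambda>x. c *\<^sub>R e x) = (\<lambda>x. c *\<^sub>R a + c *\<^sub>R g x)"
    by (simp add: 1 algebra_simps)
  ultimately show ?thesis using H1_per_scaleR[OF 1(1)] unfolding weight_field_def by blast
qed

lemma integrable_flux: "square_integrable e \<Longrightarrow> integrable cell_measure (\<lambda>x. \<eta> x *\<^sub>R e x)"
  by (intro integrable_square_integrable square_integrable_weight)

lemma mean_flux_add:
  "square_integrable e \<Longrightarrow> square_integrable f \<Longrightarrow> mean_flux (\<lambda>x. e x + f x) = mean_flux e + mean_flux f"
  unfolding mean_flux_def scaleR_add_right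
  by (intro Bochner_Integration.integral_add integrable_flux)

lemma mean_flux_scaleR: "mean_flux (\<lambda>x. c *\<^sub>R e x) = c *\<^sub>R mean_flux e"
  unfolding mean_flux_def by (subst scaleR_left_commute) (rule integral_scaleR_right)

lemma energy_commute: "energy u v = energy v u"
  by (simp add: energy_def inner_commute)

text \<open>The gradient part of \<open>e\<close> is orthogonal to the divergence-free flux of
  \<open>f\<close>, so only the mean \<open>a\<close> meets it. Symmetry and bounds of the effective
  matrix rest on this.\<close>

lemma energy_eq_mean_flux:
  assumes e: "weight_field a e" and f: "weight_field b f"
  shows "energy f e = a \<bullet> mean_flux f"
proof -
  obtain \<phi> g where g: "H1_per \<phi> g" "e = (\<lambda>x. a + g x)" using e unfolding weight_field_def by blast
  have df: "div_free (\<lambda>x. \<eta> x *\<^sub>R f x)" using f unfolding weight_field_def by blast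
  have i: "integrable cell_measure (\<lambda>x. \<eta> x *\<^sub>R f x)"
    by (rule integrable_flux[OF weight_field_square_integrable[OF f]])
  have "energy f e = (\<integral>x. (\<eta> x *\<^sub>R f x) \<bullet> a + (\<eta> x *\<^sub>R f x) \<bullet> g x \<partial>cell_measure)"
    unfolding energy_def g(2) by (simp only: inner_add_right)
  also have "\<dots> = (\<integral>x. (\<eta> x *\<^sub>R f x) \<bullet> a \<partial>cell_measure) + (\<integral>x. (\<eta> x *\<^sub>R f x) \<bullet> g x \<partial>cell_measure)"
    by (rule Bochner_Integration.integral_add)
      (intro integrable_inner_square_integrable div_free_square_integrable[OF df] square_integrable_const
        H1_per_square_integrable[OF g(1)])+
  also have "(\<integral>x. (\<eta> x *\<^sub>R f x) \<bullet> g x \<partial>cell_measure) = 0"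
    by (rule div_free_H1_orthogonal[OF df g(1)])
  also have "(\<integral>x. (\<eta> x *\<^sub>R f x) \<bullet> a \<partial>cell_measure) = mean_flux f \<bullet> a"
    unfolding mean_flux_def by (rule integral_inner_left) (use i in simp)
  finally show ?thesis by (simp add: inner_commute)
qed

text \<open>Uniqueness: a solution of mean zero has zero energy and, by ellipticity, vanishes almost
  everywhere.\<close>

lemma weight_field_zero_mean_flux:
  assumes "weight_field 0 e" shows "mean_flux e = 0"
proof -
  have si: "square_integrable e" by (rule weight_field_square_integrable[OF assms])
  have "lo * (\<integral>x. (norm (e x))\<^sup>2 \<partial>cell_measure) \<le> 0"
    using energy_lower[OF si] energy_eq_mean_flux[OF assms assms] by simp
  moreover have "0 \<le> (\<integral>x. (norm (e x))\<^sup>2 \<partial>cell_measure)"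
    by (rule Bochner_Integration.integral_nonneg) simp
  ultimately have "(\<integral>x. (norm (e x))\<^sup>2 \<partial>cell_measure) = 0"
    using lo(1) by (simp add: mult_le_0_iff)
  then have "AE x in cell_measure. (norm (e x))\<^sup>2 = 0"
    using square_integrable_sq[OF si] by (subst (asm) integral_nonneg_eq_0_iff_AE) auto
  then have "AE x in cell_measure. \<eta> x *\<^sub>R e x = 0"
    by eventually_elim simp
  then show ?thesis unfolding mean_flux_def by (rule integral_eq_zero_AE)
qed

text \<open>The columns are the mean fluxes of solutions for the two unit vectors. Any solution
  differs from their combination by one of mean zero, so \<open>S\<close> serves every solution and
  not just a chosen one.\<close>

lemma effective_matrix_exists:
  "\<exists>S. \<forall>a e. weight_field a e \<longrightarrow> (S :: real^2^2) *v a = mean_flux e"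
proof -
  obtain f1 f2 where f: "weight_field (axis 1 1) f1" "weight_field (axis 2 1) f2"
    using weight_field_exists by metis
  define S :: "real^2^2" where "S = (\<chi> i j. if j = 1 then mean_flux f1 $ i else mean_flux f2 $ i)"
  have "S *v a = mean_flux e" if e: "weight_field a e" for a e
  proof -
    let ?r = "\<lambda>x. e x + ((- (a $ 1)) *\<^sub>R f1 x + (- (a $ 2)) *\<^sub>R f2 x)"
    have "weight_field (a + ((- (a $ 1)) *\<^sub>R axis 1 1 + (- (a $ 2)) *\<^sub>R axis 2 1)) ?r"
      by (intro weight_field_add weight_field_scaleR e f)
    moreover have "a + ((- (a $ 1)) *\<^sub>R axis 1 1 + (- (a $ 2)) *\<^sub>R axis 2 1) = 0"
      by (simp add: vec_eq_iff forall_2 axis_def)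
    ultimately have "mean_flux ?r = 0" using weight_field_zero_mean_flux by simp
    moreover have "mean_flux ?r = mean_flux e + ((- (a $ 1)) *\<^sub>R mean_flux f1 + (- (a $ 2)) *\<^sub>R mean_flux f2)"
      using e f weight_field_square_integrable
      by (simp only: mean_flux_add mean_flux_scaleR square_integrable_add square_integrable_scaleR)
    ultimately have "mean_flux e = (a $ 1) *\<^sub>R mean_flux f1 + (a $ 2) *\<^sub>R mean_flux f2"
      by (simp add: algebra_simps add_eq_0_iff2)
    then show ?thesis
      by (simp add: S_def matrix_vector_mult_def vec_eq_iff forall_2 sum_2 mult.commute)
  qed
  then show ?thesis by blast
qed

text \<open>From below, the mean square of \<open>e\<close> is at least the square of its mean
  \<open>a\<close>; from above, the constant field \<open>a\<close> is a competitor. By symmetry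
  \<open>det S\<close> is at most the product of the diagonal entries.\<close>

lemma effective_matrix_bounds:
  fixes S :: "real^2^2"
  assumes S: "\<And>a e. weight_field a e \<Longrightarrow> S *v a = mean_flux e"
  shows "S $ 1 $ 2 = S $ 2 $ 1" "lo\<^sup>2 \<le> det S" "det S \<le> hi\<^sup>2"
proof -
  have energy_S: "energy f e = a \<bullet> (S *v b)" if "weight_field a e" "weight_field b f" for a b e f
    using energy_eq_mean_flux[OF that] S[OF that(2)] by simp
  show sym: "S $ 1 $ 2 = S $ 2 $ 1"
  proof -
    obtain f1 f2 where f: "weight_field (axis 1 1) f1" "weight_field (axis 2 1) f2"
      using weight_field_exists by metis
    have "axis 1 1 \<bullet> (S *v axis 2 1) = axis 2 1 \<bullet> (S *v axis 1 1)"
      using energy_S[OF f] energy_S[OF f(2) f(1)] energy_commute[of f1 f2] by simp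
    then show ?thesis by (simp add: inner_axis' matrix_vector_mult_basis column_def)
  qed
  have lower: "lo * (norm a)\<^sup>2 \<le> a \<bullet> (S *v a)" and upper: "a \<bullet> (S *v a) \<le> hi * (norm a)\<^sup>2" for a
  proof -
    obtain e where e: "weight_field a e" using weight_field_exists by blast
    obtain \<phi> g where g: "H1_per \<phi> g" "e = (\<lambda>x. a + g x)" using e unfolding weight_field_def by blast
    have de: "div_free (\<lambda>x. \<eta> x *\<^sub>R e x)" using e unfolding weight_field_def by blast
    have sie: "square_integrable e" and sig: "square_integrable g"
      by (rule weight_field_square_integrable[OF e], rule H1_per_square_integrable[OF g(1)])
    have "(norm a)\<^sup>2 \<le> (\<integral>x. (norm (e x))\<^sup>2 \<partial>cell_measure)"
    proof -
      have "(\<integral>x. (norm (e x))\<^sup>2 \<partial>cell_measure) = (\<integral>x. (norm a)\<^sup>2 + 2 * (a \<bullet> g x) + (norm (g x))\<^sup>2 \<partial>cell_measure)"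
        unfolding g(2) power2_norm_eq_inner
        by (intro Bochner_Integration.integral_cong) (auto simp: inner_add_left inner_add_right inner_commute)
      also have "\<dots> = (norm a)\<^sup>2 + 2 * (a \<bullet> (\<integral>x. g x \<partial>cell_measure)) + (\<integral>x. (norm (g x))\<^sup>2 \<partial>cell_measure)"
        using integrable_square_integrable[OF sig] square_integrable_sq[OF sig] by simp
      also have "\<dots> \<ge> (norm a)\<^sup>2"
        using Bochner_Integration.integral_nonneg[of cell_measure "\<lambda>x. (norm (g x))\<^sup>2"]
        by (simp add: H1_per_mean_zero[OF g(1)])
      finally show ?thesis .
    qed
    then have "lo * (norm a)\<^sup>2 \<le> lo * (\<integral>x. (norm (e x))\<^sup>2 \<partial>cell_measure)"
      using lo(1) by (simp add: mult_left_mono)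
    also have "\<dots> \<le> a \<bullet> (S *v a)" using energy_lower[OF sie] energy_S[OF e e] by simp
    finally show "lo * (norm a)\<^sup>2 \<le> a \<bullet> (S *v a)" .
    \<comment> \<open>Pythagoras: \<open>e - g\<close> is the constant \<open>a\<close>, and
      \<open>e\<close> is energy-orthogonal to \<open>g\<close>.\<close>
    have "energy e g = 0" unfolding energy_def by (rule div_free_H1_orthogonal[OF de g(1)])
    then have "a \<bullet> (S *v a) + energy g g = energy (\<lambda>x. a) (\<lambda>x. a)"
      using energy_expand[OF sie sig, of "-1"] energy_S[OF e e] by (simp add: g(2))
    then have "a \<bullet> (S *v a) \<le> energy (\<lambda>x. a) (\<lambda>x. a)"
      using energy_nonneg[OF sig] by simp
    also have "\<dots> \<le> (\<integral>x. hi * (norm a)\<^sup>2 \<partial>cell_measure)"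
      unfolding energy_def
    proof (rule integral_mono)
      show "integrable cell_measure (\<lambda>x. (\<eta> x *\<^sub>R a) \<bullet> a)" by (intro integrable_energy square_integrable_const)
      show "(\<eta> x *\<^sub>R a) \<bullet> a \<le> hi * (norm a)\<^sup>2" if "x \<in> space cell_measure" for x
        using hi[of x] that by (simp add: power2_norm_eq_inner mult_right_mono)
    qed simp
    finally show "a \<bullet> (S *v a) \<le> hi * (norm a)\<^sup>2" by simp
  qed
  have form: "vector [x, y] \<bullet> (S *v vector [x, y])
      = S $ 1 $ 1 * x\<^sup>2 + 2 * S $ 1 $ 2 * x * y + S $ 2 $ 2 * y\<^sup>2" for x y
    using sym by (simp add: inner_vec_def matrix_vector_mult_def sum_2 power2_eq_square algebra_simps)
  have nrm: "(norm (vector [x, y] :: real^2))\<^sup>2 = x\<^sup>2 + y\<^sup>2" for x y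
    unfolding power2_norm_eq_inner by (simp add: inner_vec_def sum_2 power2_eq_square)
  have "lo\<^sup>2 \<le> S $ 1 $ 1 * S $ 2 $ 2 - (S $ 1 $ 2)\<^sup>2"
  proof (rule det_ge_of_quadratic_form_ge)
    show "lo * (x\<^sup>2 + y\<^sup>2) \<le> S $ 1 $ 1 * x\<^sup>2 + 2 * S $ 1 $ 2 * x * y + S $ 2 $ 2 * y\<^sup>2" for x y
      using lower[of "vector [x, y]"] unfolding form nrm .
  qed (use lo(1) in simp)
  then show "lo\<^sup>2 \<le> det S" using sym by (simp add: det_2 power2_eq_square)
  have d: "0 \<le> S $ 1 $ 1" "S $ 1 $ 1 \<le> hi" "0 \<le> S $ 2 $ 2" "S $ 2 $ 2 \<le> hi"
    using lower[of "vector [1, 0]"] lower[of "vector [0, 1]"] upper[of "vector [1, 0]"] upper[of "vector [0, 1]"]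
      lo(1) unfolding form nrm by simp_all
  have "S $ 1 $ 1 * S $ 2 $ 2 \<le> hi * hi" using d by (intro mult_mono) auto
  then show "det S \<le> hi\<^sup>2" using zero_le_square[of "S $ 2 $ 1"]
    unfolding det_2 power2_eq_square sym by linarith
qed

end

section \<open>The two-phase scalar problem\<close>

definition phase_weight :: "(real^2) set \<Rightarrow> real \<Rightarrow> real^2 \<Rightarrow> real" where
  "phase_weight A1 h x = (if x \<in> A1 then 1 else h)"

lemma bounded_weight_phase:
  assumes "microstructure A1 A2" "0 < h"
  shows "bounded_weight (phase_weight A1 h) (min 1 h) (max 1 h)"
proof
  have A1: "A1 \<in> sets cell_measure"
    using assms(1) by (auto simp: microstructure_def sets_restrict_space_iff)
  then show "phase_weight A1 h \<in> borel_measurable cell_measure"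
    unfolding phase_weight_def[abs_def] by (intro measurable_If_set) (auto simp: A1[simplified])
qed (use assms in \<open>auto simp: phase_weight_def\<close>)

text \<open>Off the cell the two sides can differ, \<open>two_phase\<close> being 0 there; only
  values on the cell are integrated.\<close>

lemma two_phase_conductivity_apply:
  fixes v :: "real^2"
  assumes "microstructure A1 A2" "x \<in> unit_cell"
  shows "two_phase A1 A2 (mat 1) (h *\<^sub>R mat 1) x *v v = phase_weight A1 h x *\<^sub>R v"
proof -
  have "(h *\<^sub>R mat 1 :: real^2^2) *v v = h *\<^sub>R v"
    by (simp add: scaleR_matrix_vector_assoc[symmetric])
  then show ?thesis
    using assms by (auto simp: microstructure_def two_phase_def phase_weight_def)
qed

text \<open>Resolves the definite description: the matrix is unique because the mean flux depends on
  the mean field alone. The determinant bounds are those for a weight between 1 and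
  \<open>h\<close>.\<close>

lemma Sigma_eff_characterization:
  assumes ms: "microstructure A1 A2" and h: "0 < h"
  shows "\<And>e0. \<exists>\<phi> g. H1_per \<phi> g \<and> div_free (\<lambda>x. phase_weight A1 h x *\<^sub>R (e0 + g x))
       \<and> Sigma_eff A1 A2 h *v e0 = (\<integral>x. phase_weight A1 h x *\<^sub>R (e0 + g x) \<partial>cell_measure)"
    and "Sigma_eff A1 A2 h $ 1 $ 2 = Sigma_eff A1 A2 h $ 2 $ 1"
    and "(min 1 h)\<^sup>2 \<le> det (Sigma_eff A1 A2 h)"
    and "det (Sigma_eff A1 A2 h) \<le> (max 1 h)\<^sup>2"
proof -
  interpret bounded_weight "phase_weight A1 h" "min 1 h" "max 1 h"
    by (rule bounded_weight_phase[OF ms h])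
  let ?\<sigma> = "two_phase A1 A2 (mat 1) (h *\<^sub>R mat 1 :: real^2^2)"
  obtain S :: "real^2^2" where S: "\<And>a e. weight_field a e \<Longrightarrow> S *v a = mean_flux e"
    using effective_matrix_exists by blast
  have cf: "conductivity_field ?\<sigma> e0 e \<longleftrightarrow> weight_field e0 e" for e0 e
    unfolding conductivity_field_def weight_field_def
    by (subst div_free_cong[of "\<lambda>x. ?\<sigma> x *v e x" "\<lambda>x. phase_weight A1 h x *\<^sub>R e x"])
      (rule two_phase_conductivity_apply[OF ms], assumption, rule refl)
  have mf: "(\<integral>x. ?\<sigma> x *v e x \<partial>cell_measure) = mean_flux e" for e
    unfolding mean_flux_def
    by (intro Bochner_Integration.integral_cong) (auto simp: two_phase_conductivity_apply[OF ms])
  have eff: "Sigma_eff A1 A2 h = S"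
    unfolding Sigma_eff_def effective_conductivity_def cf mf
  proof (rule the_equality)
    show "\<forall>e0. \<exists>e. weight_field e0 e \<and> S *v e0 = mean_flux e"
      using weight_field_exists S by blast
    fix S' :: "real^2^2" assume "\<forall>e0. \<exists>e. weight_field e0 e \<and> S' *v e0 = mean_flux e"
    then have "S' *v e0 = S *v e0" for e0 using S by metis
    then show "S' = S" by (simp add: matrix_eq)
  qed
  show "\<exists>\<phi> g. H1_per \<phi> g \<and> div_free (\<lambda>x. phase_weight A1 h x *\<^sub>R (e0 + g x))
       \<and> Sigma_eff A1 A2 h *v e0 = (\<integral>x. phase_weight A1 h x *\<^sub>R (e0 + g x) \<partial>cell_measure)" for e0
  proof -
    obtain e where e: "weight_field e0 e" using weight_field_exists by blast
    then obtain \<phi> g where g: "H1_per \<phi> g" "e = (\<lambda>x. e0 + g x)" unfolding weight_field_def by blast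
    have "div_free (\<lambda>x. phase_weight A1 h x *\<^sub>R e x)" using e unfolding weight_field_def by blast
    with S[OF e] g show ?thesis unfolding eff mean_flux_def by blast
  qed
  show "Sigma_eff A1 A2 h $ 1 $ 2 = Sigma_eff A1 A2 h $ 2 $ 1"
    "(min 1 h)\<^sup>2 \<le> det (Sigma_eff A1 A2 h)" "det (Sigma_eff A1 A2 h) \<le> (max 1 h)\<^sup>2"
    unfolding eff using effective_matrix_bounds[OF S] by blast+
qed


section \<open>Decoupling\<close>

text \<open>The planar identity \<open>A^T R A = det A R\<close> for symmetric \<open>A\<close>.
  Through it the determinant of the effective conductivity enters the final formula.\<close>

lemma symmetric_R_perp_symmetric:
  fixes S :: "real^2^2"
  assumes "S $ 1 $ 2 = S $ 2 $ 1"
  shows "S *v (R_perp *v (S *v v)) = det S *\<^sub>R (R_perp *v v)"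
  unfolding R_perp_mult using assms
  by (simp add: vec_eq_iff forall_2 matrix_vector_mult_def sum_2 det_2 algebra_simps)

text \<open>Here \<open>t = \<theta>2 / \<theta>1\<close>. The first identity is the quadratic in
  factored form, the fourth equates the two expressions for \<open>h\<close>, the last gives
  \<open>h^2 - a^2\<close> the sign of \<open>1 - a^2\<close>, and \<open>0 < 1 + \<rho> a\<close>
  means \<open>0 < h\<close>.\<close>

lemma root_identities:
  fixes t \<rho> a :: real
  assumes t: "0 < t" and \<rho>: "\<bar>\<rho>\<bar> < \<bar>t - 1\<bar>" and eq: "(a\<^sup>2 + 1) * \<rho> = a * (t\<^sup>2 - \<rho>\<^sup>2 - 1)"
  shows "(a + \<rho>) * (1 + \<rho> * a) = a * t\<^sup>2" "a\<^sup>2 \<noteq> 1" "0 < 1 + \<rho> * a"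
    "(1 + \<rho> * a) * (t\<^sup>2 - (\<rho> + a)\<^sup>2) = (1 - a\<^sup>2) * t\<^sup>2" "t\<^sup>2 - (\<rho> + a)\<^sup>2 \<noteq> 0"
    "(1 + \<rho> * a)\<^sup>2 - a\<^sup>2 * t\<^sup>2 = (1 + \<rho> * a) * (1 - a\<^sup>2)"
proof -
  show key: "(a + \<rho>) * (1 + \<rho> * a) = a * t\<^sup>2"
    using eq by (simp add: algebra_simps power2_eq_square)
  show a1: "a\<^sup>2 \<noteq> 1"
  proof
    assume "a\<^sup>2 = 1"
    then consider "a = 1" | "a = -1" by (auto simp: power2_eq_1_iff)
    \<comment> \<open>For \<open>a^2 = 1\<close> the quadratic forces
      \<open>t = |1 + a \<rho>|\<close>, so \<open>|t - 1| \<le> |\<rho>|\<close>, against the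
      hypothesis.\<close>
    then have "t\<^sup>2 = (1 + a * \<rho>)\<^sup>2"
      by cases (use eq in \<open>simp_all add: power2_eq_square algebra_simps\<close>)
    then have "t = \<bar>1 + a * \<rho>\<bar>" using t by (metis abs_of_pos power2_eq_iff_nonneg abs_ge_zero order_less_imp_le power2_abs)
    moreover have "\<bar>a * \<rho>\<bar> = \<bar>\<rho>\<bar>" using \<open>a\<^sup>2 = 1\<close> by (auto simp: power2_eq_1_iff)
    ultimately show False using \<rho> by linarith
  qed
  have \<rho>2: "\<rho>\<^sup>2 < 1 + t\<^sup>2"
  proof -
    have "\<rho>\<^sup>2 < (t - 1)\<^sup>2" using power_strict_mono[OF \<rho>, of 2] by simp
    also have "\<dots> \<le> 1 + t\<^sup>2" using t by (simp add: power2_diff)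
    finally show ?thesis .
  qed
  show pos: "0 < 1 + \<rho> * a"
  proof (rule ccontr)
    assume "\<not> 0 < 1 + \<rho> * a"
    \<comment> \<open>In terms of \<open>k\<close>, the quadratic times \<open>\<rho>\<close> has
      nonnegative coefficients and the positive constant term \<open>t^2\<close>, so it has no root
      \<open>k \<ge> 0\<close>.\<close>
    define k where "k = - (\<rho> * a) - 1"
    have k: "0 \<le> k" using \<open>\<not> 0 < 1 + \<rho> * a\<close> by (simp add: k_def)
    have "k\<^sup>2 + k * (1 - \<rho>\<^sup>2 + t\<^sup>2) + t\<^sup>2 = \<rho> * ((a\<^sup>2 + 1) * \<rho> - a * (t\<^sup>2 - \<rho>\<^sup>2 - 1))"
      by (simp add: k_def algebra_simps power2_eq_square)
    also have "\<dots> = 0" using eq by simp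
    finally have "k\<^sup>2 + k * (1 - \<rho>\<^sup>2 + t\<^sup>2) + t\<^sup>2 = 0" .
    moreover have "0 \<le> k * (1 - \<rho>\<^sup>2 + t\<^sup>2)" using k \<rho>2 by simp
    moreover have "0 < t\<^sup>2" "0 \<le> k\<^sup>2" using t by simp_all
    ultimately show False by linarith
  qed
  have "(1 + \<rho> * a) * (t\<^sup>2 - (\<rho> + a)\<^sup>2) = (1 + \<rho> * a) * t\<^sup>2 - (\<rho> + a) * ((a + \<rho>) * (1 + \<rho> * a))"
    by (simp add: algebra_simps power2_eq_square)
  also have "\<dots> = (1 - a\<^sup>2) * t\<^sup>2" unfolding key by (simp add: algebra_simps power2_eq_square)
  finally show D: "(1 + \<rho> * a) * (t\<^sup>2 - (\<rho> + a)\<^sup>2) = (1 - a\<^sup>2) * t\<^sup>2" .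
  show "t\<^sup>2 - (\<rho> + a)\<^sup>2 \<noteq> 0"
  proof
    assume "t\<^sup>2 - (\<rho> + a)\<^sup>2 = 0"
    with D t a1 show False by simp
  qed
  have "(1 + \<rho> * a)\<^sup>2 - a\<^sup>2 * t\<^sup>2 = (1 + \<rho> * a)\<^sup>2 - a * ((a + \<rho>) * (1 + \<rho> * a))"
    unfolding key by (simp add: power2_eq_square)
  then show "(1 + \<rho> * a)\<^sup>2 - a\<^sup>2 * t\<^sup>2 = (1 + \<rho> * a) * (1 - a\<^sup>2)"
    by (simp add: algebra_simps power2_eq_square)
qed

text \<open>By \<open>sgn\<close> the numbers \<open>1 - a^2\<close> and \<open>h^2 - a^2\<close>
  have the same sign, so \<open>a^2\<close> lies strictly on one side of the interval that contains
  the determinant.\<close>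

lemma det_Sigma_eff_neq:
  assumes ms: "microstructure A1 A2" and h: "0 < h"
    and a: "a\<^sup>2 \<noteq> 1" and sgn: "h\<^sup>2 - a\<^sup>2 = k * (1 - a\<^sup>2)" and k: "0 < k"
  shows "det (Sigma_eff A1 A2 h) \<noteq> a\<^sup>2"
proof (cases "a\<^sup>2 < 1")
  case True
  then have "a\<^sup>2 < h\<^sup>2" using sgn k mult_pos_pos[of k "1 - a\<^sup>2"] by linarith
  then have "a\<^sup>2 < (min 1 h)\<^sup>2" using True by (simp add: min_def)
  then show ?thesis using Sigma_eff_characterization(3)[OF ms h] by simp
next
  case False
  then have "1 < a\<^sup>2" using a by simp
  then have "h\<^sup>2 < a\<^sup>2" using sgn k mult_pos_neg[of k "1 - a\<^sup>2"] by linarith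
  then have "(max 1 h)\<^sup>2 < a\<^sup>2" using \<open>1 < a\<^sup>2\<close> by (simp add: max_def)
  then show ?thesis using Sigma_eff_characterization(4)[OF ms h] by simp
qed

text \<open>The fields \<open>F\<close> and the rotated fluxes of the coupled problem with phases \<open>I\<close> and
  \<open>t I + \<rho> T\<close> (\<open>I\<close> the identity on pairs) are four curl-free fields. Two combinations of them,
  \<open>p = R K1 + a F2\<close> and \<open>p' = R K2 - a F1\<close>, solve the scalar problem with conductivities \<open>1\<close> and \<open>h\<close>;
  the formulas in the proof invert this change of unknowns.\<close>

lemma decoupled_fields:
  fixes X Y :: "real^2" and a t \<rho> h :: real
  assumes ms: "microstructure A1 A2" and h: "0 < h"
    and th: "t * h = 1 + \<rho> * a" and ta: "t * a = h * (a + \<rho>)"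
    and a: "a\<^sup>2 \<noteq> 1" and dS: "det (Sigma_eff A1 A2 h) \<noteq> a\<^sup>2"
  defines "S \<equiv> Sigma_eff A1 A2 h"
  shows "\<exists>\<phi>1 g1 \<phi>2 g2 K1 K2. H1_per \<phi>1 g1 \<and> H1_per \<phi>2 g2 \<and> div_free K1 \<and> div_free K2 \<and>
    (\<forall>x\<in>A1. K1 x = X + g1 x \<and> K2 x = Y + g2 x) \<and>
    (\<forall>x\<in>A2. K1 x = t *\<^sub>R (X + g1 x) - \<rho> *\<^sub>R (R_perp *v (Y + g2 x)) \<and>
       K2 x = t *\<^sub>R (Y + g2 x) + \<rho> *\<^sub>R (R_perp *v (X + g1 x))) \<and>
    (\<integral>x. K1 x \<partial>cell_measure)
      = ((1 - a\<^sup>2) / (det S - a\<^sup>2)) *\<^sub>R (S *v X) - (a * (1 - det S) / (det S - a\<^sup>2)) *\<^sub>R (R_perp *v Y) \<and>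
    (\<integral>x. K2 x \<partial>cell_measure)
      = ((1 - a\<^sup>2) / (det S - a\<^sup>2)) *\<^sub>R (S *v Y) + (a * (1 - det S) / (det S - a\<^sup>2)) *\<^sub>R (R_perp *v X)"
proof -
  let ?R = "\<lambda>v. R_perp *v v"
  define \<eta> where "\<eta> = phase_weight A1 h"
  \<comment> \<open>\<open>\<gamma>\<close> inverts the pointwise change of unknowns,
    \<open>\<delta>\<close> the linear system for the means.\<close>
  define \<gamma> where "\<gamma> = 1 / (1 - a\<^sup>2)"
  define \<delta> where "\<delta> = 1 / (det S - a\<^sup>2)"
  have \<gamma>: "\<gamma> * (1 - a\<^sup>2) = 1" using a by (simp add: \<gamma>_def)
  have \<delta>: "\<delta> * (det S - a\<^sup>2) = 1" using dS by (simp add: \<delta>_def S_def)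
  have symS: "S $ 1 $ 2 = S $ 2 $ 1" unfolding S_def by (rule Sigma_eff_characterization(2)[OF ms h])
  note lin = matrix_vector_right_distrib matrix_vector_mult_diff_distrib matrix_vector_mult_scaleR
  have SRS: "S *v ?R (S *v v) = det S *\<^sub>R ?R v" for v by (rule symmetric_R_perp_symmetric[OF symS])
  \<comment> \<open>The means of the scalar fields, chosen so that the reconstructed fields have
    means \<open>X\<close> and \<open>Y\<close>; by \<open>SRS\<close> the system reduces to the
    scalar factor \<open>det S - a^2\<close>.\<close>
  define p0 where "p0 = ((1 - a\<^sup>2) * \<delta>) *\<^sub>R (?R (S *v X) + a *\<^sub>R Y)"
  define q0 where "q0 = ((1 - a\<^sup>2) * \<delta>) *\<^sub>R (?R (S *v Y) - a *\<^sub>R X)"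
  obtain \<phi> g where g: "H1_per \<phi> g" "div_free (\<lambda>x. \<eta> x *\<^sub>R (p0 + g x))"
    "S *v p0 = (\<integral>x. \<eta> x *\<^sub>R (p0 + g x) \<partial>cell_measure)"
    using Sigma_eff_characterization(1)[OF ms h, of p0] unfolding S_def \<eta>_def by blast
  obtain \<phi>' g' where g': "H1_per \<phi>' g'" "div_free (\<lambda>x. \<eta> x *\<^sub>R (q0 + g' x))"
    "S *v q0 = (\<integral>x. \<eta> x *\<^sub>R (q0 + g' x) \<partial>cell_measure)"
    using Sigma_eff_characterization(1)[OF ms h, of q0] unfolding S_def \<eta>_def by blast
  define Q where "Q x = \<eta> x *\<^sub>R (p0 + g x)" for x
  define Q' where "Q' x = \<eta> x *\<^sub>R (q0 + g' x)" for x
  note g2 = g(2)[folded Q_def] and g3 = g(3)[folded Q_def]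
    and g2' = g'(2)[folded Q'_def] and g3' = g'(3)[folded Q'_def]
  \<comment> \<open>A rotated scalar flux is its mean plus a periodic gradient and may therefore
    enter \<open>G1\<close> and \<open>G2\<close>.\<close>
  obtain \<xi>1 where c1: "H1_per \<xi>1 (\<lambda>x. ?R (Q x) - ?R (S *v p0))"
    using div_free_rotated_is_gradient[OF g2] unfolding g3[symmetric] by blast
  obtain \<xi>2 where c2: "H1_per \<xi>2 (\<lambda>x. ?R (Q' x) - ?R (S *v q0))"
    using div_free_rotated_is_gradient[OF g2'] unfolding g3'[symmetric] by blast
  \<comment> \<open>The inverse change of unknowns. The fluxes \<open>K1\<close>, \<open>K2\<close>
    combine rotated scalar fields with scalar fluxes, so they are divergence-free by
    construction.\<close>
  define G1 where "G1 x = \<gamma> *\<^sub>R (a *\<^sub>R g' x + (-1) *\<^sub>R (?R (Q x) - ?R (S *v p0)))" for x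
  define G2 where "G2 x = \<gamma> *\<^sub>R ((-1) *\<^sub>R (?R (Q' x) - ?R (S *v q0)) + (- a) *\<^sub>R g x)" for x
  define K1 where "K1 x = \<gamma> *\<^sub>R ((-1) *\<^sub>R (?R p0 + ?R (g x)) + a *\<^sub>R Q' x)" for x
  define K2 where "K2 x = \<gamma> *\<^sub>R ((-1) *\<^sub>R (?R q0 + ?R (g' x)) + (- a) *\<^sub>R Q x)" for x
  have H: "\<exists>\<phi>1. H1_per \<phi>1 G1" "\<exists>\<phi>2. H1_per \<phi>2 G2"
    unfolding G1_def[abs_def] G2_def[abs_def]
    using H1_per_scaleR[OF H1_per_add[OF H1_per_scaleR[OF g'(1)] H1_per_scaleR[OF c1]]]
      H1_per_scaleR[OF H1_per_add[OF H1_per_scaleR[OF c2] H1_per_scaleR[OF g(1)]]] by blast+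
  have d: "div_free K1" "div_free K2"
    unfolding K1_def[abs_def] K2_def[abs_def]
    by (rule div_free_scaleR[OF div_free_add[OF div_free_scaleR[OF div_free_add[OF div_free_const
          div_free_rotated_gradient[OF g(1)]]] div_free_scaleR[OF g2']]],
        rule div_free_scaleR[OF div_free_add[OF div_free_scaleR[OF div_free_add[OF div_free_const
          div_free_rotated_gradient[OF g'(1)]]] div_free_scaleR[OF g2]]])
  have X: "X = \<gamma> *\<^sub>R (a *\<^sub>R q0 - ?R (S *v p0))"
  proof -
    have "a *\<^sub>R q0 - ?R (S *v p0) = ((1 - a\<^sup>2) * (\<delta> * (det S - a\<^sup>2))) *\<^sub>R X"
      unfolding p0_def q0_def lin SRS R_perp_R_perp by (simp add: algebra_simps power2_eq_square)
    then show ?thesis using \<gamma> \<delta> by simp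
  qed
  have Y: "Y = \<gamma> *\<^sub>R (- ?R (S *v q0) - a *\<^sub>R p0)"
  proof -
    have "- ?R (S *v q0) - a *\<^sub>R p0 = ((1 - a\<^sup>2) * (\<delta> * (det S - a\<^sup>2))) *\<^sub>R Y"
      unfolding p0_def q0_def lin SRS R_perp_R_perp by (simp add: algebra_simps power2_eq_square)
    then show ?thesis using \<gamma> \<delta> by simp
  qed
  have F1: "X + G1 x = \<gamma> *\<^sub>R (a *\<^sub>R (q0 + g' x) - ?R (Q x))" for x
    by (subst X) (simp add: G1_def algebra_simps)
  have F2: "Y + G2 x = \<gamma> *\<^sub>R (- ?R (Q' x) - a *\<^sub>R (p0 + g x))" for x
    by (subst Y) (simp add: G2_def algebra_simps)
  have ph1: "\<forall>x\<in>A1. K1 x = X + G1 x \<and> K2 x = Y + G2 x"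
    unfolding F1 F2
    by (auto simp: K1_def K2_def Q_def Q'_def \<eta>_def phase_weight_def lin algebra_simps)
  have ph2: "\<forall>x\<in>A2. K1 x = t *\<^sub>R (X + G1 x) - \<rho> *\<^sub>R ?R (Y + G2 x) \<and>
       K2 x = t *\<^sub>R (Y + G2 x) + \<rho> *\<^sub>R ?R (X + G1 x)"
  proof
    fix x assume "x \<in> A2"
    then have \<eta>: "\<eta> x = h" using ms by (auto simp: \<eta>_def phase_weight_def microstructure_def)
    define p p' where "p = p0 + g x" and "p' = q0 + g' x"
    have k: "K1 x = \<gamma> *\<^sub>R (- ?R p + (a * h) *\<^sub>R p')" "K2 x = \<gamma> *\<^sub>R (- ?R p' - (a * h) *\<^sub>R p)"
      by (simp_all add: K1_def K2_def Q_def Q'_def \<eta> p_def p'_def lin algebra_simps)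
    have f: "X + G1 x = \<gamma> *\<^sub>R (a *\<^sub>R p' - h *\<^sub>R ?R p)" "Y + G2 x = \<gamma> *\<^sub>R (- h *\<^sub>R ?R p' - a *\<^sub>R p)"
      unfolding F1 F2 by (simp_all add: Q_def Q'_def \<eta> p_def p'_def lin)
    have "t *\<^sub>R (X + G1 x) - \<rho> *\<^sub>R ?R (Y + G2 x)
       = \<gamma> *\<^sub>R ((t * a - \<rho> * h) *\<^sub>R p' + (\<rho> * a - t * h) *\<^sub>R ?R p)"
      unfolding f lin R_perp_R_perp by (simp add: algebra_simps)
    moreover have "t *\<^sub>R (Y + G2 x) + \<rho> *\<^sub>R ?R (X + G1 x)
       = \<gamma> *\<^sub>R ((\<rho> * a - t * h) *\<^sub>R ?R p' - (t * a - \<rho> * h) *\<^sub>R p)"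
      unfolding f lin R_perp_R_perp by (simp add: algebra_simps)
    \<comment> \<open>These are \<open>th\<close> and \<open>ta\<close> rearranged; the law of phase
      2 comes down to them.\<close>
    moreover have "\<rho> * a - t * h = -1" "t * a - \<rho> * h = a * h"
      using th ta by (simp_all add: algebra_simps)
    ultimately show "K1 x = t *\<^sub>R (X + G1 x) - \<rho> *\<^sub>R ?R (Y + G2 x) \<and>
       K2 x = t *\<^sub>R (Y + G2 x) + \<rho> *\<^sub>R ?R (X + G1 x)"
      unfolding k by simp
  qed
  have Rint: "integrable cell_measure (\<lambda>x. ?R (k x)) \<and> (\<integral>x. ?R (k x) \<partial>cell_measure) = 0"
    if "H1_per \<psi> k" for \<psi> k
    using integral_bounded_linear[OF matrix_vector_mul_bounded_linear[of R_perp]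
        integrable_square_integrable[OF H1_per_square_integrable[OF that]]]
      integrable_bounded_linear[OF matrix_vector_mul_bounded_linear[of R_perp]
        integrable_square_integrable[OF H1_per_square_integrable[OF that]]]
      H1_per_mean_zero[OF that] by simp
  have Qint: "integrable cell_measure Q" "integrable cell_measure Q'"
    by (intro integrable_square_integrable div_free_square_integrable g2 g2')+
  have m1: "(\<integral>x. K1 x \<partial>cell_measure) = \<gamma> *\<^sub>R (- ?R p0 + a *\<^sub>R (S *v q0))"
    unfolding K1_def using Rint[OF g(1)] Qint g3' by simp
  have m2: "(\<integral>x. K2 x \<partial>cell_measure) = \<gamma> *\<^sub>R (- ?R q0 - a *\<^sub>R (S *v p0))"
    unfolding K2_def using Rint[OF g'(1)] Qint g3 by simp
  \<comment> \<open>\<open>SRS\<close> turns the term \<open>S R S Y\<close> of \<open>S q0\<close>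
    into \<open>det S R Y\<close>, the source of the factor \<open>1 - det S\<close>.\<close>
  have "- ?R p0 + a *\<^sub>R (S *v q0)
      = (1 - a\<^sup>2) *\<^sub>R (((1 - a\<^sup>2) * \<delta>) *\<^sub>R (S *v X) - (a * (1 - det S) * \<delta>) *\<^sub>R ?R Y)"
    unfolding p0_def q0_def lin SRS R_perp_R_perp by (simp add: algebra_simps power2_eq_square)
  then have M1: "(\<integral>x. K1 x \<partial>cell_measure)
      = ((1 - a\<^sup>2) * \<delta>) *\<^sub>R (S *v X) - (a * (1 - det S) * \<delta>) *\<^sub>R ?R Y"
    unfolding m1 using \<gamma> by (simp only: scaleR_scaleR scaleR_one)
  have "- ?R q0 - a *\<^sub>R (S *v p0)
      = (1 - a\<^sup>2) *\<^sub>R (((1 - a\<^sup>2) * \<delta>) *\<^sub>R (S *v Y) + (a * (1 - det S) * \<delta>) *\<^sub>R ?R X)"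
    unfolding p0_def q0_def lin SRS R_perp_R_perp by (simp add: algebra_simps power2_eq_square)
  then have M2: "(\<integral>x. K2 x \<partial>cell_measure)
      = ((1 - a\<^sup>2) * \<delta>) *\<^sub>R (S *v Y) + (a * (1 - det S) * \<delta>) *\<^sub>R ?R X"
    unfolding m2 using \<gamma> by (simp only: scaleR_scaleR scaleR_one)
  have \<delta>div: "u * \<delta> = u / (det S - a\<^sup>2)" for u by (simp add: \<delta>_def)
  show ?thesis
    using H d ph1 ph2 M1 M2 unfolding \<delta>div by blast
qed


section \<open>The effective tensor\<close>

text \<open>\<open>T_op\<close> has zero diagonal blocks and off-diagonal blocks
  \<open>- R_perp\<close> and \<open>R_perp\<close>, whence the signs.\<close>

lemma block_apply_nth:
  "block_apply (\<alpha> *\<^sub>R kron \<sigma> S + r *\<^sub>R T_op) E $ 1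
    = \<alpha> *\<^sub>R (\<sigma> $ 1 $ 1 *\<^sub>R (S *v E $ 1) + \<sigma> $ 1 $ 2 *\<^sub>R (S *v E $ 2)) - r *\<^sub>R (R_perp *v E $ 2)"
  "block_apply (\<alpha> *\<^sub>R kron \<sigma> S + r *\<^sub>R T_op) E $ 2
    = \<alpha> *\<^sub>R (\<sigma> $ 2 $ 1 *\<^sub>R (S *v E $ 1) + \<sigma> $ 2 $ 2 *\<^sub>R (S *v E $ 2)) + r *\<^sub>R (R_perp *v E $ 1)"
  by (simp_all add: block_apply_def kron_def T_op_def sum_2 R_perp_def vec_eq_iff forall_2
      matrix_vector_mult_def algebra_simps)

lemma block_apply_isotropic:
  "block_apply (isotropic_phase \<sigma> r) E $ 1
    = \<sigma> $ 1 $ 1 *\<^sub>R E $ 1 + \<sigma> $ 1 $ 2 *\<^sub>R E $ 2 - r *\<^sub>R (R_perp *v E $ 2)"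
  "block_apply (isotropic_phase \<sigma> r) E $ 2
    = \<sigma> $ 2 $ 1 *\<^sub>R E $ 1 + \<sigma> $ 2 $ 2 *\<^sub>R E $ 2 + r *\<^sub>R (R_perp *v E $ 1)"
  using block_apply_nth[of 1 \<sigma> "mat 1" r E] by (simp_all add: isotropic_phase_def)

lemma block_apply_diff: "block_apply L (E - E') = block_apply L E - block_apply L E'"
  by (simp add: block_apply_def vec_eq_iff matrix_vector_mult_diff_distrib sum_subtractf)

text \<open>Testing on \<open>axis j v\<close> isolates block column \<open>j\<close>. Uniqueness in
  the description of the effective tensor ends with this.\<close>

lemma block_apply_eq_iff: "(\<forall>E. block_apply M E = block_apply M' E) \<longleftrightarrow> M = M'"
proof
  assume *: "\<forall>E. block_apply M E = block_apply M' E"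
  have "M $ i $ j *v v = M' $ i $ j *v v" for i j v
  proof -
    have "block_apply N (axis j v) $ i = N $ i $ j *v v" for N
      using exhaust_2[of j] by (auto simp: block_apply_def sum_2 axis_def)
    then show ?thesis using * by metis
  qed
  then have "M $ i $ j = M' $ i $ j" for i j by (simp add: matrix_eq)
  then show "M = M'" by (simp add: vec_eq_iff)
qed simp

section \<open>Positivity of the phases and uniqueness of the mean flux\<close>

lemma sym_pos_def_entries:
  assumes "sym_pos_def \<sigma>" shows "\<sigma> $ 1 $ 2 = \<sigma> $ 2 $ 1" "0 < \<sigma> $ 1 $ 1" "0 < det \<sigma>"
proof -
  show sym: "\<sigma> $ 1 $ 2 = \<sigma> $ 2 $ 1"
    using assms by (simp add: sym_pos_def_def transpose_def vec_eq_iff)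
  have pos: "0 < x \<bullet> (\<sigma> *v x)" if "x \<noteq> 0" for x using assms that by (simp add: sym_pos_def_def)
  show s11: "0 < \<sigma> $ 1 $ 1"
    using pos[of "axis 1 1"]
    by (simp add: axis_eq_0_iff inner_axis' matrix_vector_mult_basis column_def)
  \<comment> \<open>This vector is \<open>\<sigma>\<close>-orthogonal to the first axis, which
    leaves one entry times the determinant.\<close>
  have "0 < vector [- (\<sigma> $ 1 $ 2), \<sigma> $ 1 $ 1] \<bullet> (\<sigma> *v vector [- (\<sigma> $ 1 $ 2), \<sigma> $ 1 $ 1])"
    using s11 by (intro pos) (auto simp: vec_eq_iff forall_2)
  also have "\<dots> = \<sigma> $ 1 $ 1 * det \<sigma>"
    using sym by (simp add: inner_vec_def matrix_vector_mult_def sum_2 det_2 algebra_simps)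
  finally show "0 < det \<sigma>" using s11 by (simp add: zero_less_mult_iff)
qed

text \<open>Completing the square: \<open>\<sigma>\<^sub>1\<^sub>1\<close> times the quadratic form is
  \<open>|\<sigma>\<^sub>1\<^sub>1 D\<^sub>1 + \<sigma>\<^sub>1\<^sub>2 D\<^sub>2 - r R D\<^sub>2|\<^sup>2 + (det \<sigma> - r\<^sup>2) |D\<^sub>2|\<^sup>2\<close>.\<close>

lemma isotropic_phase_positive:
  assumes "pos_def_phase \<sigma> r" "D \<noteq> 0"
  shows "0 < block_apply (isotropic_phase \<sigma> r) D \<bullet> D"
proof -
  have sp: "sym_pos_def \<sigma>" and r: "r\<^sup>2 < det \<sigma>" using assms(1) by (auto simp: pos_def_phase_def)
  note e = sym_pos_def_entries[OF sp]
  let ?u = "\<sigma> $ 1 $ 1 *\<^sub>R D $ 1 + \<sigma> $ 1 $ 2 *\<^sub>R D $ 2 - r *\<^sub>R (R_perp *v D $ 2)"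
  have eq: "\<sigma> $ 1 $ 1 * (block_apply (isotropic_phase \<sigma> r) D \<bullet> D)
      = ?u \<bullet> ?u + (det \<sigma> - r\<^sup>2) * (D $ 2 \<bullet> D $ 2)"
    unfolding inner_vec_def[of _ D] sum_2 block_apply_isotropic
    by (simp add: e(1) R_perp_mult inner_vec_def sum_2 det_2 algebra_simps power2_eq_square)
  have "0 < ?u \<bullet> ?u + (det \<sigma> - r\<^sup>2) * (D $ 2 \<bullet> D $ 2)"
  proof (cases "D $ 2 = 0")
    case True
    then have "D $ 1 \<noteq> 0" using assms(2) by (simp add: vec_eq_iff[of D] forall_2)
    then have "?u \<noteq> 0" using True e(2) by simp
    then show ?thesis using True by (simp only: inner_zero_right mult_zero_right add_0_right inner_gt_zero_iff not_False_eq_True)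
  next
    case False
    then show ?thesis using r by (intro add_nonneg_pos mult_pos_pos) auto
  qed
  then show ?thesis unfolding eq[symmetric] using e(2) by (simp add: zero_less_mult_iff)
qed

lemma bounded_linear_axis: "bounded_linear (axis i :: 'a::euclidean_space \<Rightarrow> 'a^'n)"
  by (rule linear_conv_bounded_linear[THEN iffD1], rule linearI) (simp_all add: axis_def vec_eq_iff)

lemma pair_decompose: "(v :: 'a::euclidean_space^2) = axis 1 (v $ 1) + axis 2 (v $ 2)"
  by (simp add: vec_eq_iff forall_2 axis_def)

lemma square_integrable_pair:
  fixes f :: "real^2 \<Rightarrow> 'a::euclidean_space^2"
  assumes "\<And>i. square_integrable (\<lambda>x. f x $ i)" shows "square_integrable f"
proof -
  have "square_integrable (\<lambda>x. axis 1 (f x $ 1) + axis 2 (f x $ 2) :: 'a^2)"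
    by (intro square_integrable_add square_integrable_bounded_linear[OF assms bounded_linear_axis])
  then show ?thesis by (simp only: pair_decompose[symmetric])
qed

lemma cell_mean_nth:
  fixes f :: "real^2 \<Rightarrow> 'a::euclidean_space^'n"
  assumes "integrable cell_measure f"
  shows "(\<integral>x. f x \<partial>cell_measure) $ i = (\<integral>x. f x $ i \<partial>cell_measure)"
  by (rule integral_bounded_linear[OF bounded_linear_vec_nth assms, symmetric])

lemma two_phase_cases:
  assumes "microstructure A1 A2" "x \<in> unit_cell"
  obtains "x \<in> A1" "two_phase A1 A2 c1 c2 x = c1" | "x \<in> A2" "two_phase A1 A2 c1 c2 x = c2"
proof (cases "x \<in> A1")
  case True
  then show ?thesis using that(1) by (simp add: two_phase_def)
next
  case False
  then have "x \<in> A2" using assms by (auto simp: microstructure_def)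
  then show ?thesis using that(2) False by (simp add: two_phase_def)
qed

lemma cell_field_square_integrable_flux:
  assumes "cell_field L E0 E" shows "square_integrable (\<lambda>x. block_apply (L x) (E x))"
  using assms unfolding cell_field_def
  by (intro square_integrable_pair div_free_square_integrable) blast

text \<open>The difference \<open>D\<close> of two solutions is a pair of periodic gradients with
  divergence-free flux \<open>J\<close>, so \<open>J \<bullet> D\<close> has mean zero; positivity
  of the phases then forces \<open>J = 0\<close> almost everywhere.\<close>

lemma cell_field_mean_unique:
  assumes ms: "microstructure A1 A2" and pd: "pos_def_phase \<sigma>1 r1" "pos_def_phase \<sigma>2 r2"
  defines "L \<equiv> two_phase A1 A2 (isotropic_phase \<sigma>1 r1) (isotropic_phase \<sigma>2 r2)"
  assumes E: "cell_field L E0 E" and E': "cell_field L E0 E'"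
  shows "(\<integral>x. block_apply (L x) (E x) \<partial>cell_measure) = (\<integral>x. block_apply (L x) (E' x) \<partial>cell_measure)"
proof -
  obtain \<phi>1 \<phi>2 g1 g2 where g: "H1_per \<phi>1 g1" "H1_per \<phi>2 g2" "E = (\<lambda>x. E0 + vector [g1 x, g2 x])"
    using E unfolding cell_field_def by blast
  obtain \<phi>1' \<phi>2' g1' g2' where g': "H1_per \<phi>1' g1'" "H1_per \<phi>2' g2'" "E' = (\<lambda>x. E0 + vector [g1' x, g2' x])"
    using E' unfolding cell_field_def by blast
  define D where "D x = E x - E' x" for x
  define J where "J x = block_apply (L x) (E x) - block_apply (L x) (E' x)" for x
  have J_eq: "J x = block_apply (L x) (D x)" for x by (simp add: J_def D_def block_apply_diff)
  note si = cell_field_square_integrable_flux[OF E] cell_field_square_integrable_flux[OF E']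
  have siJ: "square_integrable J" unfolding J_def by (intro square_integrable_diff si)
  have dJ: "div_free (\<lambda>x. J x $ i)" for i
  proof -
    have "div_free (\<lambda>x. block_apply (L x) (E x) $ i + (-1) *\<^sub>R (block_apply (L x) (E' x) $ i))"
      using E E' unfolding cell_field_def by (intro div_free_add div_free_scaleR) blast+
    then show ?thesis by (simp add: J_def)
  qed
  have D1: "H1_per (\<lambda>x. \<phi>1 x + (-1) * \<phi>1' x) (\<lambda>x. D x $ 1)"
    using H1_per_add[OF g(1) H1_per_scaleR[OF g'(1), of "-1"]] by (simp add: D_def g(3) g'(3))
  have D2: "H1_per (\<lambda>x. \<phi>2 x + (-1) * \<phi>2' x) (\<lambda>x. D x $ 2)"
    using H1_per_add[OF g(2) H1_per_scaleR[OF g'(2), of "-1"]] by (simp add: D_def g(3) g'(3))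
  have "square_integrable (\<lambda>x. D x $ i)" for i
    using exhaust_2[of i] H1_per_square_integrable[OF D1] H1_per_square_integrable[OF D2] by auto
  then have siD: "square_integrable D" by (rule square_integrable_pair)
  have int: "integrable cell_measure (\<lambda>x. J x \<bullet> D x)"
    by (rule integrable_inner_square_integrable[OF siJ siD])
  have "(\<integral>x. J x \<bullet> D x \<partial>cell_measure)
      = (\<integral>x. J x $ 1 \<bullet> D x $ 1 + J x $ 2 \<bullet> D x $ 2 \<partial>cell_measure)"
    by (simp add: inner_vec_def[of "J _"] sum_2)
  also have "\<dots> = (\<integral>x. J x $ 1 \<bullet> D x $ 1 \<partial>cell_measure) + (\<integral>x. J x $ 2 \<bullet> D x $ 2 \<partial>cell_measure)"
    by (intro Bochner_Integration.integral_add integrable_inner_square_integrable square_integrable_nth siJ siD)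
  also have "\<dots> = 0"
    by (simp add: div_free_H1_orthogonal[OF dJ D1] div_free_H1_orthogonal[OF dJ D2])
  finally have z: "(\<integral>x. J x \<bullet> D x \<partial>cell_measure) = 0" .
  have pos: "0 < J x \<bullet> D x" if "x \<in> unit_cell" "D x \<noteq> 0" for x
    using that isotropic_phase_positive[OF pd(1) that(2)] isotropic_phase_positive[OF pd(2) that(2)]
    unfolding J_eq L_def
    by (cases rule: two_phase_cases[OF ms that(1), of "isotropic_phase \<sigma>1 r1" "isotropic_phase \<sigma>2 r2"]) simp_all
  have "AE x in cell_measure. J x \<bullet> D x = 0"
  proof (subst integral_nonneg_eq_0_iff_AE[symmetric, OF int])
    show "AE x in cell_measure. 0 \<le> J x \<bullet> D x"
    proof (rule AE_I2)
      fix x assume "x \<in> space cell_measure"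
      then show "0 \<le> J x \<bullet> D x" using pos[of x] by (cases "D x = 0") auto
    qed
  qed (rule z)
  then have "AE x in cell_measure. J x = 0"
  proof (rule AE_mp, intro AE_I2 impI)
    fix x assume "x \<in> space cell_measure" "J x \<bullet> D x = 0"
    then have "D x = 0" using pos[of x] by (cases "D x = 0") auto
    \<comment> \<open>At the argument 0, additivity says that the zero field has zero flux.\<close>
    then show "J x = 0" using block_apply_diff[of "L x" 0 0] by (simp add: J_eq)
  qed
  then have "(\<integral>x. J x \<partial>cell_measure) = 0" by (rule integral_eq_zero_AE)
  then show ?thesis
    unfolding J_def using integrable_square_integrable[OF si(1)] integrable_square_integrable[OF si(2)]
    by simp
qed

text \<open>The congruence by the Cholesky factor \<open>C = ((c, 0), (b, e))\<close> of \<open>\<sigma>1 = C C\<^sup>T\<close> reduces the phases to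
  \<open>I + 0 T\<close> and \<open>t I + \<rho> T\<close>, up to the null Lagrangian \<open>r1 T\<close>, since \<open>C R C\<^sup>T = (det C) R\<close>.\<close>

lemma isotropic_cell_field:
  fixes \<sigma>1 \<sigma>2 :: "real^2^2" and a t \<rho> h r1 r2 :: real and E0 :: "real^2^2"
  assumes ms: "microstructure A1 A2" and h: "0 < h"
    and th: "t * h = 1 + \<rho> * a" and ta: "t * a = h * (a + \<rho>)"
    and a: "a\<^sup>2 \<noteq> 1" and dS: "det (Sigma_eff A1 A2 h) \<noteq> a\<^sup>2"
    and sp: "sym_pos_def \<sigma>1" and \<sigma>2: "\<sigma>2 = t *\<^sub>R \<sigma>1" and r2: "r2 = r1 + \<rho> * sqrt (det \<sigma>1)"
  defines "S \<equiv> Sigma_eff A1 A2 h"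
    and "L \<equiv> two_phase A1 A2 (isotropic_phase \<sigma>1 r1) (isotropic_phase \<sigma>2 r2)"
  shows "\<exists>E. cell_field L E0 E \<and>
    block_apply (((1 - a\<^sup>2) / (det S - a\<^sup>2)) *\<^sub>R kron \<sigma>1 S
           + (r1 + a * (1 - det S) * sqrt (det \<sigma>1) / (det S - a\<^sup>2)) *\<^sub>R T_op) E0
      = (\<integral>x. block_apply (L x) (E x) \<partial>cell_measure)"
proof -
  let ?R = "\<lambda>v. R_perp *v v"
  note lin = matrix_vector_right_distrib matrix_vector_mult_diff_distrib matrix_vector_mult_scaleR
  note en = sym_pos_def_entries[OF sp]
  \<comment> \<open>\<open>c\<close>, \<open>b\<close>, \<open>e\<close> are the Cholesky entries;
    \<open>s = c e\<close> is \<open>det C\<close>, the square root of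
    \<open>det \<sigma>1\<close>.\<close>
  define s c where "s = sqrt (det \<sigma>1)" and "c = sqrt (\<sigma>1 $ 1 $ 1)"
  define b e where "b = \<sigma>1 $ 1 $ 2 / c" and "e = s / c"
  have c0: "c \<noteq> 0" and s0: "0 < s" using en by (simp_all add: c_def s_def)
  have e0: "e \<noteq> 0" using c0 s0 by (simp add: e_def)
  have s11: "\<sigma>1 $ 1 $ 1 = c * c" using en by (simp add: c_def)
  have s12: "\<sigma>1 $ 1 $ 2 = c * b" using c0 by (simp add: b_def)
  have s21: "\<sigma>1 $ 2 $ 1 = c * b" using s12 en by simp
  have sc: "s = c * e" using c0 by (simp add: e_def)
  have "s * s = \<sigma>1 $ 1 $ 1 * \<sigma>1 $ 2 $ 2 - \<sigma>1 $ 1 $ 2 * \<sigma>1 $ 2 $ 1"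
    using en by (simp add: s_def det_2)
  then have "c * c * \<sigma>1 $ 2 $ 2 = c * c * (b * b + e * e)"
    by (simp add: s11 s12 s21 sc algebra_simps)
  then have s22: "\<sigma>1 $ 2 $ 2 = b * b + e * e" using c0 by simp
  \<comment> \<open>This is \<open>C^T E0\<close>: the reduced problem has field
    \<open>C^T E\<close> and flux \<open>K\<close> with \<open>J = C K + r1 T E\<close>.\<close>
  define X Y where "X = c *\<^sub>R E0 $ 1 + b *\<^sub>R E0 $ 2" and "Y = e *\<^sub>R E0 $ 2"
  define \<alpha> \<beta> where "\<alpha> = (1 - a\<^sup>2) / (det S - a\<^sup>2)" and "\<beta> = a * (1 - det S) / (det S - a\<^sup>2)"
  obtain \<phi>1 g1 \<phi>2 g2 K1 K2 where g: "H1_per \<phi>1 g1" "H1_per \<phi>2 g2" and K: "div_free K1" "div_free K2"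
    and ph1: "\<And>x. x \<in> A1 \<Longrightarrow> K1 x = X + g1 x" "\<And>x. x \<in> A1 \<Longrightarrow> K2 x = Y + g2 x"
    and ph2: "\<And>x. x \<in> A2 \<Longrightarrow> K1 x = t *\<^sub>R (X + g1 x) - \<rho> *\<^sub>R ?R (Y + g2 x)"
       "\<And>x. x \<in> A2 \<Longrightarrow> K2 x = t *\<^sub>R (Y + g2 x) + \<rho> *\<^sub>R ?R (X + g1 x)"
    and M1: "(\<integral>x. K1 x \<partial>cell_measure) = \<alpha> *\<^sub>R (S *v X) - \<beta> *\<^sub>R ?R Y"
    and M2: "(\<integral>x. K2 x \<partial>cell_measure) = \<alpha> *\<^sub>R (S *v Y) + \<beta> *\<^sub>R ?R X"
    using decoupled_fields[OF ms h th ta a dS, of X Y] unfolding S_def[symmetric] \<alpha>_def[symmetric] \<beta>_def[symmetric]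
    by blast
  \<comment> \<open>Back substitution in \<open>C^T G = g\<close>.\<close>
  define G1 where "G1 x = (1/c) *\<^sub>R (g1 x + (- (b/e)) *\<^sub>R g2 x)" for x
  define G2 where "G2 x = (1/e) *\<^sub>R g2 x" for x
  define E where "E x = E0 + vector [G1 x, G2 x]" for x
  have E1: "E x $ 1 = E0 $ 1 + G1 x" and E2: "E x $ 2 = E0 $ 2 + G2 x" for x
    by (simp_all add: E_def)
  have G: "H1_per (\<lambda>x. (1/c) * (\<phi>1 x + (- (b/e)) * \<phi>2 x)) G1" "H1_per (\<lambda>x. (1/e) * \<phi>2 x) G2"
    unfolding G1_def[abs_def] G2_def[abs_def]
    by (rule H1_per_scaleR[OF H1_per_add[OF g(1) H1_per_scaleR[OF g(2)]]], rule H1_per_scaleR[OF g(2)])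
  have F1: "X + g1 x = c *\<^sub>R E x $ 1 + b *\<^sub>R E x $ 2" and F2: "Y + g2 x = e *\<^sub>R E x $ 2" for x
    unfolding E1 E2 using c0 e0 by (simp_all add: X_def Y_def G1_def G2_def algebra_simps)
  have J: "block_apply (L x) (E x) $ 1 = c *\<^sub>R K1 x + (- r1) *\<^sub>R ?R (E x $ 2)"
    "block_apply (L x) (E x) $ 2 = (b *\<^sub>R K1 x + e *\<^sub>R K2 x) + r1 *\<^sub>R ?R (E x $ 1)"
    if x: "x \<in> unit_cell" for x
  proof -
    have "block_apply (L x) (E x) $ 1 = c *\<^sub>R K1 x + (- r1) *\<^sub>R ?R (E x $ 2) \<and>
      block_apply (L x) (E x) $ 2 = (b *\<^sub>R K1 x + e *\<^sub>R K2 x) + r1 *\<^sub>R ?R (E x $ 1)"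
    proof (cases rule: two_phase_cases[OF ms x, of "isotropic_phase \<sigma>1 r1" "isotropic_phase \<sigma>2 r2"])
      case 1
      have L: "L x = isotropic_phase \<sigma>1 r1" using 1(2) by (simp add: L_def)
      show ?thesis
        unfolding L block_apply_isotropic ph1[OF 1(1)] F1 F2 s11 s12 s21 s22 lin
        by (simp add: algebra_simps)
    next
      case 2
      have L: "L x = isotropic_phase \<sigma>2 r2" using 2(2) by (simp add: L_def)
      have r: "r2 = r1 + \<rho> * (c * e)" using r2 by (simp add: s_def[symmetric] sc)
      show ?thesis
        unfolding L block_apply_isotropic ph2[OF 2(1)] F1 F2 \<sigma>2 vector_scaleR_component s11 s12 s21 s22 r lin
        by (simp add: algebra_simps)
    qed
    then show "block_apply (L x) (E x) $ 1 = c *\<^sub>R K1 x + (- r1) *\<^sub>R ?R (E x $ 2)"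
      "block_apply (L x) (E x) $ 2 = (b *\<^sub>R K1 x + e *\<^sub>R K2 x) + r1 *\<^sub>R ?R (E x $ 1)" by blast+
  qed
  \<comment> \<open>A constant plus a gradient stays divergence-free after rotation, so the term
    \<open>r1 T E\<close> is harmless; its mean is \<open>r1 T E0\<close>.\<close>
  have dRE: "div_free (\<lambda>x. ?R (E x $ i))" for i
    using exhaust_2[of i] div_free_add[OF div_free_const div_free_rotated_gradient[OF G(1)], of "?R (E0 $ 1)"]
      div_free_add[OF div_free_const div_free_rotated_gradient[OF G(2)], of "?R (E0 $ 2)"]
    by (auto simp: E1 E2 lin)
  have d1: "div_free (\<lambda>x. c *\<^sub>R K1 x + (- r1) *\<^sub>R ?R (E x $ 2))"
    and d2: "div_free (\<lambda>x. (b *\<^sub>R K1 x + e *\<^sub>R K2 x) + r1 *\<^sub>R ?R (E x $ 1))"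
    by (intro div_free_add div_free_scaleR K dRE)+
  have dJ: "div_free (\<lambda>x. block_apply (L x) (E x) $ i)" for i
  proof -
    have "div_free (\<lambda>x. block_apply (L x) (E x) $ 1)"
      using d1 div_free_cong[OF J(1)] by simp
    moreover have "div_free (\<lambda>x. block_apply (L x) (E x) $ 2)"
      using d2 div_free_cong[OF J(2)] by simp
    ultimately show ?thesis using exhaust_2[of i] by auto
  qed
  have cf: "cell_field L E0 E"
    unfolding cell_field_def using G dJ by (auto simp: E_def[abs_def])
  have intRE: "integrable cell_measure (\<lambda>x. ?R (E x $ i))" for i
    by (intro integrable_square_integrable div_free_square_integrable dRE)
  have intK: "integrable cell_measure K1" "integrable cell_measure K2"
    by (intro integrable_square_integrable div_free_square_integrable K)+
  have meanR: "(\<integral>x. ?R (v + k x) \<partial>cell_measure) = ?R v" if "H1_per \<psi> k" for \<psi> k v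
  proof -
    have ik: "integrable cell_measure k"
      by (rule integrable_square_integrable[OF H1_per_square_integrable[OF that]])
    have "(\<integral>x. ?R (v + k x) \<partial>cell_measure) = ?R (\<integral>x. v + k x \<partial>cell_measure)"
      by (rule integral_bounded_linear[OF matrix_vector_mul_bounded_linear]) (use ik in simp)
    also have "(\<integral>x. v + k x \<partial>cell_measure) = v" using ik H1_per_mean_zero[OF that] by simp
    finally show ?thesis .
  qed
  let ?J = "\<integral>x. block_apply (L x) (E x) \<partial>cell_measure"
  have iJ: "integrable cell_measure (\<lambda>x. block_apply (L x) (E x))"
    by (rule integrable_square_integrable[OF cell_field_square_integrable_flux[OF cf]])
  have "?J $ 1 = (\<integral>x. c *\<^sub>R K1 x + (- r1) *\<^sub>R ?R (E x $ 2) \<partial>cell_measure)"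
    unfolding cell_mean_nth[OF iJ] by (intro Bochner_Integration.integral_cong) (auto simp: J(1))
  also have "\<dots> = c *\<^sub>R (\<alpha> *\<^sub>R (S *v X) - \<beta> *\<^sub>R ?R Y) - r1 *\<^sub>R ?R (E0 $ 2)"
    using intK intRE meanR[OF G(2), of "E0 $ 2", folded E2] by (simp add: M1)
  finally have J1: "?J $ 1 = c *\<^sub>R (\<alpha> *\<^sub>R (S *v X) - \<beta> *\<^sub>R ?R Y) - r1 *\<^sub>R ?R (E0 $ 2)" .
  have "?J $ 2 = (\<integral>x. (b *\<^sub>R K1 x + e *\<^sub>R K2 x) + r1 *\<^sub>R ?R (E x $ 1) \<partial>cell_measure)"
    unfolding cell_mean_nth[OF iJ] by (intro Bochner_Integration.integral_cong) (auto simp: J(2))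
  also have "\<dots> = b *\<^sub>R (\<alpha> *\<^sub>R (S *v X) - \<beta> *\<^sub>R ?R Y) + e *\<^sub>R (\<alpha> *\<^sub>R (S *v Y) + \<beta> *\<^sub>R ?R X) + r1 *\<^sub>R ?R (E0 $ 1)"
    using intK intRE meanR[OF G(1), of "E0 $ 1", folded E1] by (simp add: M1 M2)
  finally have J2: "?J $ 2 = b *\<^sub>R (\<alpha> *\<^sub>R (S *v X) - \<beta> *\<^sub>R ?R Y)
     + e *\<^sub>R (\<alpha> *\<^sub>R (S *v Y) + \<beta> *\<^sub>R ?R X) + r1 *\<^sub>R ?R (E0 $ 1)" .
  have coeff: "r1 + a * (1 - det S) * sqrt (det \<sigma>1) / (det S - a\<^sup>2) = r1 + \<beta> * (c * e)"
    unfolding \<beta>_def s_def[symmetric] sc by simp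
  have "block_apply (\<alpha> *\<^sub>R kron \<sigma>1 S + (r1 + \<beta> * (c * e)) *\<^sub>R T_op) E0 $ 1 = ?J $ 1"
    unfolding J1 block_apply_nth s11 s12 X_def Y_def lin by (simp add: algebra_simps)
  moreover have "block_apply (\<alpha> *\<^sub>R kron \<sigma>1 S + (r1 + \<beta> * (c * e)) *\<^sub>R T_op) E0 $ 2 = ?J $ 2"
    unfolding J2 block_apply_nth s21 s22 X_def Y_def lin by (simp add: algebra_simps)
  ultimately have "block_apply (\<alpha> *\<^sub>R kron \<sigma>1 S + (r1 + \<beta> * (c * e)) *\<^sub>R T_op) E0 = ?J"
    by (simp add: vec_eq_iff[of _ ?J] forall_2)
  then show ?thesis using cf unfolding \<alpha>_def[symmetric] coeff by blast
qed

text \<open>The conclusion also records nonzero denominators and positive arguments of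
  \<open>Sigma_eff\<close>, so that no formula rests on the convention for division by zero.\<close>

theorem mainTheorem11:
  fixes A1 A2 :: "(real^2) set"
    and \<sigma>0 \<sigma>1 \<sigma>2 \<sigma>s :: "real^2^2"
    and \<theta>1 \<theta>2 r1 r2 \<rho> a0 h h' :: real
  assumes "microstructure A1 A2"
    and "pos_def_phase \<sigma>1 r1" and "pos_def_phase \<sigma>2 r2"
    and "\<theta>1 > 0" and "\<theta>2 > 0" and "sym_pos_def \<sigma>0"
    and "\<sigma>1 = \<theta>1 *\<^sub>R \<sigma>0" and "\<sigma>2 = \<theta>2 *\<^sub>R \<sigma>0"
    and "\<bar>r1 - r2\<bar> < \<bar>\<theta>1 - \<theta>2\<bar> * sqrt (det \<sigma>0)"
    and "\<rho> = (r2 - r1) / sqrt (det \<sigma>1)"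
    and "(a0\<^sup>2 + 1) * \<rho> = a0 * (\<theta>2\<^sup>2 / \<theta>1\<^sup>2 - \<rho>\<^sup>2 - 1)"
    and "h = (1 - a0\<^sup>2) * \<theta>1 * \<theta>2 / (\<theta>2\<^sup>2 - \<theta>1\<^sup>2 * (\<rho> + a0)\<^sup>2)"
    and "h' = \<theta>1 / \<theta>2 * (\<rho> * a0 + 1)"
    and "\<sigma>s = Sigma_eff A1 A2 h"
  shows "\<theta>2\<^sup>2 - \<theta>1\<^sup>2 * (\<rho> + a0)\<^sup>2 \<noteq> 0 \<and> h > 0 \<and> h' > 0
       \<and> Sigma_eff A1 A2 h = Sigma_eff A1 A2 h'
       \<and> det \<sigma>s - a0\<^sup>2 \<noteq> 0
       \<and> effective_tensor (two_phase A1 A2 (isotropic_phase \<sigma>1 r1) (isotropic_phase \<sigma>2 r2))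
         = ((1 - a0\<^sup>2) / (det \<sigma>s - a0\<^sup>2)) *\<^sub>R kron \<sigma>1 \<sigma>s
           + (r1 + a0 * (1 - det \<sigma>s) * sqrt (det \<sigma>1) / (det \<sigma>s - a0\<^sup>2)) *\<^sub>R T_op"
proof -
  note ms = assms(1) and pd = assms(2,3) and \<theta>1 = assms(4) and \<theta>2 = assms(5)
  define t where "t = \<theta>2 / \<theta>1"
  have t: "0 < t" and \<theta>2t: "\<theta>2 = t * \<theta>1" using \<theta>1 \<theta>2 by (simp_all add: t_def)
  have d0: "0 < det \<sigma>0" by (rule sym_pos_def_entries(3)[OF assms(6)])
  have "det \<sigma>1 = \<theta>1\<^sup>2 * det \<sigma>0"
    by (simp add: assms(7) det_2 power2_eq_square algebra_simps)
  then have sq: "sqrt (det \<sigma>1) = \<theta>1 * sqrt (det \<sigma>0)"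
    using \<theta>1 by (simp add: real_sqrt_mult)
  have sq0: "0 < sqrt (det \<sigma>1)" using sq \<theta>1 d0 by simp
  have r2: "r2 = r1 + \<rho> * sqrt (det \<sigma>1)" using sq0 by (simp add: assms(10))
  \<comment> \<open>Dividing the bound on \<open>r1 - r2\<close> by
    \<open>sqrt (det \<sigma>1) = \<theta>1 sqrt (det \<sigma>0)\<close> reduces it to
    \<open>|\<rho>| < |t - 1|\<close>.\<close>
  have "\<bar>\<rho>\<bar> * sqrt (det \<sigma>1) = \<bar>r1 - r2\<bar>"
    using sq0 by (simp add: assms(10) abs_divide abs_minus_commute)
  also have "\<dots> < \<bar>\<theta>1 - \<theta>2\<bar> * sqrt (det \<sigma>0)" by (rule assms(9))
  also have "\<bar>\<theta>1 - \<theta>2\<bar> = \<theta>1 * \<bar>t - 1\<bar>"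
  proof -
    have "\<theta>1 - \<theta>2 = \<theta>1 * (1 - t)" by (simp add: \<theta>2t algebra_simps)
    then show ?thesis using \<theta>1 by (simp add: abs_mult abs_minus_commute)
  qed
  also have "\<theta>1 * \<bar>t - 1\<bar> * sqrt (det \<sigma>0) = \<bar>t - 1\<bar> * sqrt (det \<sigma>1)" by (simp add: sq)
  finally have \<rho>: "\<bar>\<rho>\<bar> < \<bar>t - 1\<bar>" using sq0 by (simp add: mult_less_cancel_right)
  have "\<theta>2\<^sup>2 / \<theta>1\<^sup>2 = t\<^sup>2" by (simp add: t_def power_divide)
  with assms(11) have eq: "(a0\<^sup>2 + 1) * \<rho> = a0 * (t\<^sup>2 - \<rho>\<^sup>2 - 1)" by simp
  note rt = root_identities[OF t \<rho> eq]
  have den: "\<theta>2\<^sup>2 - \<theta>1\<^sup>2 * (\<rho> + a0)\<^sup>2 = \<theta>1\<^sup>2 * (t\<^sup>2 - (\<rho> + a0)\<^sup>2)"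
    by (simp add: \<theta>2t algebra_simps power2_eq_square)
  then have den0: "\<theta>2\<^sup>2 - \<theta>1\<^sup>2 * (\<rho> + a0)\<^sup>2 \<noteq> 0" using \<theta>1 rt(5) by simp
  have h': "h' = (1 + \<rho> * a0) / t" unfolding assms(13) \<theta>2t using \<theta>1 by (simp add: add.commute)
  have "h = (1 - a0\<^sup>2) * t / (t\<^sup>2 - (\<rho> + a0)\<^sup>2)"
    unfolding assms(12) den using \<theta>1 by (simp add: \<theta>2t power2_eq_square)
  also have "\<dots> = (1 + \<rho> * a0) / t"
    using rt(4,5) t by (simp add: frac_eq_eq power2_eq_square mult.assoc)
  finally have h: "h = (1 + \<rho> * a0) / t" .
  have hh': "h = h'" using h h' by simp
  have hpos: "0 < h" using h t rt(3) by simp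
  \<comment> \<open>The two conditions for decoupling in the second phase.\<close>
  have th: "t * h = 1 + \<rho> * a0" using h t by simp
  have ta: "t * a0 = h * (a0 + \<rho>)"
    using rt(1) t by (simp add: h field_simps power2_eq_square)
  \<comment> \<open>The last root identity divided by \<open>t^2\<close>; the positive factor is
    \<open>h / t\<close>.\<close>
  have sgn: "h\<^sup>2 - a0\<^sup>2 = ((1 + \<rho> * a0) / t\<^sup>2) * (1 - a0\<^sup>2)"
    using rt(6) t by (simp add: h power_divide field_simps)
  have dS: "det (Sigma_eff A1 A2 h) \<noteq> a0\<^sup>2"
    by (rule det_Sigma_eff_neq[OF ms hpos rt(2) sgn]) (use rt(3) t in simp)
  define L where "L = two_phase A1 A2 (isotropic_phase \<sigma>1 r1) (isotropic_phase \<sigma>2 r2)"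
  define M where "M = ((1 - a0\<^sup>2) / (det \<sigma>s - a0\<^sup>2)) *\<^sub>R kron \<sigma>1 \<sigma>s
           + (r1 + a0 * (1 - det \<sigma>s) * sqrt (det \<sigma>1) / (det \<sigma>s - a0\<^sup>2)) *\<^sub>R T_op"
  have sp: "sym_pos_def \<sigma>1" using pd(1) by (simp add: pos_def_phase_def)
  have \<sigma>2: "\<sigma>2 = t *\<^sub>R \<sigma>1" by (simp add: assms(7,8) \<theta>2t)
  have M: "\<exists>E. cell_field L E0 E \<and> block_apply M E0 = (\<integral>x. block_apply (L x) (E x) \<partial>cell_measure)" for E0
    unfolding M_def L_def assms(14)
    by (rule isotropic_cell_field[OF ms hpos th ta rt(2) dS sp \<sigma>2 r2])
  have "effective_tensor L = M"
    unfolding effective_tensor_def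
  proof (rule the_equality)
    show "\<forall>E0. \<exists>E. cell_field L E0 E \<and> block_apply M E0 = (\<integral>x. block_apply (L x) (E x) \<partial>cell_measure)"
      using M by blast
    fix M' assume M': "\<forall>E0. \<exists>E. cell_field L E0 E \<and> block_apply M' E0 = (\<integral>x. block_apply (L x) (E x) \<partial>cell_measure)"
    \<comment> \<open>Both operators report the mean flux of a cell field for the same
      \<open>E0\<close>, and these means agree.\<close>
    have "block_apply M' E0 = block_apply M E0" for E0
    proof -
      obtain E where E: "cell_field L E0 E" "block_apply M E0 = (\<integral>x. block_apply (L x) (E x) \<partial>cell_measure)"
        using M by blast
      obtain E' where E': "cell_field L E0 E'" "block_apply M' E0 = (\<integral>x. block_apply (L x) (E' x) \<partial>cell_measure)"
        using M' by blast
      show ?thesis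
        unfolding E(2) E'(2) using cell_field_mean_unique[OF ms pd] E(1) E'(1) unfolding L_def by blast
    qed
    then show "M' = M" by (simp add: block_apply_eq_iff[symmetric])
  qed
  then show ?thesis
    using den0 hpos hh' dS unfolding L_def M_def assms(14) by auto
qed

end
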